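(* A matroid is in $\mathcal{P}_{1,q}$ iff it contains no minor isomorphic to any of the matroids $U_{2,4}$, $M(K_4)$, $M(K_{2,3})$ and $M^*(K_{2,3})$.
   Context: $\mathcal{P}_{1,q}$ is the class of matroids representable over the finite field $\mathbb{F}_q=GF(q)$ that have pathwidth at most $1$. For a matroid $M$ with ground set $E(M)$ and rank function $r_M$, $\lambda_M(X) = r_M(X)+r_M(E(M)-X)-r_M(E(M))$ (no "$+1$"), the width of an ordering $(e_1,\ldots,e_n)$ of $E(M)$ is $\max_i\lambda_M(\{e_1,\ldots,e_i\})$, and the pathwidth is the minimum width over all orderings. $M(H)$ denotes the cycle matroid of a graph $H$ and $M^*$ the dual matroid. *)

theory Defs
  imports Complex_Main
begin

section \<open>Matroids\<close>

text \<open>A set system is a candidate matroid, given by its ground set and its independent sets.\<close>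

record 'a set_system =
  ground :: "'a set"
  indeps :: "'a set set"

locale matroid =
  fixes M :: "'a set_system"
  assumes finite_ground: "finite (ground M)"
    and indeps_subset: "I \<in> indeps M \<Longrightarrow> I \<subseteq> ground M"
    and empty_indep: "{} \<in> indeps M"
    and indep_mono: "J \<in> indeps M \<Longrightarrow> I \<subseteq> J \<Longrightarrow> I \<in> indeps M"
    and augment: "I \<in> indeps M \<Longrightarrow> J \<in> indeps M \<Longrightarrow> card I < card J
      \<Longrightarrow> \<exists>x\<in>J - I. insert x I \<in> indeps M"

definition basis :: "'a set_system \<Rightarrow> 'a set \<Rightarrow> bool" where
  "basis M B \<longleftrightarrow> B \<in> indeps M \<and> (\<forall>I\<in>indeps M. B \<subseteq> I \<longrightarrow> I = B)"

definition rank :: "'a set_system \<Rightarrow> 'a set \<Rightarrow> nat" where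
  "rank M X = Max (card ` {I \<in> indeps M. I \<subseteq> X})"

text \<open>The bases of the dual are the complements of the bases.\<close>

definition dual :: "'a set_system \<Rightarrow> 'a set_system" where
  "dual M = \<lparr>ground = ground M,
     indeps = {X. X \<subseteq> ground M \<and> (\<exists>B. basis M B \<and> X \<subseteq> ground M - B)}\<rparr>"

definition delete :: "'a set_system \<Rightarrow> 'a set \<Rightarrow> 'a set_system" where
  "delete M D = \<lparr>ground = ground M - D, indeps = {I \<in> indeps M. I \<subseteq> ground M - D}\<rparr>"

definition contract :: "'a set_system \<Rightarrow> 'a set \<Rightarrow> 'a set_system" where
  "contract M C = dual (delete (dual M) C)"

definition matroid_iso :: "'a set_system \<Rightarrow> 'b set_system \<Rightarrow> bool" where
  "matroid_iso M N \<longleftrightarrow> (\<exists>f. bij_betw f (ground M) (ground N) \<and>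
     (\<forall>X \<subseteq> ground M. X \<in> indeps M \<longleftrightarrow> f ` X \<in> indeps N))"

definition minor :: "'a set_system \<Rightarrow> 'a set_system \<Rightarrow> bool" where
  "minor N M \<longleftrightarrow> (\<exists>C D. C \<subseteq> ground M \<and> D \<subseteq> ground M \<and> C \<inter> D = {} \<and>
     N = delete (contract M C) D)"

definition has_minor_iso :: "'a set_system \<Rightarrow> 'b set_system \<Rightarrow> bool" where
  "has_minor_iso M N \<longleftrightarrow> (\<exists>M'. minor M' M \<and> matroid_iso M' N)"


section \<open>Representability\<close>

text \<open>A vector of \<open>F\<^sup>n\<close> is given by the values at \<open>i < n\<close> of a function on \<open>nat\<close>. Linear
  independence is that of the family \<open>(v x)\<close>, \<open>x \<in> X\<close>, not of the set \<open>v ` X\<close>: parallel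
  elements may be represented by equal vectors.\<close>

definition lin_indep_family :: "nat \<Rightarrow> ('a \<Rightarrow> nat \<Rightarrow> 'f::field) \<Rightarrow> 'a set \<Rightarrow> bool" where
  "lin_indep_family n v X \<longleftrightarrow>
     (\<forall>c. (\<forall>i<n. (\<Sum>x\<in>X. c x * v x i) = 0) \<longrightarrow> (\<forall>x\<in>X. c x = 0))"

definition representable :: "'f::field itself \<Rightarrow> 'a set_system \<Rightarrow> bool" where
  "representable _ M \<longleftrightarrow> (\<exists>n (v :: 'a \<Rightarrow> nat \<Rightarrow> 'f).
     \<forall>X \<subseteq> ground M. X \<in> indeps M \<longleftrightarrow> lin_indep_family n v X)"


section \<open>Pathwidth\<close>

definition connectivity :: "'a set_system \<Rightarrow> 'a set \<Rightarrow> int" where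
  "connectivity M X =
     int (rank M X) + int (rank M (ground M - X)) - int (rank M (ground M))"

definition orderings :: "'a set_system \<Rightarrow> 'a list set" where
  "orderings M = {es. distinct es \<and> set es = ground M}"

text \<open>The empty prefix is included so that the maximum is over a nonempty set even when the
  ground set is empty. This does not change the maximum otherwise: in a matroid the empty prefix
  contributes 0, and connectivity is never negative.\<close>

definition ordering_width :: "'a set_system \<Rightarrow> 'a list \<Rightarrow> int" where
  "ordering_width M es = Max ((\<lambda>i. connectivity M (set (take i es))) ` {0..length es})"

definition pathwidth :: "'a set_system \<Rightarrow> int" where
  "pathwidth M = Min (ordering_width M ` orderings M)"

text \<open>The class \<open>\<P>\<^bsub>w,q\<^esub>\<close>, where the type \<open>'f\<close> is the field \<open>GF(q)\<close>, \<open>q = CARD('f)\<close>.\<close>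

definition pathwidth_class :: "nat \<Rightarrow> 'f::{field,finite} itself \<Rightarrow> 'a set_system set" where
  "pathwidth_class w F = {M. matroid M \<and> representable F M \<and> pathwidth M \<le> int w}"


section \<open>Uniform matroids and cycle matroids\<close>

definition uniform_matroid :: "nat \<Rightarrow> nat \<Rightarrow> nat set_system" where
  "uniform_matroid k n = \<lparr>ground = {..<n}, indeps = {I. I \<subseteq> {..<n} \<and> card I \<le> k}\<rparr>"

text \<open>Simple graphs; an edge is the set of its two ends.\<close>

record 'v graph =
  verts :: "'v set"
  edges :: "'v set set"

definition complete_graph :: "nat \<Rightarrow> nat graph" where
  "complete_graph n = \<lparr>verts = {..<n}, edges = {{u, v} |u v. u < n \<and> v < n \<and> u \<noteq> v}\<rparr>"

definition complete_bipartite_graph :: "nat \<Rightarrow> nat \<Rightarrow> (nat + nat) graph" where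
  "complete_bipartite_graph m n = \<lparr>verts = Inl ` {..<m} \<union> Inr ` {..<n},
     edges = {{Inl i, Inr j} |i j. i < m \<and> j < n}\<rparr>"

definition cycle_edges :: "'v list \<Rightarrow> 'v set set" where
  "cycle_edges vs = (\<lambda>i. {vs ! i, vs ! (Suc i mod length vs)}) ` {..<length vs}"

definition is_cycle :: "'v graph \<Rightarrow> 'v list \<Rightarrow> bool" where
  "is_cycle H vs \<longleftrightarrow> distinct vs \<and> length vs \<ge> 3 \<and> set vs \<subseteq> verts H \<and> cycle_edges vs \<subseteq> edges H"

definition cycle_matroid :: "'v graph \<Rightarrow> 'v set set_system" where
  "cycle_matroid H = \<lparr>ground = edges H,
     indeps = {F. F \<subseteq> edges H \<and> (\<nexists>vs. is_cycle H vs \<and> cycle_edges vs \<subseteq> F)}\<rparr>"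

end

theory Submission
  imports Defs
begin

text \<open>An ordering of width one builds the matroid by adding loops and coloops and by adding elements in
  parallel or in series: its first two elements are parallel or in series unless one of them is a loop or
  a coloop. Hence such a matroid is representable over every field. The class is closed under minors,
  since connectivity does not increase, and each excluded minor has connectivity at least 2 on every set
  of half its elements.

  For the converse, induct on the size of a matroid \<open>M\<close> without these minors. Orderings of the
  components of \<open>M\<close> can be concatenated, so let \<open>M\<close> be connected.
  If \<open>e\<close> and \<open>f\<close> are parallel, let \<open>X\<close> and \<open>Y\<close> be the sets before and after \<open>f\<close> in an ordering of \<open>M - e\<close>.
  Inserting \<open>e\<close> next to \<open>f\<close> fails only when \<open>f\<close> is in series with both sides. If \<open>X\<close> or \<open>Y\<close> is
  independent, then moving \<open>e, f\<close> to that end works; otherwise contracting most of \<open>X\<close> and of \<open>Y\<close>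
  gives a triangle with doubled edges, which is \<open>M\<^sup>*(K\<^sub>2\<^sub>,\<^sub>3)\<close>. Series pairs are dual.
  If \<open>M\<close> is simple and cosimple, the two ends of an ordering of \<open>M - e\<close> give two triads
  meeting only in \<open>e\<close>, and those of \<open>M / e\<close> two triangles. Without a \<open>U\<^sub>2\<^sub>,\<^sub>4\<close> minor a triangle and a
  triad meet in no or in two elements, and this forces \<open>M = M(K\<^sub>4)\<close>.\<close>

section \<open>Rank functions\<close>

text \<open>The argument runs on integer-valued rank functions rather than on set systems. Deletion
  keeps the function and shrinks the ground set, while contraction and duality are explicit
  formulas, so the induction stays inside one locale and whatever is shown for parallel pairs or
  triangles applies to series pairs and triads by instantiating it with the dual. For this the list
  of excluded minors must be closed under duality: \<open>U\<^sub>2\<^sub>,\<^sub>4\<close> is its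
  own dual, and \<open>M(K\<^sub>2\<^sub>,\<^sub>3)\<close> and its dual are exchanged. The other
  obstacle is to recognise an excluded minor inside an abstract rank function. All four are sparse
  paving: for a fixed \<open>k\<close> the sets with fewer than \<open>k\<close> elements are
  independent, those with more are dependent, and only a short list of \<open>k\<close>-sets is
  exceptional. Hence only \<open>k\<close>-sets have to be examined, and the link with graphs is a
  finite computation on six edges. The six elements of \<open>M(K\<^sub>4)\<close> arise as follows:
  the triangles and triads found span, from three elements each, a six-element set of rank and dual
  rank at most 3. Its connectivity is at most 3 + 3 - 6 = 0, so in a connected matroid it is the
  whole ground set.\<close>

locale rank_function =
  fixes E :: "'a set" and r :: "'a set \<Rightarrow> int"
  assumes finite_E: "finite E"
    and r_empty: "r {} = 0"
    and r_mono: "X \<subseteq> Y \<Longrightarrow> Y \<subseteq> E \<Longrightarrow> r X \<le> r Y"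
    and r_card: "X \<subseteq> E \<Longrightarrow> r X \<le> int (card X)"
    and submodular: "X \<subseteq> E \<Longrightarrow> Y \<subseteq> E \<Longrightarrow> r (X \<union> Y) + r (X \<inter> Y) \<le> r X + r Y"

definition dual_rank :: "'a set \<Rightarrow> ('a set \<Rightarrow> int) \<Rightarrow> 'a set \<Rightarrow> int" where
  "dual_rank E r X = int (card X) + r (E - X) - r E"

text \<open>Deletion has no such counterpart: a minor is \<open>contract_rank r C\<close> on a
  smaller ground set.\<close>

definition contract_rank :: "('a set \<Rightarrow> int) \<Rightarrow> 'a set \<Rightarrow> 'a set \<Rightarrow> int" where
  "contract_rank r C X = r (X \<union> C) - r C"

definition conn :: "'a set \<Rightarrow> ('a set \<Rightarrow> int) \<Rightarrow> 'a set \<Rightarrow> int" where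
  "conn E r X = r X + r (E - X) - r E"

context rank_function
begin

lemma finite_sub: "X \<subseteq> E \<Longrightarrow> finite X"
  using finite_E finite_subset by blast

lemma card_split:
  assumes "X \<subseteq> Y" "Y \<subseteq> E"
  shows "card Y = card X + card (Y - X)"
proof -
  have "card (X \<union> (Y - X)) = card X + card (Y - X)"
    by (rule card_Un_disjoint) (use assms finite_sub[of Y] finite_subset[of X Y] in auto)
  then show ?thesis using assms by (simp add: Un_absorb1)
qed

lemma r_nonneg: "X \<subseteq> E \<Longrightarrow> 0 \<le> r X"
  using r_mono[of "{}" X] r_empty by simp

lemma r_union_le: "X \<subseteq> E \<Longrightarrow> Y \<subseteq> E \<Longrightarrow> r (X \<union> Y) \<le> r X + r Y"
  using submodular[of X Y] r_nonneg[of "X \<inter> Y"] by fastforce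

lemma r_single_le: "x \<in> E \<Longrightarrow> r {x} \<le> 1"
  using r_card[of "{x}"] by simp

lemma r_insert_le: "X \<subseteq> E \<Longrightarrow> x \<in> E \<Longrightarrow> r (insert x X) \<le> r X + 1"
  using r_union_le[of X "{x}"] r_single_le[of x] by simp

lemma r_le_insert: "X \<subseteq> E \<Longrightarrow> x \<in> E \<Longrightarrow> r X \<le> r (insert x X)"
  by (rule r_mono) auto

lemma r_union_card: "X \<subseteq> E \<Longrightarrow> Y \<subseteq> E \<Longrightarrow> r (X \<union> Y) \<le> r X + int (card Y)"
  using r_union_le[of X Y] r_card[of Y] by linarith

text \<open>Diminishing returns: submodularity for \<open>Y\<close> and \<open>insert x X\<close>,
  which meet in \<open>X\<close> when \<open>x\<close> is outside \<open>Y\<close>.\<close>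

lemma r_insert_mono:
  assumes "X \<subseteq> Y" "Y \<subseteq> E" "x \<in> E"
  shows "r (insert x Y) - r Y \<le> r (insert x X) - r X"
proof (cases "x \<in> Y")
  case True
  then show ?thesis using r_le_insert[of X x] assms by (simp add: insert_absorb)
next
  case False
  have "Y \<union> insert x X = insert x Y" "Y \<inter> insert x X = X" using assms False by auto
  moreover have "X \<subseteq> E" using assms by blast
  ultimately show ?thesis using submodular[of Y "insert x X"] assms by auto
qed

lemma spanned_mono:
  assumes "X \<subseteq> Y" "Y \<subseteq> E" "x \<in> E" "r (insert x X) = r X"
  shows "r (insert x Y) = r Y"
  using r_insert_mono[OF assms(1,2,3)] r_le_insert[OF assms(2,3)] assms(4) by linarith

lemma indep_sub:
  assumes "I \<subseteq> J" "J \<subseteq> E" "r J = int (card J)"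
  shows "r I = int (card I)"
proof -
  have "I \<subseteq> E" using assms by blast
  then have "r J \<le> r I + int (card (J - I))"
    using r_union_card[of I "J - I"] assms by (auto simp: Un_absorb1)
  then show ?thesis using card_split[of I J] r_card[of I] \<open>I \<subseteq> E\<close> assms by auto
qed

lemma spanned_union:
  assumes "X \<subseteq> E" "Y \<subseteq> E" "\<And>y. y \<in> Y \<Longrightarrow> r (insert y X) = r X"
  shows "r (X \<union> Y) = r X"
proof -
  have "finite Y" using assms finite_sub by blast
  then show ?thesis using assms(2,3)
  proof (induction Y)
    case empty
    then show ?case by simp
  next
    case (insert y Y)
    have "r (insert y (X \<union> Y)) = r (X \<union> Y)"
      by (rule spanned_mono[of X]) (use insert assms(1) in auto)
    then show ?case using insert by simp
  qed
qed

lemma ex_basis: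
  assumes "I \<subseteq> A" "A \<subseteq> E" "r I = int (card I)"
  obtains B where "I \<subseteq> B" "B \<subseteq> A" "r B = int (card B)" "r B = r A"
proof -
  let ?P = "\<lambda>B. I \<subseteq> B \<and> B \<subseteq> A \<and> r B = int (card B)"
  have fA: "finite A" using assms finite_sub by blast
  have "\<forall>B. ?P B \<longrightarrow> card B < Suc (card A)" using fA by (auto simp: less_Suc_eq_le intro: card_mono)
  then obtain B where B: "?P B" and mx: "\<And>B'. ?P B' \<Longrightarrow> card B' \<le> card B"
    using ex_has_greatest_nat[of ?P I card "Suc (card A)"] assms(1,3) by auto
  have "r (insert y B) = r B" if "y \<in> A" for y
  proof (rule ccontr)
    assume ne: "r (insert y B) \<noteq> r B"
    then have nin: "y \<notin> B" by (auto simp: insert_absorb)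
    have "B \<subseteq> E" "y \<in> E" using B that assms by auto
    then have "r (insert y B) = r B + 1"
      using ne r_le_insert[of B y] r_insert_le[of B y] by linarith
    then have "?P (insert y B)" using B nin that fA finite_subset[of B A] by auto
    then show False using mx[of "insert y B"] nin B fA finite_subset[of B A] by auto
  qed
  then have "r (B \<union> A) = r B" using spanned_union[of B A] B assms by auto
  then have "r B = r A" using B by (simp add: Un_absorb1)
  with B show thesis using that by blast
qed

text \<open>\<open>insert x D\<close> is the fundamental circuit when \<open>x\<close> is outside
  \<open>B\<close>. \<open>D\<close> is a smallest subset of \<open>B\<close> spanning
  \<open>x\<close>; if some \<open>b\<close> in \<open>D\<close> could not be exchanged for
  \<open>x\<close>, submodularity would show that \<open>D - {b}\<close> already spans
  \<open>x\<close>.\<close>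

lemma fundamental:
  assumes B: "B \<subseteq> E" "r B = int (card B)" and x: "x \<in> E" "r (insert x B) = int (card B)"
  obtains D where "D \<subseteq> B" "r (insert x D) = int (card D)"
    "\<And>b. b \<in> D \<Longrightarrow> r (insert x (B - {b})) = int (card B)"
proof -
  let ?P = "\<lambda>D. D \<subseteq> B \<and> r (insert x D) = int (card D)"
  obtain D where D: "?P D" and mn: "\<And>D'. ?P D' \<Longrightarrow> card D \<le> card D'"
    using ex_has_least_nat[of ?P B card] x by auto
  have fB: "finite B" using B finite_sub by blast
  have "r (insert x (B - {b})) = int (card B)" if b: "b \<in> D" for b
  proof (rule ccontr)
    assume ne: "r (insert x (B - {b})) \<noteq> int (card B)"
    have "r (insert x (B - {b})) \<le> r (insert x B)" by (rule r_mono) (use B x in auto)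
    then have lt: "r (insert x (B - {b})) \<le> int (card B) - 1" using ne x by auto
    \<comment> \<open>If \<open>x\<close> lies in \<open>B\<close>, then \<open>{x}\<close> competes
      with \<open>D\<close>, so \<open>D\<close> has at most one element. This is what makes the
      intersection below equal to \<open>insert x (D - {b})\<close>.\<close>
    have xD: "x \<notin> D - {b}"
    proof
      assume xd: "x \<in> D - {b}"
      then have "insert x (B - {b}) = B - {b}" "insert x B = B" "insert x D = D" "{x} \<subseteq> D"
        using D by auto
      moreover have "r {x} = 1" using indep_sub[of "{x}" B] xd D B by auto
      ultimately have "?P {x}" using D by auto
      then have "card D \<le> 1" using mn[of "{x}"] by auto
      then show False using xd b D fB card_le_Suc0_iff_eq[of D] finite_subset[of D B] by auto
    qed
    have "insert x D \<union> insert x (B - {b}) = insert x B"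
      "insert x D \<inter> insert x (B - {b}) = insert x (D - {b})" using D b xD by auto
    moreover have "insert x D \<subseteq> E" "insert x (B - {b}) \<subseteq> E" using D B x by auto
    ultimately have "r (insert x B) + r (insert x (D - {b})) \<le> r (insert x D) + r (insert x (B - {b}))"
      using submodular[of "insert x D" "insert x (B - {b})"] by simp
    then have "r (insert x (D - {b})) \<le> int (card D) - 1" using lt x(2) D by linarith
    moreover have "r (D - {b}) = int (card D) - 1"
    proof -
      have "finite D" using D fB finite_subset by blast
      then have "card D = card (D - {b}) + 1" using b by (metis Suc_eq_plus1 card.remove)
      then show ?thesis using indep_sub[of "D - {b}" B] D B by auto
    qed
    moreover have "r (D - {b}) \<le> r (insert x (D - {b}))" by (rule r_mono) (use D B x in auto)
    ultimately have "r (insert x (D - {b})) = int (card D) - 1" by linarith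
    moreover have "finite D" using D fB finite_subset by blast
    ultimately have "?P (D - {b})" "card (D - {b}) < card D"
      using b D \<open>r (D - {b}) = _\<close> indep_sub[of "D - {b}" B] B card_Diff1_less[of D b] by auto
    then show False using mn[of "D - {b}"] by auto
  qed
  then show thesis using that D by blast
qed

section \<open>Restriction, contraction, duality and pullback of rank functions\<close>

lemma restrict:
  assumes "S \<subseteq> E"
  shows "rank_function S r"
proof
  show "finite S" using assms finite_sub by blast
  show "r {} = 0" by (rule r_empty)
  show "r X \<le> r Y" if "X \<subseteq> Y" "Y \<subseteq> S" for X Y using r_mono that assms by blast
  show "r X \<le> int (card X)" if "X \<subseteq> S" for X using r_card that assms by blast
  show "r (X \<union> Y) + r (X \<inter> Y) \<le> r X + r Y" if "X \<subseteq> S" "Y \<subseteq> S" for X Y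
    using submodular that assms by blast
qed

lemma contract: 
  assumes "C \<union> S \<subseteq> E"
  shows "rank_function S (contract_rank r C)"
proof
  show "finite S" using assms finite_sub by blast
  show "contract_rank r C {} = 0" by (simp add: contract_rank_def)
  show "contract_rank r C X \<le> contract_rank r C Y" if "X \<subseteq> Y" "Y \<subseteq> S" for X Y
    using r_mono[of "X \<union> C" "Y \<union> C"] that assms by (auto simp: contract_rank_def)
  show "contract_rank r C X \<le> int (card X)" if "X \<subseteq> S" for X
  proof -
    have "X \<subseteq> E" using that assms by blast
    then show ?thesis using r_union_card[of C X] assms by (auto simp: contract_rank_def Un_commute)
  qed
  show "contract_rank r C (X \<union> Y) + contract_rank r C (X \<inter> Y) \<le> contract_rank r C X + contract_rank r C Y"
    if "X \<subseteq> S" "Y \<subseteq> S" for X Y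
  proof -
    have "(X \<union> C) \<union> (Y \<union> C) = X \<union> Y \<union> C" "(X \<union> C) \<inter> (Y \<union> C) = X \<inter> Y \<union> C" by auto
    then show ?thesis using submodular[of "X \<union> C" "Y \<union> C"] that assms by (auto simp: contract_rank_def)
  qed
qed

lemma dual: "rank_function E (dual_rank E r)"
proof
  show "finite E" by (rule finite_E)
  show "dual_rank E r {} = 0" by (simp add: dual_rank_def)
  show "dual_rank E r X \<le> dual_rank E r Y" if "X \<subseteq> Y" "Y \<subseteq> E" for X Y
  proof -
    have "E - X = (E - Y) \<union> (Y - X)" using that by auto
    then have "r (E - X) \<le> r (E - Y) + int (card (Y - X))"
      using r_union_card[of "E - Y" "Y - X"] that by auto
    moreover have "card Y = card X + card (Y - X)"
      using card_split that by blast
    ultimately show ?thesis by (simp add: dual_rank_def)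
  qed
  show "dual_rank E r X \<le> int (card X)" if "X \<subseteq> E" for X
    using r_mono[of "E - X" E] by (auto simp: dual_rank_def)
  show "dual_rank E r (X \<union> Y) + dual_rank E r (X \<inter> Y) \<le> dual_rank E r X + dual_rank E r Y"
    if "X \<subseteq> E" "Y \<subseteq> E" for X Y
  proof -
    have "E - X \<union> (E - Y) = E - X \<inter> Y" "(E - X) \<inter> (E - Y) = E - (X \<union> Y)" by auto
    then have "r (E - X \<inter> Y) + r (E - (X \<union> Y)) \<le> r (E - X) + r (E - Y)"
      using submodular[of "E - X" "E - Y"] by auto
    moreover have "card (X \<union> Y) + card (X \<inter> Y) = card X + card Y"
      using that finite_sub card_Un_Int[of X Y] by auto
    ultimately show ?thesis by (auto simp: dual_rank_def)
  qed
qed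

text \<open>Copies a minor found inside \<open>E\<close> onto the ground set of the matroid it is
  isomorphic to.\<close>

lemma pullback:
  assumes "inj_on g G" "finite G" "g ` G \<subseteq> E"
  shows "rank_function G (\<lambda>X. r (g ` X))"
proof
  show "finite G" by fact
  show "r (g ` {}) = 0" by (simp add: r_empty)
  show "r (g ` X) \<le> r (g ` Y)" if "X \<subseteq> Y" "Y \<subseteq> G" for X Y
    using that assms r_mono[of "g ` X" "g ` Y"] by blast
  show "r (g ` X) \<le> int (card X)" if "X \<subseteq> G" for X
  proof -
    have "card (g ` X) = card X" using inj_on_subset[OF assms(1) that] card_image by blast
    then show ?thesis using r_card[of "g ` X"] that assms by auto
  qed
  show "r (g ` (X \<union> Y)) + r (g ` (X \<inter> Y)) \<le> r (g ` X) + r (g ` Y)" if "X \<subseteq> G" "Y \<subseteq> G" for X Y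
  proof -
    have "g ` X \<subseteq> E" "g ` Y \<subseteq> E" using that assms by auto
    then show ?thesis
      using submodular[of "g ` X" "g ` Y"] inj_on_image_Int[OF assms(1) that] by (simp add: image_Un)
  qed
qed

lemma dual_dual: "X \<subseteq> E \<Longrightarrow> dual_rank E (dual_rank E r) X = r X"
proof -
  assume X: "X \<subseteq> E"
  then have "card E = card X + card (E - X)"
    using card_split by blast
  then show ?thesis using X r_empty by (auto simp: dual_rank_def double_diff)
qed

section \<open>Connectivity under duality and in minors\<close>

lemma conn_dual: "X \<subseteq> E \<Longrightarrow> conn E (dual_rank E r) X = conn E r X"
proof -
  assume X: "X \<subseteq> E"
  then have "card E = card X + card (E - X)"
    using card_split by blast
  then show ?thesis using X r_empty by (auto simp: dual_rank_def conn_def double_diff)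
qed

text \<open>Symmetric in the matroid and its dual, so a set of small rank in both is a separator;
  the simple cosimple case ends this way.\<close>

lemma conn_via_dual: "X \<subseteq> E \<Longrightarrow> conn E r X = r X + dual_rank E r X - int (card X)"
  by (simp add: conn_def dual_rank_def)

lemma conn_compl: "X \<subseteq> E \<Longrightarrow> conn E r (E - X) = conn E r X"
  by (simp add: conn_def double_diff)

lemma conn_le_card: "X \<subseteq> E \<Longrightarrow> conn E r X \<le> int (card X)"
  using r_card[of X] r_mono[of "E - X" E] by (auto simp: conn_def)

text \<open>Submodularity for \<open>X\<close> and \<open>S\<close>, then for \<open>E - X\<close>
  and \<open>X \<union> S\<close>; the rank of \<open>X \<union> S\<close> cancels.\<close>

lemma conn_restrict:
  assumes "S \<subseteq> E" "X \<subseteq> E"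
  shows "conn S r (X \<inter> S) \<le> conn E r X"
proof -
  have "r (X \<union> S) + r (X \<inter> S) \<le> r X + r S" using submodular assms by auto
  moreover have "r ((E - X) \<union> (X \<union> S)) + r ((E - X) \<inter> (X \<union> S)) \<le> r (E - X) + r (X \<union> S)"
    using submodular[of "E - X" "X \<union> S"] assms by auto
  moreover have "(E - X) \<union> (X \<union> S) = E" "(E - X) \<inter> (X \<union> S) = S - X \<inter> S" using assms by auto
  ultimately show ?thesis by (simp add: conn_def)
qed

text \<open>Submodularity of each side with \<open>C\<close>; the two intersections cover
  \<open>C\<close>, so their ranks add up to at least \<open>r C\<close>.\<close>

lemma conn_contract:
  assumes "C \<subseteq> E" "X \<subseteq> E"
  shows "conn (E - C) (contract_rank r C) (X - C) \<le> conn E r X"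
proof -
  have "r (X \<union> C) + r (X \<inter> C) \<le> r X + r C" using submodular assms by auto
  moreover have "r ((E - X) \<union> C) + r ((E - X) \<inter> C) \<le> r (E - X) + r C"
    using submodular[of "E - X" C] assms by auto
  moreover have "r (X \<inter> C \<union> (E - X) \<inter> C) \<le> r (X \<inter> C) + r ((E - X) \<inter> C)"
    by (rule r_union_le) (use assms in auto)
  moreover have "X \<inter> C \<union> (E - X) \<inter> C = C" "X - C \<union> C = X \<union> C" "E - C \<union> C = E"
     "E - C - (X - C) \<union> C = (E - X) \<union> C" using assms by auto
  ultimately show ?thesis by (auto simp: conn_def contract_rank_def)
qed

lemma conn_minor:
  assumes "C \<union> S \<subseteq> E" "C \<inter> S = {}" "X \<subseteq> E"
  shows "conn S (contract_rank r C) (X \<inter> S) \<le> conn E r X"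
proof -
  have *: "(X - C) \<inter> S = X \<inter> S" using assms by auto
  interpret c: rank_function "E - C" "contract_rank r C" by (rule contract) (use assms in auto)
  have "conn S (contract_rank r C) ((X - C) \<inter> S) \<le> conn (E - C) (contract_rank r C) (X - C)"
    by (rule c.conn_restrict) (use assms in auto)
  then show ?thesis using conn_contract[of C X] assms * by auto
qed

end

section \<open>Orderings of width one\<close>

text \<open>Prefixes are given by splits of the list, so that a rearranged ordering is treated by
  cases on where the cut falls.\<close>

definition width1 :: "'a set \<Rightarrow> ('a set \<Rightarrow> int) \<Rightarrow> 'a list \<Rightarrow> bool" where
  "width1 E r es \<longleftrightarrow> distinct es \<and> set es = E \<and>
     (\<forall>xs ys. es = xs @ ys \<longrightarrow> conn E r (set xs) \<le> 1)"

lemma width1_conn: "width1 E r (xs @ ys) \<Longrightarrow> conn E r (set xs) \<le> 1"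
  by (auto simp: width1_def)

text \<open>Makes every prefix of the ordering inherited by a minor the trace of a prefix of the
  original ordering.\<close>

lemma filter_eq_append:
  "filter P es = us @ vs \<Longrightarrow> \<exists>xs ys. es = xs @ ys \<and> filter P xs = us \<and> filter P ys = vs"
proof (induction es arbitrary: us)
  case Nil
  then show ?case by simp
next
  case (Cons e es)
  show ?case
  proof (cases "P e \<and> us \<noteq> []")
    case True
    then obtain us' where us: "us = e # us'" "filter P es = us' @ vs"
      using Cons.prems by (cases us) auto
    then obtain xs ys where "es = xs @ ys" "filter P xs = us'" "filter P ys = vs"
      using Cons.IH by blast
    then show ?thesis using us True by (intro exI[of _ "e # xs"] exI[of _ ys]) auto
  next
    case F: False
    show ?thesis
    proof (cases "us = []")
      case True
      then show ?thesis using Cons.prems by (intro exI[of _ "[]"] exI[of _ "e # es"]) auto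
    next
      case False
      then obtain xs ys where "es = xs @ ys" "filter P xs = us" "filter P ys = vs"
        using Cons F by auto
      then show ?thesis using F False by (intro exI[of _ "e # xs"] exI[of _ ys]) auto
    qed
  qed
qed

context rank_function
begin

lemma width1_minor:
  assumes "width1 E r es" "C \<union> S \<subseteq> E" "C \<inter> S = {}"
  shows "width1 S (contract_rank r C) (filter (\<lambda>x. x \<in> S) es)"
  unfolding width1_def
proof (intro conjI allI impI)
  show "distinct (filter (\<lambda>x. x \<in> S) es)" "set (filter (\<lambda>x. x \<in> S) es) = S"
    using assms by (auto simp: width1_def)
  fix us vs assume "filter (\<lambda>x. x \<in> S) es = us @ vs"
  then obtain xs ys where xy: "es = xs @ ys" "filter (\<lambda>x. x \<in> S) xs = us"
    using filter_eq_append[of "\<lambda>x. x \<in> S" es us vs] by blast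
  have "set us = set xs \<inter> S" "set xs \<subseteq> E" using xy assms(1) by (auto simp: width1_def)
  then show "conn S (contract_rank r C) (set us) \<le> 1"
    using conn_minor[OF assms(2,3), of "set xs"] width1_conn[of E r xs ys] assms(1) xy by auto
qed

lemma width1_rev:
  assumes "width1 E r es"
  shows "width1 E r (rev es)"
  unfolding width1_def
proof (intro conjI allI impI)
  show "distinct (rev es)" "set (rev es) = E" using assms by (auto simp: width1_def)
  fix xs ys assume "rev es = xs @ ys"
  then have es: "es = rev ys @ rev xs" by (metis rev_append rev_rev_ident)
  then have "set xs = E - set ys" "set ys \<subseteq> E" using assms by (auto simp: width1_def)
  then show "conn E r (set xs) \<le> 1"
    using conn_compl[of "set ys"] width1_conn[of E r "rev ys" "rev xs"] assms es by auto
qed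

lemma width1_dual:
  assumes "width1 E (dual_rank E r) es"
  shows "width1 E r es"
  unfolding width1_def
proof (intro conjI allI impI)
  show "distinct es" "set es = E" using assms by (auto simp: width1_def)
  fix xs ys assume es: "es = xs @ ys"
  then have "set xs \<subseteq> E" using assms by (auto simp: width1_def)
  then show "conn E r (set xs) \<le> 1"
    using conn_dual[of "set xs"] width1_conn[of E "dual_rank E r" xs ys] assms es by simp
qed

text \<open>With at most three elements one side of every cut has at most one element, and
  connectivity is at most the size of either side.\<close>

lemma width1_small:
  assumes "card E \<le> 3"
  shows "\<exists>es. width1 E r es"
proof -
  obtain es where es: "distinct es" "set es = E" using finite_distinct_list[OF finite_E] by blast
  have "conn E r (set xs) \<le> 1" if "es = xs @ ys" for xs ys
  proof -
    have s: "set xs \<subseteq> E" "E - set xs = set ys" "set ys \<subseteq> E" using that es by auto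
    have "length xs + length ys \<le> 3" using es that assms distinct_card[of es] by auto
    then consider "length xs \<le> 1" | "length ys \<le> 1" by linarith
    then show ?thesis
    proof cases
      case 1
      then show ?thesis using conn_le_card[OF s(1)] card_length[of xs] by linarith
    next
      case 2
      then show ?thesis using conn_le_card[OF s(3)] card_length[of ys] conn_compl[OF s(1)] s by auto
    qed
  qed
  then show ?thesis using es by (auto simp: width1_def)
qed

text \<open>The ranks of \<open>S\<close> and \<open>E - S\<close> add up to \<open>r E\<close>. A
  cut inside one part leaves the other part whole on one side, where its rank cancels.\<close>

lemma width1_append:
  assumes "S \<subseteq> E" "conn E r S \<le> 0" "width1 S r es" "width1 (E - S) r fs"
  shows "width1 E r (es @ fs)"
  unfolding width1_def
proof (intro conjI allI impI)
  show "distinct (es @ fs)" "set (es @ fs) = E" using assms by (auto simp: width1_def)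
  have sep: "r S + r (E - S) \<le> r E" using assms(2) by (simp add: conn_def)
  fix xs ys assume "es @ fs = xs @ ys"
  then consider us where "es = xs @ us" "ys = us @ fs" | us where "xs = es @ us" "fs = us @ ys"
    by (auto simp: append_eq_append_conv2)
  then show "conn E r (set xs) \<le> 1"
  proof cases
    case 1
    then have x: "set xs \<subseteq> S" using assms(3) by (auto simp: width1_def)
    have "conn S r (set xs) \<le> 1" using width1_conn 1 assms(3) by blast
    moreover have "E - set xs = (S - set xs) \<union> (E - S)" using x assms(1) by auto
    then have "r (E - set xs) \<le> r (S - set xs) + r (E - S)" using r_union_le[of "S - set xs" "E - S"] assms(1) by auto
    ultimately show ?thesis using sep by (simp add: conn_def)
  next
    case 2
    then have x: "set us \<subseteq> E - S" "set xs = S \<union> set us" using assms(3,4) by (auto simp: width1_def)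
    have "conn (E - S) r (set us) \<le> 1" using width1_conn 2 assms(4) by blast
    moreover have "r (set xs) \<le> r S + r (set us)" using r_union_le[of S "set us"] x assms(1) by auto
    moreover have "E - set xs = E - S - set us" using x by auto
    ultimately show ?thesis using sep by (simp add: conn_def)
  qed
qed

end

section \<open>Minors in terms of rank functions\<close>

text \<open>\<open>C\<close> is contracted, \<open>g\<close> embeds \<open>N\<close> into the
  contraction, and everything outside \<open>C\<close> and the image counts as deleted. Independence
  in the contraction is expressed through \<open>r\<close> itself.\<close>

definition has_rank_minor :: "'a set \<Rightarrow> ('a set \<Rightarrow> int) \<Rightarrow> 'b set_system \<Rightarrow> bool" where
  "has_rank_minor E r N \<longleftrightarrow> (\<exists>C g. C \<subseteq> E \<and> inj_on g (ground N) \<and> g ` ground N \<subseteq> E - C \<and>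
     (\<forall>X \<subseteq> ground N. X \<in> indeps N \<longleftrightarrow> r (g ` X \<union> C) = r C + int (card X)))"

definition matroid_of_rank :: "'a set \<Rightarrow> ('a set \<Rightarrow> int) \<Rightarrow> 'a set_system" where
  "matroid_of_rank E r = \<lparr>ground = E, indeps = {X. X \<subseteq> E \<and> r X = int (card X)}\<rparr>"

lemma has_rank_minorI:
  assumes "C \<subseteq> E" "inj_on g (ground N)" "g ` ground N \<subseteq> E - C"
    "\<And>X. X \<subseteq> ground N \<Longrightarrow> X \<in> indeps N \<longleftrightarrow> r (g ` X \<union> C) = r C + int (card X)"
  shows "has_rank_minor E r N"
  using assms unfolding has_rank_minor_def by blast

context rank_function
begin

lemma has_rank_minor_minor:
  assumes "C \<union> S \<subseteq> E" "C \<inter> S = {}" "has_rank_minor S (contract_rank r C) N"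
  shows "has_rank_minor E r N"
proof -
  obtain D g where D: "D \<subseteq> S" "inj_on g (ground N)" "g ` ground N \<subseteq> S - D"
    "\<And>X. X \<subseteq> ground N \<Longrightarrow>
      X \<in> indeps N \<longleftrightarrow> contract_rank r C (g ` X \<union> D) = contract_rank r C D + int (card X)"
    using assms(3) unfolding has_rank_minor_def by blast
  show ?thesis
    by (rule has_rank_minorI[of "D \<union> C" _ g]) (use D assms in \<open>auto simp: contract_rank_def Un_assoc\<close>)
qed

lemma has_rank_minor_isomorphic:
  assumes "has_rank_minor E r N" "matroid_iso N' N"
  shows "has_rank_minor E r N'"
proof -
  obtain C g where C: "C \<subseteq> E" "inj_on g (ground N)" "g ` ground N \<subseteq> E - C"
    "\<And>X. X \<subseteq> ground N \<Longrightarrow> X \<in> indeps N \<longleftrightarrow> r (g ` X \<union> C) = r C + int (card X)"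
    using assms(1) unfolding has_rank_minor_def by blast
  obtain h where h: "bij_betw h (ground N') (ground N)"
    "\<And>X. X \<subseteq> ground N' \<Longrightarrow> X \<in> indeps N' \<longleftrightarrow> h ` X \<in> indeps N"
    using assms(2) unfolding matroid_iso_def by blast
  have hi: "inj_on h (ground N')" "h ` ground N' = ground N" using h(1) by (auto simp: bij_betw_def)
  show ?thesis
  proof (rule has_rank_minorI[of C _ "g \<circ> h"])
    show "(g \<circ> h) ` ground N' \<subseteq> E - C" using C(3) hi(2) by (metis image_comp)
    show "inj_on (g \<circ> h) (ground N')" using hi C(2) by (simp add: comp_inj_on)
    fix X assume X: "X \<subseteq> ground N'"
    then have "h ` X \<subseteq> ground N" "card (h ` X) = card X"
      using hi by (auto intro!: card_image intro: inj_on_subset)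
    then show "X \<in> indeps N' \<longleftrightarrow> r ((g \<circ> h) ` X \<union> C) = r C + int (card X)"
      using h(2)[OF X] C(4)[of "h ` X"] by (simp add: image_comp)
  qed (use C in auto)
qed

text \<open>\<open>A\<close> consists of the first \<open>m\<close> elements in the ordering that
  the minor inherits. Choosing \<open>m\<close> as half the size will contradict the connectivity of
  each excluded minor.\<close>

lemma width1_rank_minor:
  assumes "width1 E r es" "has_rank_minor E r N" "m \<le> card (ground N)"
  obtains \<rho> A where "rank_function (ground N) \<rho>"
    "\<And>X. X \<subseteq> ground N \<Longrightarrow> X \<in> indeps N \<longleftrightarrow> \<rho> X = int (card X)"
    "A \<subseteq> ground N" "card A = m" "\<rho> A + \<rho> (ground N - A) \<le> \<rho> (ground N) + 1"
proof -
  obtain C g where C: "C \<subseteq> E" "inj_on g (ground N)" "g ` ground N \<subseteq> E - C"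
    "\<And>X. X \<subseteq> ground N \<Longrightarrow> X \<in> indeps N \<longleftrightarrow> r (g ` X \<union> C) = r C + int (card X)"
    using assms(2) unfolding has_rank_minor_def by blast
  let ?G = "ground N" let ?S = "g ` ?G"
  have fG: "finite ?G" using C(2,3) finite_E by (meson finite_Diff finite_imageD finite_subset)
  interpret c: rank_function ?S "contract_rank r C" by (rule contract) (use C in auto)
  have "rank_function ?G (\<lambda>X. contract_rank r C (g ` X))"
    by (rule c.pullback) (use C fG in auto)
  moreover have "X \<in> indeps N \<longleftrightarrow> contract_rank r C (g ` X) = int (card X)" if "X \<subseteq> ?G" for X
    using C(4)[OF that] by (auto simp: contract_rank_def)
  moreover
  define fs where "fs = filter (\<lambda>x. x \<in> ?S) es"
  have o: "width1 ?S (contract_rank r C) fs" unfolding fs_def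
    by (rule width1_minor[OF assms(1)]) (use C in auto)
  then have fs: "distinct fs" "set fs = ?S" by (auto simp: width1_def)
  define A where "A = {x \<in> ?G. g x \<in> set (take m fs)}"
  have A: "A \<subseteq> ?G" "g ` A = set (take m fs)" using fs set_take_subset[of m fs] by (auto simp: A_def)
  have "card (set (take m fs)) = m"
    using fs assms(3) C(2) distinct_card[of fs] distinct_card[of "take m fs"] by (simp add: card_image)
  then have "card A = m" using A C(2) by (metis card_image inj_on_subset)
  moreover have "conn ?S (contract_rank r C) (g ` A) \<le> 1"
    using width1_conn[of ?S "contract_rank r C" "take m fs" "drop m fs"] o A by simp
  moreover have "?S - g ` A = g ` (?G - A)" using A C(2) by (simp add: inj_on_image_set_diff)
  ultimately show thesis using that[of "\<lambda>X. contract_rank r C (g ` X)" A] A by (auto simp: conn_def)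
qed

section \<open>Duals and minors of a matroid given by its rank function\<close>

lemma basis_matroid_of_rank:
  "basis (matroid_of_rank E r) B \<longleftrightarrow> B \<subseteq> E \<and> r B = int (card B) \<and> r B = r E"
proof
  assume b: "basis (matroid_of_rank E r) B"
  then have B: "B \<subseteq> E" "r B = int (card B)" by (auto simp: basis_def matroid_of_rank_def)
  obtain J where "B \<subseteq> J" "J \<subseteq> E" "r J = int (card J)" "r J = r E" using ex_basis[OF B(1) _ B(2)] by blast
  moreover then have "J = B" using b by (auto simp: basis_def matroid_of_rank_def)
  ultimately show "B \<subseteq> E \<and> r B = int (card B) \<and> r B = r E" by simp
next
  assume B: "B \<subseteq> E \<and> r B = int (card B) \<and> r B = r E"
  have "I = B" if "I \<subseteq> E" "r I = int (card I)" "B \<subseteq> I" for I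
  proof -
    have "card I \<le> card B" using B that r_mono[of I E] by auto
    then show ?thesis using that finite_sub[of I] by (metis card_seteq)
  qed
  then show "basis (matroid_of_rank E r) B" using B by (auto simp: basis_def matroid_of_rank_def)
qed

lemma dual_indep_iff:
  assumes "X \<subseteq> E"
  shows "dual_rank E r X = int (card X) \<longleftrightarrow> (\<exists>B. basis (matroid_of_rank E r) B \<and> X \<subseteq> E - B)"
proof
  assume "dual_rank E r X = int (card X)"
  then have eq: "r (E - X) = r E" by (simp add: dual_rank_def)
  obtain B where "B \<subseteq> E - X" "r B = int (card B)" "r B = r (E - X)"
    using ex_basis[of "{}" "E - X"] r_empty by auto
  then have "basis (matroid_of_rank E r) B" "X \<subseteq> E - B"
    using eq assms by (auto simp: basis_matroid_of_rank)
  then show "\<exists>B. basis (matroid_of_rank E r) B \<and> X \<subseteq> E - B" by blast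
next
  assume "\<exists>B. basis (matroid_of_rank E r) B \<and> X \<subseteq> E - B"
  then obtain B where "B \<subseteq> E" "r B = r E" "X \<subseteq> E - B" by (auto simp: basis_matroid_of_rank)
  then have "r E \<le> r (E - X)" "r (E - X) \<le> r E" using r_mono[of B "E - X"] r_mono[of "E - X" E] by auto
  then show "dual_rank E r X = int (card X)" by (simp add: dual_rank_def)
qed

lemma dual_matroid_of_rank: "dual (matroid_of_rank E r) = matroid_of_rank E (dual_rank E r)"
  using dual_indep_iff by (auto simp: dual_def matroid_of_rank_def)

lemma delete_matroid_of_rank: "delete (matroid_of_rank E r) D = matroid_of_rank (E - D) r"
  by (auto simp: delete_def matroid_of_rank_def)

lemma contract_matroid_of_rank:
  assumes "C \<subseteq> E"
  shows "Defs.contract (matroid_of_rank E r) C = matroid_of_rank (E - C) (contract_rank r C)"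
proof -
  interpret d: rank_function E "dual_rank E r" by (rule dual)
  interpret e: rank_function "E - C" "dual_rank E r" by (rule d.restrict) auto
  have "dual_rank (E - C) (dual_rank E r) X = contract_rank r C X" if "X \<subseteq> E - C" for X
  proof -
    have "E - (E - C - X) = X \<union> C" "E - (E - C) = C" using that assms by auto
    then show ?thesis using e.card_split[OF that] by (simp add: dual_rank_def contract_rank_def)
  qed
  then have "matroid_of_rank (E - C) (dual_rank (E - C) (dual_rank E r)) =
      matroid_of_rank (E - C) (contract_rank r C)"
    unfolding matroid_of_rank_def by auto
  then show ?thesis
    by (simp only: contract_def dual_matroid_of_rank d.delete_matroid_of_rank e.dual_matroid_of_rank)
qed

lemma has_minor_iso_matroid_of_rank:
  "has_minor_iso (matroid_of_rank E r) N \<longleftrightarrow> has_rank_minor E r N"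
proof
  assume "has_minor_iso (matroid_of_rank E r) N"
  then obtain C D where CD: "C \<subseteq> E" "D \<subseteq> E" "C \<inter> D = {}"
    "matroid_iso (delete (Defs.contract (matroid_of_rank E r) C) D) N"
    by (auto simp: has_minor_iso_def minor_def matroid_of_rank_def)
  interpret c: rank_function "E - C" "contract_rank r C" by (rule contract) (use CD in auto)
  let ?S = "E - C - D"
  have "matroid_iso (matroid_of_rank ?S (contract_rank r C)) N"
    using CD by (simp add: contract_matroid_of_rank c.delete_matroid_of_rank)
  then obtain f where f: "bij_betw f ?S (ground N)"
    "\<And>X. X \<subseteq> ?S \<Longrightarrow> contract_rank r C X = int (card X) \<longleftrightarrow> f ` X \<in> indeps N"
    by (auto simp: matroid_iso_def matroid_of_rank_def)
  let ?g = "inv_into ?S f"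
  have g: "bij_betw ?g (ground N) ?S" using f(1) by (rule bij_betw_inv_into)
  show "has_rank_minor E r N"
  proof (rule has_rank_minorI[of C _ ?g])
    show "inj_on ?g (ground N)" "?g ` ground N \<subseteq> E - C" using g by (auto simp: bij_betw_def)
    fix X assume X: "X \<subseteq> ground N"
    have "f ` ?g ` X = X" "card (?g ` X) = card X" "?g ` X \<subseteq> ?S"
      using X f(1) g by (auto simp: bij_betw_def image_inv_into_cancel intro!: card_image intro: inj_on_subset)
    then show "X \<in> indeps N \<longleftrightarrow> r (?g ` X \<union> C) = r C + int (card X)"
      using f(2)[of "?g ` X"] by (auto simp: contract_rank_def)
  qed (use CD in auto)
next
  assume "has_rank_minor E r N"
  then obtain C g where C: "C \<subseteq> E" "inj_on g (ground N)" "g ` ground N \<subseteq> E - C"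
    "\<And>X. X \<subseteq> ground N \<Longrightarrow> X \<in> indeps N \<longleftrightarrow> r (g ` X \<union> C) = r C + int (card X)"
    unfolding has_rank_minor_def by blast
  let ?S = "g ` ground N" let ?D = "E - C - ?S"
  interpret c: rank_function "E - C" "contract_rank r C" by (rule contract) (use C in auto)
  have S: "E - C - ?D = ?S" using C by auto
  have g: "bij_betw g (ground N) ?S" using C by (simp add: bij_betw_def)
  let ?f = "inv_into (ground N) g"
  have f: "bij_betw ?f ?S (ground N)" using g by (rule bij_betw_inv_into)
  have "matroid_iso (matroid_of_rank ?S (contract_rank r C)) N"
    unfolding matroid_iso_def
  proof (intro exI[of _ ?f] conjI allI impI)
    show "bij_betw ?f (ground (matroid_of_rank ?S (contract_rank r C))) (ground N)"
      using f by (simp add: matroid_of_rank_def)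
    fix X assume "X \<subseteq> ground (matroid_of_rank ?S (contract_rank r C))"
    then have X: "X \<subseteq> ?S" by (simp add: matroid_of_rank_def)
    have "g ` ?f ` X = X" "card (?f ` X) = card X" "?f ` X \<subseteq> ground N"
      using X f by (auto simp: bij_betw_def image_inv_into_cancel intro!: card_image intro: inj_on_subset)
    then show "X \<in> indeps (matroid_of_rank ?S (contract_rank r C)) \<longleftrightarrow> ?f ` X \<in> indeps N"
      using C(4)[of "?f ` X"] X by (auto simp: contract_rank_def matroid_of_rank_def)
  qed
  then have "matroid_iso (delete (Defs.contract (matroid_of_rank E r) C) ?D) N"
    using C S by (simp add: contract_matroid_of_rank c.delete_matroid_of_rank)
  moreover have "minor (delete (Defs.contract (matroid_of_rank E r) C) ?D) (matroid_of_rank E r)"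
    unfolding minor_def using C by (intro exI[of _ C] exI[of _ ?D]) (auto simp: matroid_of_rank_def)
  ultimately show "has_minor_iso (matroid_of_rank E r) N" unfolding has_minor_iso_def by blast
qed

lemma has_rank_minor_dual:
  assumes "has_rank_minor E (dual_rank E r) N" "\<And>I. I \<in> indeps N \<Longrightarrow> I \<subseteq> ground N"
  shows "has_rank_minor E r (Defs.dual N)"
proof -
  interpret d: rank_function E "dual_rank E r" by (rule dual)
  obtain C g where C: "C \<subseteq> E" "inj_on g (ground N)" "g ` ground N \<subseteq> E - C"
    "\<And>X. X \<subseteq> ground N \<Longrightarrow> X \<in> indeps N \<longleftrightarrow> dual_rank E r (g ` X \<union> C) = dual_rank E r C + int (card X)"
    using assms(1) unfolding has_rank_minor_def by blast
  let ?G = "ground N"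
  let ?\<rho> = "\<lambda>X. contract_rank (dual_rank E r) C (g ` X)"
  have fG: "finite ?G" using C(2,3) finite_E by (meson finite_Diff finite_imageD finite_subset)
  interpret c: rank_function "g ` ?G" "contract_rank (dual_rank E r) C"
    by (rule d.contract) (use C in auto)
  interpret p: rank_function ?G ?\<rho> by (rule c.pullback) (use C fG in auto)
  have "X \<in> indeps N \<longleftrightarrow> ?\<rho> X = int (card X)" if "X \<subseteq> ?G" for X
    using C(4)[OF that] by (auto simp: contract_rank_def)
  then have "N = matroid_of_rank ?G ?\<rho>"
    using assms(2) by (cases N) (auto simp: matroid_of_rank_def)
  then have dN: "Defs.dual N = matroid_of_rank ?G (dual_rank ?G ?\<rho>)"
    using p.dual_matroid_of_rank by simp
  \<comment> \<open>Duality exchanges the two operations: the elements deleted from the dual are the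
    ones to contract here.\<close>
  let ?C = "E - C - g ` ?G"
  show ?thesis
  proof (rule has_rank_minorI[of ?C _ g])
    show "g ` ground (Defs.dual N) \<subseteq> E - ?C" "inj_on g (ground (Defs.dual N))"
      using C by (auto simp: dual_def)
    fix X assume "X \<subseteq> ground (Defs.dual N)"
    then have X: "X \<subseteq> ?G" by (simp add: dual_def)
    have Z: "g ` X \<union> ?C \<subseteq> E" "?C \<subseteq> E" using X C by auto
    have eq: "E - (g ` X \<union> ?C) = g ` (?G - X) \<union> C" "E - ?C = g ` ?G \<union> C"
      using C(1,3) X inj_on_image_set_diff[OF C(2) _ X] by auto
    have "card (g ` X \<union> ?C) = card (g ` X) + card ?C"
      by (rule card_Un_disjoint) (use X fG finite_E finite_subset in auto)
    moreover have "card (g ` X) = card X" using X C(2) by (meson card_image inj_on_subset)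
    ultimately have "r (g ` X \<union> ?C) - r ?C = dual_rank ?G ?\<rho> X"
      using dual_dual[OF Z(1)] dual_dual[OF Z(2)]
      unfolding dual_rank_def[of E "dual_rank E r"] dual_rank_def[of ?G] eq contract_rank_def by linarith
    then show "X \<in> indeps (Defs.dual N) \<longleftrightarrow> r (g ` X \<union> ?C) = r ?C + int (card X)"
      using X by (auto simp: dN matroid_of_rank_def)
  qed auto
qed

end

section \<open>The rank function of a matroid given by independent sets\<close>

context matroid
begin

lemma finite_indep: "I \<in> indeps M \<Longrightarrow> finite I"
  using finite_subset[OF indeps_subset finite_ground] .

lemma finite_indeps: "finite {I \<in> indeps M. I \<subseteq> X}"
  by (rule finite_subset[of _ "Pow (ground M)"]) (use finite_ground indeps_subset in auto)

lemma card_le_rank: "I \<in> indeps M \<Longrightarrow> I \<subseteq> X \<Longrightarrow> card I \<le> rank M X"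
  unfolding rank_def using finite_indeps[of X] by (intro Max_ge) auto

lemma rank_attained: "\<exists>I\<in>indeps M. I \<subseteq> X \<and> card I = rank M X"
proof -
  have "rank M X \<in> card ` {I \<in> indeps M. I \<subseteq> X}"
    unfolding rank_def using finite_indeps[of X] empty_indep by (intro Max_in) auto
  then show ?thesis by auto
qed

lemma extend_indep:
  assumes "I \<in> indeps M" "I \<subseteq> X"
  obtains J where "J \<in> indeps M" "I \<subseteq> J" "J \<subseteq> X" "card J = rank M X"
proof -
  let ?P = "\<lambda>J. J \<in> indeps M \<and> I \<subseteq> J \<and> J \<subseteq> X"
  have "\<forall>J. ?P J \<longrightarrow> card J < Suc (rank M X)" using card_le_rank by (auto simp: less_Suc_eq_le)
  then obtain J where J: "?P J" and mx: "\<And>J'. ?P J' \<Longrightarrow> card J' \<le> card J"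
    using ex_has_greatest_nat[of ?P I card "Suc (rank M X)"] assms by auto
  obtain K where K: "K \<in> indeps M" "K \<subseteq> X" "card K = rank M X" using rank_attained by blast
  have "\<not> card J < card K"
  proof
    assume "card J < card K"
    then obtain x where x: "x \<in> K - J" "insert x J \<in> indeps M" using augment J K by blast
    then have "?P (insert x J)" using J K by auto
    moreover have "finite J" using J finite_indep by blast
    ultimately show False using mx[OF \<open>?P (insert x J)\<close>] x by simp
  qed
  then have "card J = rank M X" using card_le_rank[of J X] J K by auto
  then show thesis using that J by blast
qed

lemma rank_function: "rank_function (ground M) (\<lambda>X. int (rank M X))"
proof
  show "finite (ground M)" by (rule finite_ground)
  show "int (rank M {}) = 0" using rank_attained[of "{}"] by auto
  show "int (rank M X) \<le> int (rank M Y)" if "X \<subseteq> Y" for X Y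
  proof -
    obtain I where "I \<in> indeps M" "I \<subseteq> X" "card I = rank M X" using rank_attained by blast
    then show ?thesis using card_le_rank[of I Y] that by auto
  qed
  show "int (rank M X) \<le> int (card X)" if "X \<subseteq> ground M" for X
  proof -
    obtain I where "I \<subseteq> X" "card I = rank M X" using rank_attained by blast
    then show ?thesis using card_mono[of X I] finite_subset[OF that finite_ground] by auto
  qed
  show "int (rank M (X \<union> Y)) + int (rank M (X \<inter> Y)) \<le> int (rank M X) + int (rank M Y)" for X Y
  proof -
    \<comment> \<open>A largest independent subset \<open>I\<close> of the intersection is extended
      to a largest one \<open>J\<close> of the union. The traces of \<open>J\<close> on
      \<open>X\<close> and \<open>Y\<close> count the elements in the intersection twice, and these
      include \<open>I\<close>.\<close>
    obtain I where I: "I \<in> indeps M" "I \<subseteq> X \<inter> Y" "card I = rank M (X \<inter> Y)"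
      using rank_attained by blast
    then obtain J where J: "J \<in> indeps M" "I \<subseteq> J" "J \<subseteq> X \<union> Y" "card J = rank M (X \<union> Y)"
      using extend_indep[of I "X \<union> Y"] by blast
    have fJ: "finite J" using J finite_indep by blast
    have "J \<inter> X \<union> J \<inter> Y = J" "I \<subseteq> J \<inter> X \<inter> (J \<inter> Y)" using I J by auto
    then have "card (J \<inter> X) + card (J \<inter> Y) = card J + card (J \<inter> X \<inter> (J \<inter> Y))"
      "card I \<le> card (J \<inter> X \<inter> (J \<inter> Y))"
      using card_Un_Int[of "J \<inter> X" "J \<inter> Y"] fJ by (auto intro: card_mono)
    moreover have "card (J \<inter> X) \<le> rank M X" "card (J \<inter> Y) \<le> rank M Y"
      using J(1) indep_mono by (auto intro!: card_le_rank)
    ultimately show ?thesis using I J by linarith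
  qed
qed

lemma indep_iff_rank: "I \<in> indeps M \<longleftrightarrow> I \<subseteq> ground M \<and> rank M I = card I"
proof
  assume I: "I \<in> indeps M"
  obtain J where "J \<in> indeps M" "I \<subseteq> J" "J \<subseteq> I" "card J = rank M I" using extend_indep[OF I] by blast
  then show "I \<subseteq> ground M \<and> rank M I = card I" using indeps_subset[OF I] by auto
next
  assume I: "I \<subseteq> ground M \<and> rank M I = card I"
  obtain J where "J \<in> indeps M" "J \<subseteq> I" "card J = rank M I" using rank_attained by blast
  then show "I \<in> indeps M" using I finite_subset[OF _ finite_ground] by (metis card_seteq order_refl)
qed

lemma eq_matroid_of_rank: "M = matroid_of_rank (ground M) (\<lambda>X. int (rank M X))"
  using indep_iff_rank by (cases M) (auto simp: matroid_of_rank_def)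

lemma pathwidth_le_1_iff:
  "pathwidth M \<le> 1 \<longleftrightarrow> (\<exists>es. width1 (ground M) (\<lambda>X. int (rank M X)) es)"
proof -
  have prefixes: "(\<forall>i\<le>length es. connectivity M (set (take i es)) \<le> 1) \<longleftrightarrow>
      (\<forall>xs ys. es = xs @ ys \<longrightarrow> conn (ground M) (\<lambda>X. int (rank M X)) (set xs) \<le> 1)" for es
  proof (intro iffI allI impI)
    fix xs ys assume "\<forall>i\<le>length es. connectivity M (set (take i es)) \<le> 1" "es = xs @ ys"
    then show "conn (ground M) (\<lambda>X. int (rank M X)) (set xs) \<le> 1"
      by (auto simp: connectivity_def conn_def dest!: spec[of _ "length xs"])
  next
    fix i assume "\<forall>xs ys. es = xs @ ys \<longrightarrow> conn (ground M) (\<lambda>X. int (rank M X)) (set xs) \<le> 1"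
    then have "conn (ground M) (\<lambda>X. int (rank M X)) (set (take i es)) \<le> 1"
      using append_take_drop_id[of i es] by metis
    then show "connectivity M (set (take i es)) \<le> 1" by (simp add: connectivity_def conn_def)
  qed
  have fo: "finite (orderings M)"
    by (rule finite_subset[OF _ finite_lists_length_le[OF finite_ground, of "card (ground M)"]])
      (auto simp: orderings_def dest: distinct_card)
  moreover have "orderings M \<noteq> {}"
    using finite_distinct_list[OF finite_ground] by (auto simp: orderings_def)
  ultimately have "pathwidth M \<le> 1 \<longleftrightarrow> (\<exists>es\<in>orderings M. ordering_width M es \<le> 1)"
    unfolding pathwidth_def by (subst Min_le_iff) auto
  also have "\<dots> \<longleftrightarrow> (\<exists>es\<in>orderings M. \<forall>i\<le>length es. connectivity M (set (take i es)) \<le> 1)"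
    unfolding ordering_width_def by (intro bex_cong refl, subst Max_le_iff) auto
  also have "\<dots> \<longleftrightarrow> (\<exists>es\<in>orderings M. \<forall>xs ys. es = xs @ ys \<longrightarrow>
      conn (ground M) (\<lambda>X. int (rank M X)) (set xs) \<le> 1)"
    by (simp only: prefixes)
  also have "\<dots> \<longleftrightarrow> (\<exists>es. width1 (ground M) (\<lambda>X. int (rank M X)) es)"
    by (auto simp: width1_def orderings_def)
  finally show ?thesis .
qed

end

section \<open>Representability\<close>

definition represents :: "'a set \<Rightarrow> ('a set \<Rightarrow> int) \<Rightarrow> nat \<Rightarrow> ('a \<Rightarrow> nat \<Rightarrow> 'f::field) \<Rightarrow> bool" where
  "represents E r n v \<longleftrightarrow> (\<forall>X \<subseteq> E. r X = int (card X) \<longleftrightarrow> lin_indep_family n v X)"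

lemma lin_indep_family_cong:
  assumes "\<And>x i. x \<in> X \<Longrightarrow> i < n \<Longrightarrow> v x i = w x i"
  shows "lin_indep_family n v X = lin_indep_family n w X"
proof -
  have "(\<Sum>x\<in>X. c x * v x i) = (\<Sum>x\<in>X. c x * w x i)" if "i < n" for c i
    using assms that by (intro sum.cong) auto
  then show ?thesis by (simp add: lin_indep_family_def)
qed

lemma lin_indep_family_reindex:
  assumes "inj_on h X"
  shows "lin_indep_family n v (h ` X) = lin_indep_family n (v \<circ> h) X"
proof
  assume l: "lin_indep_family n v (h ` X)"
  show "lin_indep_family n (v \<circ> h) X"
    unfolding lin_indep_family_def
  proof (intro allI impI)
    fix c assume c: "\<forall>i<n. (\<Sum>x\<in>X. c x * (v \<circ> h) x i) = 0"
    have "\<forall>i<n. (\<Sum>y\<in>h ` X. c (inv_into X h y) * v y i) = 0"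
      using c assms by (simp add: sum.reindex inv_into_f_f)
    then have "\<forall>y\<in>h ` X. c (inv_into X h y) = 0"
      using l unfolding lin_indep_family_def by (elim allE[of _ "\<lambda>y. c (inv_into X h y)"]) auto
    then show "\<forall>x\<in>X. c x = 0" using assms by simp
  qed
next
  assume l: "lin_indep_family n (v \<circ> h) X"
  show "lin_indep_family n v (h ` X)"
    unfolding lin_indep_family_def
  proof (intro allI impI)
    fix c assume c: "\<forall>i<n. (\<Sum>y\<in>h ` X. c y * v y i) = 0"
    then have "\<forall>i<n. (\<Sum>x\<in>X. c (h x) * (v \<circ> h) x i) = 0" using assms by (simp add: sum.reindex)
    then have "\<forall>x\<in>X. c (h x) = 0"
      using l unfolding lin_indep_family_def by (elim allE[of _ "\<lambda>x. c (h x)"]) auto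
    then show "\<forall>y\<in>h ` X. c y = 0" by simp
  qed
qed

lemma lin_indep_family_zero:
  assumes "finite X" "x \<in> X" "\<And>i. i < n \<Longrightarrow> v x i = 0"
  shows "\<not> lin_indep_family n v X"
proof
  assume "lin_indep_family n v X"
  moreover have "\<forall>i<n. (\<Sum>y\<in>X. (if y = x then 1 else 0) * v y i) = 0"
    using assms by (auto simp: if_distrib[of "\<lambda>a. a * _"] cong: if_cong)
  ultimately have "\<forall>y\<in>X. (if y = x then 1 else 0) = (0::'b)"
    unfolding lin_indep_family_def by (elim allE[of _ "\<lambda>y. if y = x then 1 else 0"]) auto
  then show False using assms by auto
qed

lemma lin_indep_family_parallel:
  assumes "finite X" "x \<in> X" "y \<in> X" "x \<noteq> y" "\<And>i. i < n \<Longrightarrow> v x i = v y i"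
  shows "\<not> lin_indep_family n v X"
proof
  assume l: "lin_indep_family n v X"
  let ?c = "\<lambda>z. if z = x then 1 else if z = y then - 1 else (0::'b)"
  have "(\<Sum>z\<in>X. ?c z * v z i) = 0" if "i < n" for i
  proof -
    have "(\<Sum>z\<in>X. ?c z * v z i) = (\<Sum>z\<in>{x,y}. ?c z * v z i)"
      by (rule sum.mono_neutral_right) (use assms in auto)
    then show ?thesis using assms that by simp
  qed
  moreover have "(\<forall>i<n. (\<Sum>z\<in>X. ?c z * v z i) = 0) \<longrightarrow> (\<forall>z\<in>X. ?c z = 0)"
    using l unfolding lin_indep_family_def by (rule spec)
  ultimately have "?c x = 0" using assms(2) by blast
  then show False by simp
qed

text \<open>With \<open>f = e\<close> this extends a representation by a coloop, otherwise by an element in series with \<open>f\<close>.\<close>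

lemma lin_indep_family_new_coordinate:
  fixes v :: "'a \<Rightarrow> nat \<Rightarrow> 'f::field"
  assumes "finite X" and w: "\<And>x i. i < n \<Longrightarrow> w x i = (if x = e then 0 else v x i)"
    "\<And>x. w x n = (if x = e \<or> x = f then 1 else 0)"
  shows "e \<in> X \<Longrightarrow> lin_indep_family (Suc n) w X = lin_indep_family n v (X - {e})"
    and "e \<notin> X \<Longrightarrow> lin_indep_family (Suc n) w X = lin_indep_family n v (X - {f})"
proof -
  have dn: "(\<forall>i<Suc n. P i) \<longleftrightarrow> (\<forall>i<n. P i) \<and> P n" for P :: "nat \<Rightarrow> bool"
    by (auto simp: less_Suc_eq)
  {
    assume e: "e \<in> X"
    have low: "(\<Sum>x\<in>X. c x * w x i) = (\<Sum>x\<in>X - {e}. c x * v x i)" if "i < n" for c i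
      using assms(1) e w(1)[OF that] by (subst sum.remove[of X e]) (auto intro!: sum.cong)
    have top: "(\<Sum>x\<in>X. c x * w x n) = c e + (if f \<in> X - {e} then c f else 0)" for c
    proof -
      have "(\<Sum>x\<in>X. c x * w x n) = c e + (\<Sum>x\<in>X - {e}. if x = f then c x else 0)"
      proof -
        have "(\<Sum>x\<in>X - {e}. c x * w x n) = (\<Sum>x\<in>X - {e}. if x = f then c x else 0)"
          by (rule sum.cong) (use w(2) in auto)
        then show ?thesis using sum.remove[OF assms(1) e, of "\<lambda>x. c x * w x n"] w(2)[of e] by simp
      qed
      then show ?thesis using assms(1) by (simp add: sum.delta')
    qed
    show "lin_indep_family (Suc n) w X = lin_indep_family n v (X - {e})"
    proof
      assume l: "lin_indep_family (Suc n) w X"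
      show "lin_indep_family n v (X - {e})"
        unfolding lin_indep_family_def
      proof (intro allI impI)
        fix c assume c: "\<forall>i<n. (\<Sum>x\<in>X - {e}. c x * v x i) = 0"
        \<comment> \<open>Since \<open>w e\<close> vanishes in the old coordinates, the coefficient
          of \<open>e\<close> is free to cancel the new one.\<close>
        let ?c = "c(e := - (if f \<in> X - {e} then c f else 0))"
        have "(\<Sum>x\<in>X - {e}. ?c x * v x i) = (\<Sum>x\<in>X - {e}. c x * v x i)" for i
          by (intro sum.cong) auto
        then have "\<forall>i<Suc n. (\<Sum>x\<in>X. ?c x * w x i) = 0" unfolding dn using low[of _ ?c] top[of ?c] c by auto
        then have "\<forall>x\<in>X. ?c x = 0" using l unfolding lin_indep_family_def by blast
        then show "\<forall>x\<in>X - {e}. c x = 0" by (metis DiffE fun_upd_other singletonI)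
      qed
    next
      assume l: "lin_indep_family n v (X - {e})"
      show "lin_indep_family (Suc n) w X"
        unfolding lin_indep_family_def dn
      proof (intro allI impI)
        fix c assume c: "(\<forall>i<n. (\<Sum>x\<in>X. c x * w x i) = 0) \<and> (\<Sum>x\<in>X. c x * w x n) = 0"
        then have "\<forall>x\<in>X - {e}. c x = 0" using l low unfolding lin_indep_family_def by auto
        moreover from this have "c e = 0" using c top[of c] by (auto split: if_splits)
        ultimately show "\<forall>x\<in>X. c x = 0" by auto
      qed
    qed
  }
  {
    assume e: "e \<notin> X"
    have low: "(\<Sum>x\<in>X. c x * w x i) = (\<Sum>x\<in>X. c x * v x i)" if "i < n" for c i
      using e w(1)[OF that] by (intro sum.cong) auto
    have top: "(\<Sum>x\<in>X. c x * w x n) = (if f \<in> X then c f else 0)" for c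
    proof -
      have "(\<Sum>x\<in>X. c x * w x n) = (\<Sum>x\<in>X. if x = f then c x else 0)"
        by (rule sum.cong) (use e w(2) in auto)
      then show ?thesis using assms(1) by (simp add: sum.delta')
    qed
    have rest: "(\<Sum>x\<in>X. c x * v x i) = (\<Sum>x\<in>X - {f}. c x * v x i)" if "f \<in> X \<Longrightarrow> c f = 0" for c i
      by (rule sum.mono_neutral_right) (use assms(1) that in auto)
    show "lin_indep_family (Suc n) w X = lin_indep_family n v (X - {f})"
    proof
      assume l: "lin_indep_family (Suc n) w X"
      show "lin_indep_family n v (X - {f})"
        unfolding lin_indep_family_def
      proof (intro allI impI)
        fix c assume c: "\<forall>i<n. (\<Sum>x\<in>X - {f}. c x * v x i) = 0"
        \<comment> \<open>Without \<open>e\<close>, the new coordinate of a combination is the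
          coefficient of \<open>f\<close>, so \<open>f\<close> cannot take part in a
          relation.\<close>
        let ?c = "c(f := 0)"
        have "(\<Sum>x\<in>X - {f}. ?c x * v x i) = (\<Sum>x\<in>X - {f}. c x * v x i)" for i
          by (intro sum.cong) auto
        then have "\<forall>i<Suc n. (\<Sum>x\<in>X. ?c x * w x i) = 0"
          unfolding dn using low[of _ ?c] top[of ?c] rest[of ?c] c by auto
        then have "\<forall>x\<in>X. ?c x = 0" using l unfolding lin_indep_family_def by blast
        then show "\<forall>x\<in>X - {f}. c x = 0" by (metis DiffE fun_upd_other singletonI)
      qed
    next
      assume l: "lin_indep_family n v (X - {f})"
      show "lin_indep_family (Suc n) w X"
        unfolding lin_indep_family_def dn
      proof (intro allI impI)
        fix c assume c: "(\<forall>i<n. (\<Sum>x\<in>X. c x * w x i) = 0) \<and> (\<Sum>x\<in>X. c x * w x n) = 0"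
        then have cf: "f \<in> X \<Longrightarrow> c f = 0" using top[of c] by auto
        then have "\<forall>i<n. (\<Sum>x\<in>X - {f}. c x * v x i) = 0" using c low[of _ c] rest[of c] by auto
        then have "\<forall>x\<in>X - {f}. c x = 0" using l unfolding lin_indep_family_def by auto
        then show "\<forall>x\<in>X. c x = 0" using cf by auto
      qed
    qed
  }
qed

lemma contract_rank_empty: "r {} = 0 \<Longrightarrow> contract_rank r {} = r"
  by (simp add: contract_rank_def fun_eq_iff)

lemma (in rank_function) width1_restrict:
  assumes "width1 E r es" "S \<subseteq> E"
  shows "\<exists>fs. width1 S r fs"
proof -
  have "width1 S (contract_rank r {}) (filter (\<lambda>x. x \<in> S) es)"
    by (rule width1_minor[OF assms(1)]) (use assms(2) in auto)
  then show ?thesis unfolding contract_rank_empty[of r, OF r_empty] by (rule exI)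
qed

section \<open>Extending a representation by one element\<close>

context rank_function
begin

lemma represents_loop:
  assumes "e \<in> E" "r {e} = 0" "represents (E - {e}) r n v"
  shows "represents E r n (v(e := \<lambda>_. 0))"
  unfolding represents_def
proof (intro allI impI)
  fix X assume X: "X \<subseteq> E"
  show "r X = int (card X) \<longleftrightarrow> lin_indep_family n (v(e := \<lambda>_. 0)) X"
  proof (cases "e \<in> X")
    case True
    then have "r X \<noteq> int (card X)" using indep_sub[of "{e}" X] X assms by auto
    moreover have "\<not> lin_indep_family n (v(e := \<lambda>_. 0)) X"
      by (rule lin_indep_family_zero[of X e]) (use True X finite_sub in auto)
    ultimately show ?thesis by simp
  next
    case False
    then have "lin_indep_family n (v(e := \<lambda>_. 0)) X = lin_indep_family n v X"
      by (intro lin_indep_family_cong) auto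
    moreover have "X \<subseteq> E - {e}" using False X by auto
    ultimately show ?thesis using assms by (simp add: represents_def)
  qed
qed

lemma represents_coloop:
  assumes "e \<in> E" "r (E - {e}) = r E - 1" "represents (E - {e}) r n v"
  shows "represents E r (Suc n)
    (\<lambda>x i. if i < n then (if x = e then 0 else v x i) else if x = e then 1 else 0)"
    (is "represents E r (Suc n) ?w")
  unfolding represents_def
proof (intro allI impI)
  fix X assume X: "X \<subseteq> E"
  then have fX: "finite X" by (rule finite_sub)
  have Xe: "r (X - {e}) = int (card (X - {e})) \<longleftrightarrow> lin_indep_family n v (X - {e})"
    using assms(3) Diff_mono[OF X order_refl] unfolding represents_def by blast
  have w: "\<And>x i. i < n \<Longrightarrow> ?w x i = (if x = e then 0 else v x i)"
    "\<And>x. ?w x n = (if x = e \<or> x = e then 1 else 0)" by simp_all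
  have "lin_indep_family (Suc n) ?w X \<longleftrightarrow> lin_indep_family n v (X - {e})"
    using lin_indep_family_new_coordinate[where w = ?w and v = v and e = e and f = e, OF fX w] by blast
  moreover have "r X = int (card X) \<longleftrightarrow> r (X - {e}) = int (card (X - {e}))"
  proof (cases "e \<in> X")
    case True
    then have ins: "insert e (X - {e}) = X" "insert e (E - {e}) = E" using assms(1) by auto
    have "1 \<le> r X - r (X - {e})"
      using r_insert_mono[of "X - {e}" "E - {e}" e, unfolded ins] X assms(1,2) Diff_mono[OF X order_refl[of "{e}"]]
      by auto
    moreover have "r X \<le> r (X - {e}) + 1"
      using r_insert_le[of "X - {e}" e, unfolded ins] X assms(1) by blast
    moreover have "card X = Suc (card (X - {e}))" using True fX by (metis card.remove)
    ultimately show ?thesis by auto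
  next
    case False
    then show ?thesis by simp
  qed
  ultimately show "r X = int (card X) \<longleftrightarrow> lin_indep_family (Suc n) ?w X" using Xe by simp
qed

lemma represents_parallel:
  assumes "e \<in> E" "f \<in> E" "e \<noteq> f" "r {e} = 1" "r {f} = 1" "r {e, f} = 1"
    "represents (E - {e}) r n v"
  shows "represents E r n (v(e := v f))"
  unfolding represents_def
proof (intro allI impI)
  fix X assume X: "X \<subseteq> E"
  then have fX: "finite X" by (rule finite_sub)
  show "r X = int (card X) \<longleftrightarrow> lin_indep_family n (v(e := v f)) X"
  proof (cases "e \<in> X")
    case False
    then have "lin_indep_family n (v(e := v f)) X = lin_indep_family n v X"
      by (intro lin_indep_family_cong) auto
    moreover have "X \<subseteq> E - {e}" using False X by auto
    ultimately show ?thesis using assms by (simp add: represents_def)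
  next
    case e: True
    show ?thesis
    proof (cases "f \<in> X")
      case True
      then have "r X \<noteq> int (card X)" using indep_sub[of "{e, f}" X] X e assms by auto
      moreover have "\<not> lin_indep_family n (v(e := v f)) X"
        by (rule lin_indep_family_parallel[of X e f]) (use True e assms fX in auto)
      ultimately show ?thesis by simp
    next
      case f: False
      \<comment> \<open>\<open>?h\<close> replaces \<open>e\<close> by its parallel partner
        \<open>f\<close>, which changes neither the rank nor the vectors.\<close>
      let ?h = "id(e := f)"
      have inj: "inj_on ?h X" using f by (auto simp: inj_on_def)
      have im: "?h ` X = insert f (X - {e})" using e by auto
      have "lin_indep_family n v (?h ` X) = lin_indep_family n (v \<circ> ?h) X"
        using inj by (rule lin_indep_family_reindex)
      also have "\<dots> = lin_indep_family n (v(e := v f)) X" by (rule lin_indep_family_cong) auto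
      finally have l: "lin_indep_family n (v(e := v f)) X = lin_indep_family n v (?h ` X)" ..
      have "card (?h ` X) = card X" using inj by (rule card_image)
      moreover have "r (insert f X) = r X"
        by (rule spanned_mono[of "{e}"]) (use e X assms in \<open>auto simp: insert_commute\<close>)
      moreover have "r (insert e (insert f (X - {e}))) = r (insert f (X - {e}))"
        by (rule spanned_mono[of "{f}"]) (use e X assms in auto)
      moreover have "insert e (insert f (X - {e})) = insert f X" using e by auto
      moreover have "?h ` X \<subseteq> E - {e}" unfolding im using X assms by auto
      ultimately show ?thesis using assms(7) l im unfolding represents_def by metis
    qed
  qed
qed

text \<open>The hypotheses make \<open>{e, f}\<close> a cocircuit, so adding either element to a set
  avoiding both raises the rank by one. Hence a set \<open>X\<close> without \<open>e\<close> is
  independent exactly when \<open>X - {f}\<close> is independent after contracting \<open>e\<close>,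
  which is what the new coordinate expresses.\<close>

lemma represents_series:
  assumes "e \<in> E" "f \<in> E" "e \<noteq> f" "r {e} = 1" "r (E - {e}) = r E" "r (E - {f}) = r E"
    "r (E - {e, f}) < r E" "represents (E - {e}) (contract_rank r {e}) n v"
  shows "represents E r (Suc n)
    (\<lambda>x i. if i < n then (if x = e then 0 else v x i) else if x = e \<or> x = f then 1 else 0)"
    (is "represents E r (Suc n) ?w")
  unfolding represents_def
proof (intro allI impI)
  fix X assume X: "X \<subseteq> E"
  then have fX: "finite X" by (rule finite_sub)
  have w: "\<And>x i. i < n \<Longrightarrow> ?w x i = (if x = e then 0 else v x i)"
    "\<And>x. ?w x n = (if x = e \<or> x = f then 1 else 0)" by simp_all
  have rep: "r (insert e Y) = int (card Y) + 1 \<longleftrightarrow> lin_indep_family n v Y" if "Y \<subseteq> E - {e}" for Y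
  proof -
    have "contract_rank r {e} Y = int (card Y) \<longleftrightarrow> lin_indep_family n v Y"
      using assms(8) that unfolding represents_def by blast
    then show ?thesis using assms(4) by (auto simp: contract_rank_def)
  qed
  show "r X = int (card X) \<longleftrightarrow> lin_indep_family (Suc n) ?w X"
  proof (cases "e \<in> X")
    case True
    then have "lin_indep_family (Suc n) ?w X \<longleftrightarrow> lin_indep_family n v (X - {e})"
      using lin_indep_family_new_coordinate(1)[where w = ?w and v = v and e = e and f = f, OF fX w] by blast
    moreover have "insert e (X - {e}) = X" using True by auto
    moreover have "card X = Suc (card (X - {e}))" using True fX by (metis card.remove)
    moreover have "X - {e} \<subseteq> E - {e}" using X by blast
    ultimately show ?thesis using rep[of "X - {e}"] by auto
  next
    case False
    let ?Y = "X - {f}"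
    have "lin_indep_family (Suc n) ?w X \<longleftrightarrow> lin_indep_family n v ?Y"
      using lin_indep_family_new_coordinate(2)[where w = ?w and v = v and e = e and f = f, OF fX w] False by blast
    moreover have Y: "?Y \<subseteq> E - {e, f}" "?Y \<subseteq> E" "?Y \<subseteq> E - {e}" using X False by auto
    have ins: "insert e (E - {e, f}) = E - {f}" "insert f (E - {e, f}) = E - {e}" using assms by auto
    have "r (insert e ?Y) \<ge> r ?Y + 1" "r (insert f ?Y) \<ge> r ?Y + 1"
      using r_insert_mono[OF Y(1) Diff_subset assms(1), unfolded ins]
        r_insert_mono[OF Y(1) Diff_subset assms(2), unfolded ins] assms(5,6,7) by linarith+
    moreover have "r (insert e ?Y) \<le> r ?Y + 1" "r (insert f ?Y) \<le> r ?Y + 1"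
      using r_insert_le[OF Y(2)] assms(1,2) by blast+
    ultimately have "lin_indep_family (Suc n) ?w X \<longleftrightarrow> r ?Y = int (card ?Y)"
      "r (insert f ?Y) = r ?Y + 1" using rep[OF Y(3)] by auto
    moreover have "r X = int (card X) \<longleftrightarrow> r ?Y = int (card ?Y)"
    proof (cases "f \<in> X")
      case True
      then have "insert f ?Y = X" by auto
      moreover have "card X = Suc (card ?Y)" using True fX by (metis card.remove)
      ultimately show ?thesis using \<open>r (insert f ?Y) = r ?Y + 1\<close> by simp
    qed simp
    ultimately show ?thesis by simp
  qed
qed

end

lemma width1_represents:
  "rank_function E r \<Longrightarrow> width1 E r es \<Longrightarrow> \<exists>n (v :: 'a \<Rightarrow> nat \<Rightarrow> 'f::field). represents E r n v"
proof (induction "card E" arbitrary: E r es rule: less_induct)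
  case less
  interpret rank_function E r by fact
  have small: "card (E - {e}) < card E" if "e \<in> E" for e
    using finite_E that by (rule card_Diff1_less)
  have del: "\<exists>n (v :: 'a \<Rightarrow> nat \<Rightarrow> 'f::field). represents (E - {e}) r n v" if "e \<in> E" for e
    using less.hyps[OF small[OF that]] restrict[of "E - {e}"] width1_restrict[OF less.prems(2), of "E - {e}"]
    by blast
  have con: "\<exists>n (v :: 'a \<Rightarrow> nat \<Rightarrow> 'f::field). represents (E - {e}) (contract_rank r {e}) n v" if "e \<in> E" for e
    using less.hyps[OF small[OF that]] contract[of "{e}" "E - {e}"] width1_minor[OF less.prems(2), of "{e}" "E - {e}"] that
    by blast
  consider (loop) e where "e \<in> E" "r {e} = 0" | (coloop) e where "e \<in> E" "r (E - {e}) = r E - 1"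
    | (empty) "E = {}"
    | (proper) "E \<noteq> {}" "\<And>e. e \<in> E \<Longrightarrow> r {e} = 1" "\<And>e. e \<in> E \<Longrightarrow> r (E - {e}) = r E"
  proof -
    have "r {e} = 0 \<or> r {e} = 1" if "e \<in> E" for e
      using that r_nonneg[of "{e}"] r_single_le[of e] by auto
    moreover have "r (E - {e}) = r E - 1 \<or> r (E - {e}) = r E" if "e \<in> E" for e
      using that r_mono[of "E - {e}" E] r_insert_le[of "E - {e}" e] by (auto simp: insert_absorb)
    ultimately show ?thesis using that by blast
  qed
  then show ?case
  proof cases
    case loop
    then show ?thesis using del[of e] represents_loop by blast
  next
    case coloop
    then show ?thesis using del[of e] represents_coloop by blast
  next
    case empty
    have "represents {} r 0 (\<lambda>_ _. 0)" by (simp add: represents_def lin_indep_family_def r_empty)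
    then show ?thesis using empty by blast
  next
    case proper
    have E: "set es = E" "distinct es" using less.prems(2) by (auto simp: width1_def)
    then obtain e fs where es: "es = e # fs" using proper(1) by (cases es) auto
    \<comment> \<open>A single element is a loop or a coloop.\<close>
    have "fs \<noteq> []"
    proof
      assume "fs = []"
      then have "E = {e}" using E es by auto
      then show False using proper(2)[of e] proper(3)[of e] r_empty by auto
    qed
    then obtain f gs where fs: "fs = f # gs" by (cases fs) auto
    have ef: "e \<in> E" "f \<in> E" "e \<noteq> f" using E es fs by auto
    \<comment> \<open>If \<open>r {e, f} = 2\<close>, this bound makes the rank of the remaining
      elements drop, so \<open>e\<close> and \<open>f\<close> are in series. A parallel element is
      deleted and a series element contracted.\<close>
    have "conn E r {e, f} \<le> 1" using width1_conn[of E r "[e, f]" gs] less.prems(2) es fs by auto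
    then consider "r {e, f} = 1" | "r (E - {e, f}) < r E"
      using r_mono[of "{e}" "{e, f}"] proper(2) ef unfolding conn_def by force
    then show ?thesis
    proof cases
      case 1
      then show ?thesis using del[OF ef(1)] represents_parallel[OF ef] proper ef by blast
    next
      case 2
      then show ?thesis using con[OF ef(1)] represents_series[OF ef] proper ef by blast
    qed
  qed
qed

section \<open>Sparse paving matroids\<close>

text \<open>For \<open>sparse k S L\<close> this is a matroid of rank \<open>k\<close> whose circuit
  hyperplanes are the members of \<open>L\<close>.\<close>

definition sparse_paving :: "nat \<Rightarrow> 'a set \<Rightarrow> 'a set set \<Rightarrow> 'a set_system" where
  "sparse_paving k S L = \<lparr>ground = S, indeps = {X. X \<subseteq> S \<and> card X \<le> k \<and> X \<notin> L}\<rparr>"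

text \<open>Two members of \<open>L\<close> may not share \<open>k - 1\<close> elements, since
  otherwise their common part could fail to extend to a basis inside their union. The bounds on
  \<open>k\<close> keep the empty set and \<open>S\<close> out of \<open>L\<close>.\<close>

definition sparse :: "nat \<Rightarrow> 'a set \<Rightarrow> 'a set set \<Rightarrow> bool" where
  "sparse k S L \<longleftrightarrow> finite S \<and> 0 < k \<and> k < card S \<and> (\<forall>A\<in>L. A \<subseteq> S \<and> card A = k) \<and>
     (\<forall>A\<in>L. \<forall>B\<in>L. A \<noteq> B \<longrightarrow> Suc (card (A \<inter> B)) < k)"

text \<open>A set of size \<open>k - 1\<close> inside a larger \<open>T\<close> has two extensions
  to size \<open>k\<close>. They share \<open>k - 1\<close> elements, so at most one of them lies in
  \<open>L\<close>.\<close>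

lemma sparse_extend:
  assumes "sparse k S L" "T \<subseteq> S" "k \<le> card T" "T \<notin> L" "X \<subseteq> T" "card X \<le> k" "X \<notin> L"
  obtains B where "X \<subseteq> B" "B \<subseteq> T" "card B = k" "B \<notin> L"
proof -
  have fT: "finite T" using assms(1,2) finite_subset by (auto simp: sparse_def)
  consider "card X = k" | "card T = k" | "card X < k" "k < card T" using assms by linarith
  then show thesis
  proof cases
    case 1
    then show thesis using that[of X] assms by auto
  next
    case 2
    then show thesis using that[of T] assms by auto
  next
    case 3
    then have "card X \<le> k - 1" "k - 1 \<le> card T" by linarith+
    then obtain Y where Y: "X \<subseteq> Y" "Y \<subseteq> T" "card Y = k - 1"
      using exists_subset_between[of X "k - 1" T] assms(5) fT by blast
    have fY: "finite Y" using Y fT finite_subset by blast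
    have "1 < card (T - Y)" using 3 Y fY by (simp add: card_Diff_subset)
    then obtain x y where xy: "x \<in> T - Y" "y \<in> T - Y" "x \<noteq> y"
      by (metis One_nat_def card_le_Suc0_iff_eq fT finite_Diff not_less)
    have c: "card (insert x Y) = k" "card (insert y Y) = k" using xy Y fY 3 by auto
    have "insert x Y \<inter> insert y Y = Y" "insert x Y \<noteq> insert y Y" using xy by auto
    then have "\<not> (insert x Y \<in> L \<and> insert y Y \<in> L)" using assms(1) Y(3) by (force simp: sparse_def)
    then show thesis using that[of "insert x Y"] that[of "insert y Y"] Y xy c by auto
  qed
qed

lemma basis_sparse_paving:
  assumes "sparse k S L"
  shows "basis (sparse_paving k S L) B \<longleftrightarrow> B \<subseteq> S \<and> card B = k \<and> B \<notin> L"
proof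
  assume b: "basis (sparse_paving k S L) B"
  then have B: "B \<subseteq> S" "card B \<le> k" "B \<notin> L" by (auto simp: basis_def sparse_paving_def)
  have "S \<notin> L" "k \<le> card S" using assms by (auto simp: sparse_def)
  then obtain J where J: "B \<subseteq> J" "J \<subseteq> S" "card J = k" "J \<notin> L"
    using sparse_extend[OF assms, of S B] B by blast
  then have "J = B" using b by (auto simp: basis_def sparse_paving_def)
  then show "B \<subseteq> S \<and> card B = k \<and> B \<notin> L" using J by simp
next
  assume B: "B \<subseteq> S \<and> card B = k \<and> B \<notin> L"
  have "I = B" if "I \<subseteq> S" "card I \<le> k" "B \<subseteq> I" for I
    using that B card_seteq[of I B] finite_subset[of I S] assms by (auto simp: sparse_def)
  then show "basis (sparse_paving k S L) B" using B by (auto simp: basis_def sparse_paving_def)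
qed

text \<open>The bases are the \<open>k\<close>-sets outside \<open>L\<close>, so those of the dual
  are the complements of these.\<close>

lemma dual_sparse_paving:
  assumes "sparse k S L"
  shows "dual (sparse_paving k S L) = sparse_paving (card S - k) S ((\<lambda>A. S - A) ` L)"
proof -
  have fS: "finite S" using assms by (simp add: sparse_def)
  have "(\<exists>B. basis (sparse_paving k S L) B \<and> X \<subseteq> S - B) \<longleftrightarrow>
      card X \<le> card S - k \<and> X \<notin> (\<lambda>A. S - A) ` L" if X: "X \<subseteq> S" for X
  proof
    assume "\<exists>B. basis (sparse_paving k S L) B \<and> X \<subseteq> S - B"
    then obtain B where B: "B \<subseteq> S" "card B = k" "B \<notin> L" "X \<subseteq> S - B"
      using basis_sparse_paving[OF assms] by auto
    have "card X \<le> card (S - B)" using B fS by (intro card_mono) auto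
    then have "card X \<le> card S - k" using B fS by (simp add: card_Diff_subset finite_subset)
    moreover have "X \<noteq> S - A" if A: "A \<in> L" for A
    proof
      assume "X = S - A"
      moreover have "A \<subseteq> S" "card A = k" using A assms by (auto simp: sparse_def)
      ultimately have "B \<subseteq> A" "card A = card B" "finite A" using B fS finite_subset by auto
      then have "B = A" by (intro card_seteq) auto
      then show False using A B by simp
    qed
    ultimately show "card X \<le> card S - k \<and> X \<notin> (\<lambda>A. S - A) ` L" by auto
  next
    assume c: "card X \<le> card S - k \<and> X \<notin> (\<lambda>A. S - A) ` L"
    have "S - (S - X) = X" using X by auto
    then have "S - X \<notin> L" using c by (metis imageI)
    moreover have "k \<le> card (S - X)"
      using c X fS assms by (auto simp: card_Diff_subset finite_subset sparse_def)
    moreover have "{} \<notin> L" using assms by (auto simp: sparse_def)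
    ultimately obtain B where "B \<subseteq> S - X" "card B = k" "B \<notin> L"
      using sparse_extend[OF assms, of "S - X" "{}"] by auto
    then show "\<exists>B. basis (sparse_paving k S L) B \<and> X \<subseteq> S - B"
      using basis_sparse_paving[OF assms] X by blast
  qed
  then show ?thesis by (auto simp: Defs.dual_def sparse_paving_def)
qed

lemma sparse_paving_iso_image:
  assumes "inj_on f S" "\<And>A. A \<in> L \<Longrightarrow> A \<subseteq> S"
  shows "matroid_iso (sparse_paving k S L) (sparse_paving k (f ` S) ((`) f ` L))"
  unfolding matroid_iso_def
proof (intro exI[of _ f] conjI allI impI)
  show "bij_betw f (ground (sparse_paving k S L)) (ground (sparse_paving k (f ` S) ((`) f ` L)))"
    using assms(1) by (simp add: sparse_paving_def bij_betw_def)
  fix X assume "X \<subseteq> ground (sparse_paving k S L)"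
  then have X: "X \<subseteq> S" by (simp add: sparse_paving_def)
  then have "card (f ` X) = card X" using assms(1) by (meson card_image inj_on_subset)
  moreover have "f ` X \<in> (`) f ` L \<longleftrightarrow> X \<in> L"
    using inj_on_image_eq_iff[OF assms(1) X] assms(2) by auto
  ultimately show "X \<in> indeps (sparse_paving k S L) \<longleftrightarrow>
      f ` X \<in> indeps (sparse_paving k (f ` S) ((`) f ` L))"
    using X by (auto simp: sparse_paving_def)
qed

lemma (in rank_function) has_rank_minor_sparse_paving_image:
  assumes "inj_on f S" "\<And>A. A \<in> L \<Longrightarrow> A \<subseteq> S"
  shows "has_rank_minor E r (sparse_paving k (f ` S) ((`) f ` L)) \<longleftrightarrow>
    has_rank_minor E r (sparse_paving k S L)"
proof
  assume "has_rank_minor E r (sparse_paving k (f ` S) ((`) f ` L))"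
  then show "has_rank_minor E r (sparse_paving k S L)"
    using has_rank_minor_isomorphic sparse_paving_iso_image[OF assms] by blast
next
  assume m: "has_rank_minor E r (sparse_paving k S L)"
  let ?h = "inv_into S f"
  have h: "?h ` f ` X = X" if "X \<subseteq> S" for X using that assms(1) by (auto simp: inv_into_f_f image_iff subset_iff)
  have "(`) ?h ` (`) f ` L = L"
  proof -
    have "(`) ?h ` (`) f ` L = (\<lambda>A. A) ` L"
      unfolding image_image[of "(`) ?h" "(`) f"] by (rule image_cong) (use h assms(2) in auto)
    then show ?thesis by simp
  qed
  moreover have "matroid_iso (sparse_paving k (f ` S) ((`) f ` L))
      (sparse_paving k (?h ` f ` S) ((`) ?h ` (`) f ` L))"
    by (rule sparse_paving_iso_image) (use assms in \<open>auto simp: inj_on_inv_into\<close>)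
  ultimately show "has_rank_minor E r (sparse_paving k (f ` S) ((`) f ` L))"
    using has_rank_minor_isomorphic[OF m] h[of S] by simp
qed

text \<open>Testing the \<open>k\<close>-sets is enough: a smaller set lies in a
  \<open>k\<close>-set outside \<open>L\<close>, and a larger set is dependent by the bound on the
  total rank.\<close>

lemma (in rank_function) has_rank_minor_sparse_pavingI:
  assumes "sparse k S L" "C \<subseteq> E" "inj_on g S" "g ` S \<subseteq> E - C" "r (g ` S \<union> C) \<le> r C + int k"
    "\<And>A. A \<subseteq> S \<Longrightarrow> card A = k \<Longrightarrow> r (g ` A \<union> C) = r C + int k \<longleftrightarrow> A \<notin> L"
  shows "has_rank_minor E r (sparse_paving k S L)"
proof (rule has_rank_minorI[of C _ g])
  fix X assume "X \<subseteq> ground (sparse_paving k S L)"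
  then have X: "X \<subseteq> S" by (simp add: sparse_paving_def)
  have fS: "finite S" using assms(1) by (simp add: sparse_def)
  interpret c: rank_function "g ` S" "contract_rank r C" by (rule contract) (use assms in auto)
  interpret p: rank_function S "\<lambda>X. contract_rank r C (g ` X)"
    by (rule c.pullback) (use assms(3) fS in auto)
  let ?\<rho> = "\<lambda>X. contract_rank r C (g ` X)"
  have k: "?\<rho> A = int k \<longleftrightarrow> A \<notin> L" if "A \<subseteq> S" "card A = k" for A
    using assms(6)[OF that] by (auto simp: contract_rank_def)
  have "card X \<le> k \<and> X \<notin> L \<longleftrightarrow> ?\<rho> X = int (card X)"
  proof
    assume c: "card X \<le> k \<and> X \<notin> L"
    have "S \<notin> L" "k \<le> card S" using assms(1) by (auto simp: sparse_def)
    then obtain B where B: "X \<subseteq> B" "B \<subseteq> S" "card B = k" "B \<notin> L"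
      using sparse_extend[OF assms(1), of S X] c X by blast
    then show "?\<rho> X = int (card X)" using p.indep_sub[OF B(1,2)] k[OF B(2,3)] by simp
  next
    assume i: "?\<rho> X = int (card X)"
    have "?\<rho> X \<le> ?\<rho> S" using p.r_mono X by blast
    then have "card X \<le> k" using i assms(5) by (simp add: contract_rank_def)
    moreover have "X \<notin> L" using k[OF X] i assms(1) by (auto simp: sparse_def)
    ultimately show "card X \<le> k \<and> X \<notin> L" by simp
  qed
  then show "X \<in> indeps (sparse_paving k S L) \<longleftrightarrow> r (g ` X \<union> C) = r C + int (card X)"
    using X by (auto simp: sparse_paving_def contract_rank_def)
qed (use assms in \<open>auto simp: sparse_paving_def\<close>)

text \<open>The two conditionals are the ranks of \<open>A\<close> and of its complement in the
  sparse paving matroid, so the inequality says that every \<open>m\<close>-set has connectivity at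
  least 2. The first \<open>m\<close> elements of an inherited ordering of width one contradict
  this.\<close>

lemma (in rank_function) no_sparse_paving_minor:
  assumes "width1 E r es" "sparse k S L"
    and "\<And>A. A \<subseteq> S \<Longrightarrow> card A = m \<Longrightarrow> Suc k <
      (if A \<in> L then k - 1 else min k m) + (if S - A \<in> L then k - 1 else min k (card S - m))"
    and "m \<le> card S"
  shows "\<not> has_rank_minor E r (sparse_paving k S L)"
proof
  assume "has_rank_minor E r (sparse_paving k S L)"
  then obtain \<rho> A where \<rho>: "rank_function S \<rho>"
    "\<And>X. X \<subseteq> S \<Longrightarrow> X \<in> indeps (sparse_paving k S L) \<longleftrightarrow> \<rho> X = int (card X)"
    "A \<subseteq> S" "card A = m" "\<rho> A + \<rho> (S - A) \<le> \<rho> S + 1"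
    using width1_rank_minor[OF assms(1), of "sparse_paving k S L" m] assms(4)
    by (auto simp: sparse_paving_def)
  interpret p: rank_function S \<rho> by fact
  have ind: "card X \<le> k \<and> X \<notin> L \<longleftrightarrow> \<rho> X = int (card X)" if "X \<subseteq> S" for X
    using \<rho>(2)[OF that] that by (auto simp: sparse_paving_def)
  obtain B where "B \<subseteq> S" "\<rho> B = int (card B)" "\<rho> B = \<rho> S"
    using p.ex_basis[of "{}" S] p.r_empty by auto
  then have top: "\<rho> S \<le> int k" using ind[of B] by simp
  have low: "int (if X \<in> L then k - 1 else min k (card X)) \<le> \<rho> X" if X: "X \<subseteq> S" for X
  proof -
    have fX: "finite X" using X p.finite_sub by blast
    show ?thesis
    proof (cases "X \<in> L")
      case True
      then have c: "card X = k" "X \<noteq> {}" using assms(2) by (auto simp: sparse_def)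
      then obtain x where x: "x \<in> X" by blast
      have cx: "card (X - {x}) = k - 1" using x c fX by simp
      then have "X - {x} \<notin> L" using assms(2) by (auto simp: sparse_def)
      then have "\<rho> (X - {x}) = int (k - 1)" using ind[of "X - {x}"] cx X by auto
      then show ?thesis using True p.r_mono[of "X - {x}" X] X by auto
    next
      case False
      show ?thesis
      proof (cases "card X \<le> k")
        case True
        then show ?thesis using False ind[OF X] by simp
      next
        case k: False
        moreover have "{} \<notin> L" using assms(2) by (auto simp: sparse_def)
        ultimately obtain B where B: "B \<subseteq> X" "card B = k" "B \<notin> L"
          using sparse_extend[OF assms(2) X _ False, of "{}"] by auto
        then show ?thesis using False k ind[of B] p.r_mono[of B X] X by auto
      qed
    qed
  qed
  have "card (S - A) = card S - m" using \<rho>(3,4) p.finite_sub by (simp add: card_Diff_subset)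
  then have "int (if A \<in> L then k - 1 else min k m) +
      int (if S - A \<in> L then k - 1 else min k (card S - m)) \<le> int (Suc k)"
    using low[OF \<rho>(3)] low[of "S - A"] \<rho>(4,5) top by auto
  moreover have "int (Suc k) < int ((if A \<in> L then k - 1 else min k m) +
      (if S - A \<in> L then k - 1 else min k (card S - m)))"
    using assms(3)[OF \<rho>(3,4)] by (simp only: of_nat_less_iff)
  ultimately show False by simp
qed

section \<open>The excluded minors as sparse paving matroids\<close>

text \<open>The elements are numbered as in \<open>k4_edge\<close>: 01, 02, 12, 03, 13, 23.\<close>

definition k4_triangles :: "nat set set" where
  "k4_triangles = {{0,1,2}, {0,3,4}, {1,3,5}, {2,4,5}}"

text \<open>Elements \<open>2 * j\<close> and \<open>2 * j + 1\<close> are the two edges at one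
  vertex of degree 2. A cycle consists of two such pairs, and its complement is the third.\<close>

definition k23_cycles :: "nat set set" where
  "k23_cycles = {{0,1,2,3}, {0,1,4,5}, {2,3,4,5}}"

text \<open>The parallel classes of \<open>M\<^sup>*(K\<^sub>2\<^sub>,\<^sub>3)\<close>, the triangle with doubled edges.\<close>

definition pairs :: "nat set set" where
  "pairs = {{0,1}, {2,3}, {4,5}}"

lemma uniform_eq: "uniform_matroid 2 4 = sparse_paving 2 {..<4} {}"
  by (simp add: uniform_matroid_def sparse_paving_def)

lemma sparse_u24: "sparse 2 {..<4::nat} {}"
  by (simp add: sparse_def)

lemma sparse_k4: "sparse 3 {..<6} k4_triangles"
  unfolding sparse_def k4_triangles_def by (intro conjI; (simp; fail)?; code_simp)

lemma sparse_k23: "sparse 4 {..<6} k23_cycles"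
  unfolding sparse_def k23_cycles_def by (intro conjI; (simp; fail)?; code_simp)

lemma sparse_pairs: "sparse 2 {..<6} pairs"
  unfolding sparse_def pairs_def by (intro conjI; (simp; fail)?; code_simp)

text \<open>\<open>Circ\<close> lists the edge sets of all cycles through their indices. It may
  exceed \<open>L\<close> by cycles with more than \<open>k\<close> edges, as the four-cycles of
  \<open>K\<^sub>4\<close> do.\<close>

lemma cycle_matroid_eq_sparse_paving:
  assumes f: "inj_on f S" "f ` S = edges H" and L: "L \<subseteq> Circ" "\<And>A. A \<in> Circ \<Longrightarrow> A \<subseteq> S"
    and cyc: "\<And>vs. is_cycle H vs \<Longrightarrow> cycle_edges vs \<in> (`) f ` Circ"
    and circ: "\<And>A. A \<in> Circ \<Longrightarrow> \<exists>vs. is_cycle H vs \<and> cycle_edges vs = f ` A"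
    and sub: "\<And>X. X \<subseteq> S \<Longrightarrow> (\<exists>A\<in>Circ. A \<subseteq> X) \<longleftrightarrow> \<not> (card X \<le> k \<and> X \<notin> L)"
  shows "cycle_matroid H = sparse_paving k (f ` S) ((`) f ` L)"
proof -
  have "(\<nexists>vs. is_cycle H vs \<and> cycle_edges vs \<subseteq> F) \<longleftrightarrow> card F \<le> k \<and> F \<notin> (`) f ` L"
    if F: "F \<subseteq> f ` S" for F
  proof -
    obtain X where X: "X \<subseteq> S" "F = f ` X" using F by (meson subset_imageE)
    have "(\<exists>vs. is_cycle H vs \<and> cycle_edges vs \<subseteq> F) \<longleftrightarrow> (\<exists>A\<in>Circ. f ` A \<subseteq> f ` X)"
      using cyc circ X(2) by (metis imageE)
    also have "\<dots> \<longleftrightarrow> (\<exists>A\<in>Circ. A \<subseteq> X)"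
    proof -
      have "f ` A \<subseteq> f ` X \<longleftrightarrow> A \<subseteq> X" if "A \<in> Circ" for A
        using inj_on_image_mem_iff[OF f(1) _ X(1)] L(2)[OF that] by blast
      then show ?thesis by (intro bex_cong refl)
    qed
    also have "\<dots> \<longleftrightarrow> \<not> (card F \<le> k \<and> F \<notin> (`) f ` L)"
    proof -
      have c: "card F = card X" using card_image[OF inj_on_subset[OF f(1) X(1)]] X(2) by simp
      have i: "F \<in> (`) f ` L \<longleftrightarrow> X \<in> L"
      proof
        assume "F \<in> (`) f ` L"
        then obtain A where A: "A \<in> L" "f ` X = f ` A" using X(2) by (elim imageE) simp
        then have "A \<subseteq> S" using L by (meson subsetD)
        then have "X = A" using inj_on_image_eq_iff[OF f(1) X(1)] A(2) by blast
        then show "X \<in> L" using A(1) by simp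
      qed (simp add: X(2))
      show ?thesis unfolding c i by (rule sub[OF X(1)])
    qed
    finally show ?thesis by (simp only: not_not)
  qed
  then show ?thesis using f(2) by (auto simp: cycle_matroid_def sparse_paving_def)
qed

section \<open>The cycles of \<open>K\<^sub>4\<close> and of
  \<open>K\<^sub>2\<^sub>,\<^sub>3\<close>\<close>

lemma cycle_edges_3: "cycle_edges [x, y, z] = {{x, y}, {y, z}, {z, x}}"
proof -
  have "{..<length [x, y, z]} = {0, 1, 2}" by auto
  then show ?thesis unfolding cycle_edges_def by simp
qed

lemma cycle_edges_4: "cycle_edges [x, y, z, w] = {{x, y}, {y, z}, {z, w}, {w, x}}"
proof -
  have "{..<length [x, y, z, w]} = {0, 1, 2, 3}" by auto
  then show ?thesis unfolding cycle_edges_def by simp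
qed

lemma cycle_edges_5: "cycle_edges [x, y, z, w, u] = {{x, y}, {y, z}, {z, w}, {w, u}, {u, x}}"
proof -
  have "{..<length [x, y, z, w, u]} = {0, 1, 2, 3, 4}" by auto
  then show ?thesis unfolding cycle_edges_def by simp
qed

lemma length_3_conv: "length xs = 3 \<longleftrightarrow> (\<exists>x y z. xs = [x, y, z])"
  by (auto simp: numeral_eq_Suc length_Suc_conv)

lemma length_4_conv: "length xs = 4 \<longleftrightarrow> (\<exists>x y z w. xs = [x, y, z, w])"
  by (auto simp: numeral_eq_Suc length_Suc_conv)

lemma length_5_conv: "length xs = 5 \<longleftrightarrow> (\<exists>x y z w u. xs = [x, y, z, w, u])"
  by (auto simp: numeral_eq_Suc length_Suc_conv)

definition k4_edge :: "nat \<Rightarrow> nat set" where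
  "k4_edge i = [{0,1}, {0,2}, {1,2}, {0,3}, {1,3}, {2,3}] ! i"

definition k23_edge :: "nat \<Rightarrow> (nat + nat) set" where
  "k23_edge i = {Inl (i mod 2), Inr (i div 2)}"

lemma lessThan_6: "{..<6::nat} = {0, 1, 2, 3, 4, 5}"
  by auto

lemma less_2_cases: "(i::nat) < 2 \<longleftrightarrow> i = 0 \<or> i = 1"
  by auto

lemma less_3_cases: "(i::nat) < 3 \<longleftrightarrow> i = 0 \<or> i = 1 \<or> i = 2"
  by auto

lemma edges_k4: "edges (complete_graph 4) = {{0,1}, {0,2}, {1,2}, {0,3}, {1,3}, {2,3::nat}}"
proof -
  have "edges (complete_graph 4) = (\<lambda>(u, v). {u, v}) ` {(u, v) \<in> {..<4} \<times> {..<4}. u \<noteq> v}"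
    by (auto simp: complete_graph_def)
  also have "\<dots> = {{0,1}, {0,2}, {1,2}, {0,3}, {1,3}, {2,3::nat}}" by code_simp
  finally show ?thesis .
qed

lemma edges_k23: "edges (complete_bipartite_graph 2 3) =
    {{Inl 0, Inr 0}, {Inl 1, Inr 0}, {Inl 0, Inr 1}, {Inl 1, Inr 1}, {Inl 0, Inr 2}, {Inl 1, Inr (2::nat)}}"
  by (auto simp: complete_bipartite_graph_def less_2_cases less_3_cases)

lemma image_k4_edge: "k4_edge ` {..<6} = edges (complete_graph 4)"
  unfolding edges_k4 lessThan_6 by (simp add: k4_edge_def numeral_eq_Suc)

lemma image_k23_edge: "k23_edge ` {..<6} = edges (complete_bipartite_graph 2 3)"
  unfolding edges_k23 lessThan_6 by (simp add: k23_edge_def)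

lemma inj_k4_edge: "inj_on k4_edge {..<6}"
  unfolding lessThan_6 by (simp add: k4_edge_def numeral_eq_Suc doubleton_eq_iff)

lemma inj_k23_edge: "inj_on k23_edge {..<6}"
  unfolding lessThan_6 by (simp add: k23_edge_def doubleton_eq_iff)

text \<open>The three sets of size 4 are the four-cycles, the complements of the perfect
  matchings.\<close>

lemma k4_subsets:
  "\<forall>X\<in>Pow {..<6}. (\<exists>A\<in>k4_triangles \<union> {{0,2,3,5}, {0,1,4,5}, {1,2,3,4}}. A \<subseteq> X)
     \<longleftrightarrow> \<not> (card X \<le> 3 \<and> X \<notin> k4_triangles)"
  unfolding k4_triangles_def by code_simp

lemma k23_subsets:
  "\<forall>X\<in>Pow {..<6}. (\<exists>A\<in>k23_cycles. A \<subseteq> X) \<longleftrightarrow> \<not> (card X \<le> 4 \<and> X \<notin> k23_cycles)"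
  unfolding k23_cycles_def by code_simp

lemma k4_cycles_3:
  "\<forall>x\<in>{0,1,2,3}. \<forall>y\<in>{0,1,2,3}. x \<noteq> y \<longrightarrow> (\<forall>z\<in>{0,1,2,3}. x \<noteq> z \<and> y \<noteq> z \<longrightarrow>
     {{x, y}, {y, z}, {z, x}} \<in> (`) k4_edge ` k4_triangles)"
proof -
  have "(`) k4_edge ` k4_triangles = {{{0,1}, {0,2}, {1,2}}, {{0,1}, {0,3}, {1,3}},
      {{0,2}, {0,3}, {2,3}}, {{1,2}, {1,3}, {2,3}}}"
    unfolding k4_triangles_def by code_simp
  then show ?thesis by (simp only:) code_simp
qed

lemma k4_cycles_4:
  "\<forall>x\<in>{0,1,2,3}. \<forall>y\<in>{0,1,2,3}. x \<noteq> y \<longrightarrow> (\<forall>z\<in>{0,1,2,3}. x \<noteq> z \<and> y \<noteq> z \<longrightarrow>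
     (\<forall>w\<in>{0,1,2,3}. x \<noteq> w \<and> y \<noteq> w \<and> z \<noteq> w \<longrightarrow>
       {{x, y}, {y, z}, {z, w}, {w, x}} \<in> (`) k4_edge ` {{0,2,3,5}, {0,1,4,5}, {1,2,3,4}}))"
proof -
  have "(`) k4_edge ` {{0,2,3,5}, {0,1,4,5}, {1,2,3,4}} =
      {{{0,1}, {1,2}, {2,3}, {0,3}}, {{0,1}, {1,3}, {2,3}, {0,2}}, {{0,2}, {1,2}, {1,3}, {0,3}}}"
    by code_simp
  then show ?thesis by (simp only:) code_simp
qed

lemma k4_circuits:
  "\<forall>A\<in>k4_triangles \<union> {{0,2,3,5}, {0,1,4,5}, {1,2,3,4}}.
     \<exists>vs. distinct vs \<and> 3 \<le> length vs \<and> set vs \<subseteq> {0,1,2,3} \<and> cycle_edges vs = k4_edge ` A"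
proof -
  define P where "P A vs \<longleftrightarrow> distinct vs \<and> 3 \<le> length vs \<and> set vs \<subseteq> {0,1,2,3} \<and>
    cycle_edges vs = k4_edge ` A" for A vs
  have "P {0,1,2} [0,1,2]" unfolding P_def cycle_edges_3 by code_simp
  moreover have "P {0,3,4} [0,1,3]" unfolding P_def cycle_edges_3 by code_simp
  moreover have "P {1,3,5} [0,2,3]" unfolding P_def cycle_edges_3 by code_simp
  moreover have "P {2,4,5} [1,2,3]" unfolding P_def cycle_edges_3 by code_simp
  moreover have "P {0,2,3,5} [0,1,2,3]" unfolding P_def cycle_edges_4 by code_simp
  moreover have "P {0,1,4,5} [0,1,3,2]" unfolding P_def cycle_edges_4 by code_simp
  moreover have "P {1,2,3,4} [0,2,1,3]" unfolding P_def cycle_edges_4 by code_simp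
  ultimately have "\<forall>A\<in>k4_triangles \<union> {{0,2,3,5}, {0,1,4,5}, {1,2,3,4}}. \<exists>vs. P A vs"
    unfolding k4_triangles_def ball_Un ball_simps by iprover
  then show ?thesis unfolding P_def .
qed

lemma cycle_matroid_k4:
  "cycle_matroid (complete_graph 4) = sparse_paving 3 (k4_edge ` {..<6}) ((`) k4_edge ` k4_triangles)"
proof (rule cycle_matroid_eq_sparse_paving)
  let ?Circ = "k4_triangles \<union> {{0,2,3,5}, {0,1,4,5}, {1,2,3,4}}"
  show "inj_on k4_edge {..<6}" by (rule inj_k4_edge)
  show "k4_edge ` {..<6} = edges (complete_graph 4)" by (rule image_k4_edge)
  show "k4_triangles \<subseteq> ?Circ" by (rule Un_upper1)
  show Circ: "A \<subseteq> {..<6}" if "A \<in> ?Circ" for A using that by (auto simp: k4_triangles_def)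
  show "(\<exists>A\<in>?Circ. A \<subseteq> X) \<longleftrightarrow> \<not> (card X \<le> 3 \<and> X \<notin> k4_triangles)" if "X \<subseteq> {..<6}" for X
    using k4_subsets that by blast
  show "\<exists>vs. is_cycle (complete_graph 4) vs \<and> cycle_edges vs = k4_edge ` A" if A: "A \<in> ?Circ" for A
  proof -
    obtain vs where vs: "distinct vs" "3 \<le> length vs" "set vs \<subseteq> {0,1,2,3}" "cycle_edges vs = k4_edge ` A"
      using bspec[OF k4_circuits A] by blast
    moreover have "cycle_edges vs \<subseteq> edges (complete_graph 4)"
      unfolding vs(4) image_k4_edge[symmetric] using Circ[OF A] by (rule image_mono)
    moreover have "verts (complete_graph 4) = {0,1,2,3}" by (auto simp: complete_graph_def)
    ultimately show ?thesis unfolding is_cycle_def by metis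
  qed
  show "cycle_edges vs \<in> (`) k4_edge ` ?Circ" if c: "is_cycle (complete_graph 4) vs" for vs
  proof -
    have vs: "distinct vs" "3 \<le> length vs" "set vs \<subseteq> {0,1,2,3}"
      using c by (auto simp: is_cycle_def complete_graph_def)
    have "length vs \<le> 4" using card_mono[OF _ vs(3)] distinct_card[OF vs(1)] by simp
    then have "length vs = 3 \<or> length vs = 4" using vs(2) by auto
    then consider x y z where "vs = [x, y, z]" | x y z w where "vs = [x, y, z, w]"
      unfolding length_3_conv length_4_conv by blast
    then show ?thesis
    proof cases
      case 1
      have "x \<in> {0,1,2,3}" "y \<in> {0,1,2,3}" "z \<in> {0,1,2,3}"
        using vs(3) unfolding 1 list.set insert_subset by - (elim conjE, assumption)+
      moreover have "x \<noteq> y" "x \<noteq> z" "y \<noteq> z" using vs(1) unfolding 1 by auto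
      ultimately have "cycle_edges vs \<in> (`) k4_edge ` k4_triangles"
        unfolding 1 cycle_edges_3 by (intro k4_cycles_3[rule_format] conjI)
      then show ?thesis unfolding image_Un by (rule UnI1)
    next
      case 2
      have "x \<in> {0,1,2,3}" "y \<in> {0,1,2,3}" "z \<in> {0,1,2,3}" "w \<in> {0,1,2,3}"
        using vs(3) unfolding 2 list.set insert_subset by - (elim conjE, assumption)+
      moreover have "x \<noteq> y" "x \<noteq> z" "y \<noteq> z" "x \<noteq> w" "y \<noteq> w" "z \<noteq> w"
        using vs(1) unfolding 2 by auto
      ultimately have "cycle_edges vs \<in> (`) k4_edge ` {{0,2,3,5}, {0,1,4,5}, {1,2,3,4}}"
        unfolding 2 cycle_edges_4 by (intro k4_cycles_4[rule_format] conjI)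
      then show ?thesis unfolding image_Un by (rule UnI2)
    qed
  qed
qed

abbreviation k23_verts :: "(nat + nat) set" where
  "k23_verts \<equiv> {Inl 0, Inl 1, Inr 0, Inr 1, Inr 2}"

abbreviation k23_edges :: "(nat + nat) set set" where
  "k23_edges \<equiv>
    {{Inl 0, Inr 0}, {Inl 1, Inr 0}, {Inl 0, Inr 1}, {Inl 1, Inr 1}, {Inl 0, Inr 2}, {Inl 1, Inr 2}}"

lemma k23_cycles_4:
  "\<forall>i\<in>{0,1}. \<forall>j\<in>{0,1,2}. \<forall>k\<in>{0,1}. \<forall>l\<in>{0,1,2}. i \<noteq> k \<and> j \<noteq> l \<longrightarrow>
    {{Inl i, Inr j}, {Inr j, Inl k}, {Inl k, Inr l}, {Inr l, Inl i}} \<in> (`) k23_edge ` k23_cycles"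
proof -
  have "(`) k23_edge ` k23_cycles =
     {{{Inl 0, Inr 0}, {Inl 1, Inr 0}, {Inl 0, Inr 1}, {Inl 1, Inr 1}},
      {{Inl 0, Inr 0}, {Inl 1, Inr 0}, {Inl 0, Inr 2}, {Inl 1, Inr 2}},
      {{Inl 0, Inr 1}, {Inl 1, Inr 1}, {Inl 0, Inr 2}, {Inl 1, Inr 2}}}"
    unfolding k23_cycles_def by code_simp
  then show ?thesis by (simp only:) code_simp
qed

text \<open>The two sides alternate along a cycle, which excludes the odd lengths 3 and 5.\<close>

lemma k23_edges_isl: "{x, y} \<in> k23_edges \<Longrightarrow> isl x \<noteq> isl y"
  by (auto simp: doubleton_eq_iff)

lemma k23_circuits:
  "\<forall>A\<in>k23_cycles. \<exists>vs\<in>{[Inl 0, Inr 0, Inl 1, Inr 1], [Inl 0, Inr 0, Inl 1, Inr 2], [Inl 0, Inr 1, Inl 1, Inr 2]}.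
       distinct vs \<and> 3 \<le> length vs \<and> set vs \<subseteq> k23_verts \<and> cycle_edges vs = k23_edge ` A"
  unfolding k23_cycles_def by code_simp

lemma verts_k23: "verts (complete_bipartite_graph 2 3) = k23_verts"
  by (auto simp: complete_bipartite_graph_def less_2_cases less_3_cases)

lemma cycle_matroid_k23:
  "cycle_matroid (complete_bipartite_graph 2 3) =
    sparse_paving 4 (k23_edge ` {..<6}) ((`) k23_edge ` k23_cycles)"
proof (rule cycle_matroid_eq_sparse_paving)
  show "inj_on k23_edge {..<6}" by (rule inj_k23_edge)
  show "k23_edge ` {..<6} = edges (complete_bipartite_graph 2 3)" by (rule image_k23_edge)
  show "k23_cycles \<subseteq> k23_cycles" by (rule order_refl)
  show Circ: "A \<subseteq> {..<6}" if "A \<in> k23_cycles" for A using that by (auto simp: k23_cycles_def)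
  show "(\<exists>A\<in>k23_cycles. A \<subseteq> X) \<longleftrightarrow> \<not> (card X \<le> 4 \<and> X \<notin> k23_cycles)" if "X \<subseteq> {..<6}" for X
    using k23_subsets that by blast
  show "\<exists>vs. is_cycle (complete_bipartite_graph 2 3) vs \<and> cycle_edges vs = k23_edge ` A"
    if A: "A \<in> k23_cycles" for A
  proof -
    obtain vs where vs: "distinct vs" "3 \<le> length vs" "set vs \<subseteq> k23_verts" "cycle_edges vs = k23_edge ` A"
      using bspec[OF k23_circuits A] by blast
    moreover have "cycle_edges vs \<subseteq> edges (complete_bipartite_graph 2 3)"
      unfolding vs(4) image_k23_edge[symmetric] using Circ[OF A] by (rule image_mono)
    ultimately show ?thesis unfolding is_cycle_def verts_k23 by metis
  qed
  show "cycle_edges vs \<in> (`) k23_edge ` k23_cycles" if c: "is_cycle (complete_bipartite_graph 2 3) vs" for vs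
  proof -
    have vs: "distinct vs" "3 \<le> length vs" "set vs \<subseteq> k23_verts" "cycle_edges vs \<subseteq> k23_edges"
      using c unfolding is_cycle_def verts_k23 edges_k23 by auto
    have "length vs \<le> 5" using card_mono[OF _ vs(3)] distinct_card[OF vs(1)] by simp
    then have "length vs = 3 \<or> length vs = 4 \<or> length vs = 5" using vs(2) by auto
    then consider x y z where "vs = [x, y, z]" | x y z w where "vs = [x, y, z, w]"
      | x y z w u where "vs = [x, y, z, w, u]"
      unfolding length_3_conv length_4_conv length_5_conv by blast
    then show ?thesis
    proof cases
      case 1
      have *: "{x, y} \<in> k23_edges" "{y, z} \<in> k23_edges" "{z, x} \<in> k23_edges"
        using vs(4) unfolding 1 cycle_edges_3 insert_subset by - (elim conjE, assumption)+
      show ?thesis using *[THEN k23_edges_isl] by auto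
    next
      case 2
      have *: "{x, y} \<in> k23_edges" "{y, z} \<in> k23_edges" "{z, w} \<in> k23_edges"
        using vs(4) unfolding 2 cycle_edges_4 insert_subset by - (elim conjE, assumption)+
      have V: "x \<in> k23_verts" "y \<in> k23_verts" "z \<in> k23_verts" "w \<in> k23_verts"
        using vs(3) unfolding 2 list.set insert_subset by - (elim conjE, assumption)+
      have d: "x \<noteq> z" "y \<noteq> w" using vs(1) unfolding 2 by auto
      have Inl: "\<exists>i\<in>{0,1}. a = Inl i" if "a \<in> k23_verts" "isl a" for a using that by auto
      have Inr: "\<exists>i\<in>{0,1,2}. a = Inr i" if "a \<in> k23_verts" "\<not> isl a" for a using that by auto
      show ?thesis
      proof (cases "isl x")
        case True
        then have "\<not> isl y" "isl z" "\<not> isl w" using *[THEN k23_edges_isl] by auto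
        then obtain i j k l where ijkl: "i \<in> {0,1}" "j \<in> {0,1,2}" "k \<in> {0,1}" "l \<in> {0,1,2}"
          "x = Inl i" "y = Inr j" "z = Inl k" "w = Inr l" using V True Inl Inr by metis
        then show ?thesis
          using k23_cycles_4[rule_format, of i j k l] d unfolding 2 cycle_edges_4 by simp
      next
        case False
        then have "isl y" "\<not> isl z" "isl w" using *[THEN k23_edges_isl] by auto
        then obtain i j k l where ijkl: "i \<in> {0,1}" "j \<in> {0,1,2}" "k \<in> {0,1}" "l \<in> {0,1,2}"
          "y = Inl i" "z = Inr j" "w = Inl k" "x = Inr l" using V False Inl Inr by metis
        \<comment> \<open>This cycle starts on the other side; rotating it by one vertex gives the
          form of the first case.\<close>
        have "{{x, y}, {y, z}, {z, w}, {w, x}} = {{y, z}, {z, w}, {w, x}, {x, y}}" by auto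
        then show ?thesis
          using k23_cycles_4[rule_format, of i j k l] d ijkl unfolding 2 cycle_edges_4 by simp
      qed
    next
      case 3
      have *: "{x, y} \<in> k23_edges" "{y, z} \<in> k23_edges" "{z, w} \<in> k23_edges" "{w, u} \<in> k23_edges" "{u, x} \<in> k23_edges"
        using vs(4) unfolding 3 cycle_edges_5 insert_subset by - (elim conjE, assumption)+
      show ?thesis using *[THEN k23_edges_isl] by auto
    qed
  qed
qed

section \<open>Width one excludes the four minors\<close>

context rank_function
begin

lemma has_rank_minor_k4:
  "has_rank_minor E r (cycle_matroid (complete_graph 4)) \<longleftrightarrow>
    has_rank_minor E r (sparse_paving 3 {..<6} k4_triangles)"
  unfolding cycle_matroid_k4
  by (rule has_rank_minor_sparse_paving_image[OF inj_k4_edge]) (auto simp: k4_triangles_def)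

lemma has_rank_minor_k23:
  "has_rank_minor E r (cycle_matroid (complete_bipartite_graph 2 3)) \<longleftrightarrow>
    has_rank_minor E r (sparse_paving 4 {..<6} k23_cycles)"
  unfolding cycle_matroid_k23
  by (rule has_rank_minor_sparse_paving_image[OF inj_k23_edge]) (auto simp: k23_cycles_def)

lemma has_rank_minor_dual_k23:
  "has_rank_minor E r (dual (cycle_matroid (complete_bipartite_graph 2 3))) \<longleftrightarrow>
    has_rank_minor E r (sparse_paving 2 {..<6} pairs)"
proof -
  let ?S = "k23_edge ` {..<6}" and ?L = "(`) k23_edge ` k23_cycles"
  have c: "card ?S = 6" using card_image[OF inj_k23_edge] by simp
  have "sparse 4 ?S ?L"
    unfolding sparse_def
  proof (intro conjI ballI impI)
    fix A B assume "A \<in> ?L" "B \<in> ?L" "A \<noteq> B"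
    then obtain A' B' where AB: "A' \<in> k23_cycles" "B' \<in> k23_cycles" "A = k23_edge ` A'" "B = k23_edge ` B'" "A' \<noteq> B'"
      by blast
    then have s: "A' \<subseteq> {..<6}" "B' \<subseteq> {..<6}" "Suc (card (A' \<inter> B')) < 4"
      using sparse_k23 unfolding sparse_def by auto
    then have "A \<inter> B = k23_edge ` (A' \<inter> B')" using inj_on_image_Int[OF inj_k23_edge] AB by auto
    moreover have "finite A'" using s(1) by (rule finite_subset) simp
    then have "card (k23_edge ` (A' \<inter> B')) \<le> card (A' \<inter> B')" by (intro card_image_le) simp
    ultimately show "Suc (card (A \<inter> B)) < 4" using s by simp
  next
    fix A assume "A \<in> ?L"
    then obtain A' where A: "A' \<in> k23_cycles" "A = k23_edge ` A'" by blast
    then have s: "A' \<subseteq> {..<6}" "card A' = 4" using sparse_k23 unfolding sparse_def by auto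
    show "A \<subseteq> ?S" using A s by auto
    show "card A = 4" using A s inj_k23_edge by (metis card_image inj_on_subset)
  qed (use c in auto)
  then have "dual (cycle_matroid (complete_bipartite_graph 2 3)) =
      sparse_paving 2 ?S ((\<lambda>A. ?S - A) ` ?L)"
    using dual_sparse_paving c unfolding cycle_matroid_k23 by fastforce
  also have "(\<lambda>A. ?S - A) ` ?L = (`) k23_edge ` (\<lambda>A. {..<6} - A) ` k23_cycles"
    unfolding image_image
  proof (rule image_cong[OF refl])
    fix A assume "A \<in> k23_cycles"
    then have "A \<subseteq> {..<6}" using sparse_k23 by (auto simp: sparse_def)
    then show "?S - k23_edge ` A = k23_edge ` ({..<6} - A)"
      using inj_on_image_set_diff[OF inj_k23_edge Diff_subset] by metis
  qed
  also have "(\<lambda>A. {..<6} - A) ` k23_cycles = pairs"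
    unfolding k23_cycles_def pairs_def lessThan_6 by code_simp
  finally have eq: "dual (cycle_matroid (complete_bipartite_graph 2 3)) =
      sparse_paving 2 ?S ((`) k23_edge ` pairs)" .
  show ?thesis
    unfolding eq
    by (rule has_rank_minor_sparse_paving_image[OF inj_k23_edge]) (auto simp: pairs_def)
qed

lemma no_excluded_minor_if_width1:
  assumes "width1 E r es"
  shows "\<not> has_rank_minor E r (sparse_paving 2 {..<4::nat} {})"
    and "\<not> has_rank_minor E r (sparse_paving 3 {..<6} k4_triangles)"
    and "\<not> has_rank_minor E r (sparse_paving 4 {..<6} k23_cycles)"
    and "\<not> has_rank_minor E r (sparse_paving 2 {..<6} pairs)"
proof -
  show "\<not> has_rank_minor E r (sparse_paving 2 {..<4::nat} {})"
    by (rule no_sparse_paving_minor[OF assms sparse_u24, of 2]) simp_all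
  \<comment> \<open>Two complementary halves are not both triangles, so their ranks add up to at
    least 3 + 2, which is two more than the rank 3.\<close>
  have "\<forall>A\<in>k4_triangles. {..<6} - A \<notin> k4_triangles" unfolding k4_triangles_def by code_simp
  then have "\<not> (A \<in> k4_triangles \<and> {..<6} - A \<in> k4_triangles)" for A by blast
  then have "Suc 3 < (if A \<in> k4_triangles then 3 - 1 else min 3 3) +
      (if {..<6} - A \<in> k4_triangles then 3 - 1 else min 3 (card {..<6::nat} - 3))" for A
    by (simp split: if_split)
  then show "\<not> has_rank_minor E r (sparse_paving 3 {..<6} k4_triangles)"
    by (rule no_sparse_paving_minor[OF assms sparse_k4]) simp
  \<comment> \<open>The listed sets have four or two elements, so no half of the six elements is
    exceptional. The connectivities of a half are 3 + 3 - 4 and 2 + 2 - 2.\<close>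
  have notin: "A \<notin> k23_cycles" "A \<notin> pairs" if "card A = 3" for A
    using sparse_k23 sparse_pairs that unfolding sparse_def by force+
  have compl: "card ({..<6::nat} - A) = 3" if "A \<subseteq> {..<6}" "card A = 3" for A
    using that card_Diff_subset[OF finite_subset[OF that(1)] that(1)] by simp
  show "\<not> has_rank_minor E r (sparse_paving 4 {..<6} k23_cycles)"
    by (rule no_sparse_paving_minor[OF assms sparse_k23, of 3]) (simp_all add: notin compl)
  show "\<not> has_rank_minor E r (sparse_paving 2 {..<6} pairs)"
    by (rule no_sparse_paving_minor[OF assms sparse_pairs, of 3]) (simp_all add: notin compl)
qed

end

section \<open>Parallel pairs\<close>

lemma two_subsets_of_six:
  assumes "A \<subseteq> {..<6}" "card A = 2" "A \<notin> pairs"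
  shows "A \<in> {{0,2}, {0,3}, {0,4}, {0,5}, {1,2}, {1,3}, {1,4}, {1,5}, {2,4}, {2,5}, {3,4}, {3,5::nat}}"
proof -
  have "\<forall>A\<in>Pow {..<6}. card A = 2 \<longrightarrow> A \<notin> pairs \<longrightarrow>
      A \<in> {{0,2}, {0,3}, {0,4}, {0,5}, {1,2}, {1,3}, {1,4}, {1,5}, {2,4}, {2,5}, {3,4}, {3,5::nat}}"
    unfolding pairs_def by code_simp
  from bspec[OF this, of A] assms show ?thesis by simp
qed

context rank_function
begin

lemma spanned_if_full:
  assumes "A \<subseteq> W" "W \<subseteq> E" "r A = r W" "w \<in> W"
  shows "r (insert w A) = r A"
proof -
  have "insert w A \<subseteq> W" "A \<subseteq> E" "w \<in> E" using assms by auto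
  then show ?thesis using r_mono[of "insert w A" W] r_le_insert[of A w] assms by linarith
qed

text \<open>Modulo \<open>C\<close> the two members of a pair span each other and can be exchanged
  in any set, so ranks need to be known only for \<open>a\<close>, \<open>b\<close> and
  \<open>c\<close>.\<close>

lemma pairs_minor:
  assumes C: "C \<subseteq> E" and p: "distinct [a, a', b, b', c, c']" "{a, a', b, b', c, c'} \<subseteq> E - C"
    and par: "r ({a, a'} \<union> C) = r C + 1" "r ({b, b'} \<union> C) = r C + 1" "r ({c, c'} \<union> C) = r C + 1"
    and single: "\<And>x. x \<in> {a, a', b, b', c, c'} \<Longrightarrow> r (insert x C) = r C + 1"
    and span: "r ({a, b} \<union> C) = r C + 2" "r ({a, c} \<union> C) = r C + 2" "r ({b, c} \<union> C) = r C + 2"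
      "r ({a, b, c} \<union> C) = r C + 2"
  shows "has_rank_minor E r (sparse_paving 2 {..<6} pairs)"
proof -
  let ?g = "nth [a, a', b, b', c, c']"
  let ?P = "{a, a', b, b', c, c'}"
  have img: "?g ` {..<6} = ?P" unfolding lessThan_6 by simp
  have PE: "?P \<subseteq> E" using p by auto
  have exch: "r (insert y (X \<union> C)) = r (insert x (insert y (X \<union> C)))"
    if "r ({x, y} \<union> C) = r C + 1" "x \<in> ?P" "y \<in> ?P" "X \<subseteq> E" for x y X
  proof -
    have "r (insert x (insert y (X \<union> C))) = r (insert y (X \<union> C))"
    proof (rule spanned_mono[of "insert y C"])
      show "r (insert x (insert y C)) = r (insert y C)" using that(1) single[OF that(3)] by simp
    qed (use that PE C in auto)
    then show ?thesis by simp
  qed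
  have sub: "r (insert y (X \<union> C)) = r (insert x (X \<union> C))"
    if "r ({x, y} \<union> C) = r C + 1" "x \<in> ?P" "y \<in> ?P" "X \<subseteq> E" for x y X
    using exch[of x y X] exch[of y x X] that by (simp add: insert_commute)
  have aa: "r (insert a' (X \<union> C)) = r (insert a (X \<union> C))" if "X \<subseteq> E" for X
    using sub[of a a' X] par(1) that by simp
  have bb: "r (insert b' (X \<union> C)) = r (insert b (X \<union> C))" if "X \<subseteq> E" for X
    using sub[of b b' X] par(2) that by simp
  have cc: "r (insert c' (X \<union> C)) = r (insert c (X \<union> C))" if "X \<subseteq> E" for X
    using sub[of c c' X] par(3) that by simp
  have E: "a \<in> E" "a' \<in> E" "b \<in> E" "b' \<in> E" "c \<in> E" "c' \<in> E" using PE by auto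
  have ab: "r ({x, y} \<union> C) = r C + 2" if "x \<in> {a, a'}" "y \<in> {b, b'}" for x y
    using that span(1) aa[of "{b}"] aa[of "{b'}"] bb[of "{a}"] E by (auto simp: insert_commute)
  have ac: "r ({x, y} \<union> C) = r C + 2" if "x \<in> {a, a'}" "y \<in> {c, c'}" for x y
    using that span(2) aa[of "{c}"] aa[of "{c'}"] cc[of "{a}"] E by (auto simp: insert_commute)
  have bc: "r ({x, y} \<union> C) = r C + 2" if "x \<in> {b, b'}" "y \<in> {c, c'}" for x y
    using that span(3) bb[of "{c}"] bb[of "{c'}"] cc[of "{b}"] E by (auto simp: insert_commute)
  have all: "r (?P \<union> C) = r C + 2"
  proof -
    have "?P \<union> C = insert a' ({a, b, b', c, c'} \<union> C)" by auto
    also have "r \<dots> = r (insert b' ({a, b, c, c'} \<union> C))" using aa[of "{a, b, b', c, c'}"] E by (simp add: insert_commute)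
    also have "\<dots> = r (insert c' ({a, b, c} \<union> C))" using bb[of "{a, b, c, c'}"] E by (simp add: insert_commute)
    also have "\<dots> = r ({a, b, c} \<union> C)" using cc[of "{a, b, c}"] E by (simp add: insert_commute)
    finally show ?thesis using span(4) by simp
  qed
  show ?thesis
  proof (rule has_rank_minor_sparse_pavingI[OF sparse_pairs C, of ?g])
    show "inj_on ?g {..<6}" using p(1) inj_on_nth[of "[a, a', b, b', c, c']" "{..<6}"] by auto
    show "?g ` {..<6} \<subseteq> E - C" unfolding img by fact
    show "r (?g ` {..<6} \<union> C) \<le> r C + int 2" unfolding img using all by simp
    fix A :: "nat set" assume A: "A \<subseteq> {..<6}" "card A = 2"
    show "r (?g ` A \<union> C) = r C + int 2 \<longleftrightarrow> A \<notin> pairs"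
    proof (cases "A \<in> pairs")
      case True
      then have "?g ` A \<in> {{a, a'}, {b, b'}, {c, c'}}" by (auto simp: pairs_def)
      then show ?thesis using par True by auto
    next
      case False
      then have "A \<in> {{0,2}, {0,3}, {0,4}, {0,5}, {1,2}, {1,3}, {1,4}, {1,5},
          {2,4}, {2,5}, {3,4}, {3,5}}" by (rule two_subsets_of_six[OF A])
      then have "\<exists>x y. ?g ` A = {x, y} \<and> (x \<in> {a, a'} \<and> y \<in> {b, b'} \<or> x \<in> {a, a'} \<and> y \<in> {c, c'} \<or>
          x \<in> {b, b'} \<and> y \<in> {c, c'})"
        by (elim insertE emptyE) (simp, blast)+
      then have "r (?g ` A \<union> C) = r C + 2" using ab ac bc by metis
      then show ?thesis using False by simp
    qed
  qed
qed

text \<open>The set \<open>D\<close> is the part in \<open>B\<close> of a circuit through \<open>f\<close>. If no basis exchange touched it,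
  then \<open>X - D\<close> would be a separator.\<close>

lemma exchange_in_side:
  assumes X: "X \<subseteq> E" and B: "B \<subseteq> X" "r B = int (card B)" "r B = r X" "B \<noteq> X"
    and Y: "Y \<subseteq> E" "E - X = insert e (insert f Y)" "r X + r Y \<le> r E"
    and D: "D \<subseteq> B" "r (insert f (D \<union> Y)) = r (D \<union> Y)" and par: "r {e, f} = r {f}"
    and conn: "\<And>S. S \<subseteq> E \<Longrightarrow> S \<noteq> {} \<Longrightarrow> S \<noteq> E \<Longrightarrow> 0 < conn E r S"
  obtains x b where "x \<in> X - B" "b \<in> D" "r (insert x (B - {b})) = int (card B)"
proof (rule ccontr)
  assume "\<not> thesis"
  then have no: "r (insert x (B - {b})) \<noteq> int (card B)" if "x \<in> X - B" "b \<in> D" for x b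
    using that \<open>\<And>b x. x \<in> X - B \<Longrightarrow> b \<in> D \<Longrightarrow> r (insert x (B - {b})) = int (card B) \<Longrightarrow> thesis\<close> by blast
  have BE: "B \<subseteq> E" using B X by blast
  have efE: "e \<in> E" "f \<in> E" "e \<notin> X" "f \<notin> X" using Y by auto
  have fB: "finite B" using BE finite_sub by auto
  have spB: "r (insert x B) = int (card B)" if "x \<in> X" for x
    using spanned_if_full[OF B(1) X B(3) that] B(2) by simp
  \<comment> \<open>Since no exchange involves \<open>D\<close>, the fundamental circuit of
    \<open>x\<close> avoids \<open>D\<close>, and \<open>x\<close> is spanned by
    \<open>B - D\<close> alone.\<close>
  have "r (insert x (B - D)) = r (B - D)" if x: "x \<in> X - B" for x
  proof -
    have xE: "x \<in> E" using x X by auto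
    have sp: "r (insert x B) = int (card B)" using spB x by blast
    obtain F where F: "F \<subseteq> B" "r (insert x F) = int (card F)"
      "\<And>b. b \<in> F \<Longrightarrow> r (insert x (B - {b})) = int (card B)"
      using fundamental[OF BE B(2) xE sp] by metis
    have "F \<subseteq> B - D"
    proof
      fix b assume b: "b \<in> F"
      have "b \<notin> D" using no[OF x] F(3)[OF b] by blast
      then show "b \<in> B - D" using F(1) b by blast
    qed
    moreover have "r (insert x F) = r F" using indep_sub[OF F(1) BE B(2)] F(2) by simp
    ultimately show ?thesis using spanned_mono[of F "B - D" x] BE xE by blast
  qed
  then have "r ((B - D) \<union> (X - B)) = r (B - D)"
    by (intro spanned_union) (use BE X in auto)
  moreover have "(B - D) \<union> (X - B) = X - D" using B(1) D(1) by blast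
  moreover have "r (B - D) = int (card (B - D))" using indep_sub[of "B - D" B] BE B by auto
  moreover have "card B = card D + card (B - D)" using card_split[OF D(1) BE] .
  ultimately have rS: "r (X - D) = r X - int (card D)" using B by simp
  \<comment> \<open>\<open>D\<close> and \<open>Y\<close> span \<open>f\<close> and hence
    \<open>e\<close>, so this side has rank at most \<open>card D + r Y\<close>. The other side has
    rank \<open>r X - card D\<close>, which makes the connectivity nonpositive.\<close>
  have co: "E - (X - D) = insert e (insert f (D \<union> Y))" using Y B D(1) X by blast
  have DE: "D \<subseteq> E" using D BE by blast
  have "0 < conn E r (X - D)"
  proof (rule conn)
    show "X - D \<subseteq> E" using X by auto
    show "X - D \<noteq> {}" using B D by auto
    show "X - D \<noteq> E" using efE by auto
  qed
  moreover have "r (insert e (insert f (D \<union> Y))) = r (insert f (D \<union> Y))"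
    by (rule spanned_mono[of "{f}"]) (use par DE Y(1) efE in auto)
  moreover have "r (D \<union> Y) \<le> int (card D) + r Y" using r_union_card[OF Y(1) DE] by (simp add: Un_commute)
  ultimately show False using rS Y(3) D(2) unfolding conn_def co by linarith
qed

text \<open>Contracting \<open>B - {b, b'}\<close> leaves a triangle on \<open>b, b', f\<close> with each edge doubled, the parallel
  partners being \<open>x, y, e\<close>.\<close>

lemma pairs_minor_of_dependent_sides:
  assumes XY: "X \<subseteq> E" "Y \<subseteq> E" "X \<inter> Y = {}" "E - (X \<union> Y) = {e, f}" "e \<noteq> f"
    and rk: "r X + r Y = r E" "r (X \<union> Y) = r E"
    and par: "r {e} = 1" "r {f} = 1" "r {e, f} = 1"
    and dep: "r X \<noteq> int (card X)" "r Y \<noteq> int (card Y)"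
    and conn: "\<And>S. S \<subseteq> E \<Longrightarrow> S \<noteq> {} \<Longrightarrow> S \<noteq> E \<Longrightarrow> 0 < conn E r S"
  shows "has_rank_minor E r (sparse_paving 2 {..<6} pairs)"
proof -
  have ef: "e \<in> E" "f \<in> E" "e \<notin> X" "f \<notin> X" "e \<notin> Y" "f \<notin> Y" using XY by auto
  obtain B1 where B1: "B1 \<subseteq> X" "r B1 = int (card B1)" "r B1 = r X"
    using ex_basis[of "{}" X] XY(1) r_empty by auto
  obtain B2 where B2: "B2 \<subseteq> Y" "r B2 = int (card B2)" "r B2 = r Y"
    using ex_basis[of "{}" Y] XY(2) r_empty by auto
  have BE: "B1 \<subseteq> E" "B2 \<subseteq> E" "B1 \<union> B2 \<subseteq> E" using B1 B2 XY by auto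
  have fB: "finite B1" "finite B2" using BE finite_sub by auto
  have dj: "B1 \<inter> B2 = {}" using B1 B2 XY by auto
  let ?B = "B1 \<union> B2"
  have spX: "r (insert x B1) = r B1" if "x \<in> X" for x
    using spanned_if_full[OF B1(1) XY(1) B1(3) that] .
  have spY: "r (insert y B2) = r B2" if "y \<in> Y" for y
    using spanned_if_full[OF B2(1) XY(2) B2(3) that] .
  have spB: "r (insert z ?B) = r ?B" if "z \<in> X \<union> Y" for z
    using that
  proof
    assume "z \<in> X"
    then show ?thesis using spanned_mono[of B1 ?B z] spX BE XY by auto
  next
    assume "z \<in> Y"
    then show ?thesis using spanned_mono[of B2 ?B z] spY BE XY by auto
  qed
  have "r (?B \<union> (X \<union> Y)) = r ?B" by (rule spanned_union) (use BE XY spB in auto)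
  moreover have "?B \<union> (X \<union> Y) = X \<union> Y" using B1 B2 by auto
  ultimately have rB: "r ?B = r E" using rk by simp
  have cB: "card ?B = card B1 + card B2" using card_Un_disjoint[OF fB dj] .
  \<comment> \<open>Because \<open>r X + r Y = r E\<close>, the spanning set \<open>?B\<close> has
    exactly \<open>r E\<close> elements and is a basis.\<close>
  have iB: "r ?B = int (card ?B)" using rB cB B1 B2 rk by simp
  have spf: "r (insert f ?B) = int (card ?B)"
    using r_mono[of "insert f ?B" E] r_le_insert[OF BE(3) ef(2)] iB rB ef BE by auto
  \<comment> \<open>\<open>insert f D\<close> is the fundamental circuit of \<open>f\<close>. Taking
    \<open>b\<close> and \<open>b'\<close> from the parts of \<open>D\<close> in \<open>X\<close>
    and in \<open>Y\<close> puts \<open>f\<close> on the line of \<open>b\<close> and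
    \<open>b'\<close> after the contraction, parallel to neither.\<close>
  obtain D where D: "D \<subseteq> ?B" "r (insert f D) = int (card D)"
    "\<And>b. b \<in> D \<Longrightarrow> r (insert f (?B - {b})) = int (card ?B)"
    using fundamental[OF BE(3) iB ef(2) spf] by metis
  have rD: "r (insert f D) = r D" using D(2) indep_sub[OF D(1) BE(3) iB] by simp
  obtain x b where xb: "x \<in> X - B1" "b \<in> D \<inter> B1" "r (insert x (B1 - {b})) = int (card B1)"
  proof (rule exchange_in_side[OF XY(1) B1(1,2,3) _ XY(2), of e f "D \<inter> B1"])
    show "B1 \<noteq> X" using B1 dep by auto
    show "E - X = insert e (insert f Y)" using XY by blast
    show "r X + r Y \<le> r E" using rk by simp
    have "D \<subseteq> D \<inter> B1 \<union> Y" using D(1) B2(1) by auto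
    then show "r (insert f (D \<inter> B1 \<union> Y)) = r (D \<inter> B1 \<union> Y)"
      by (rule spanned_mono) (use rD ef BE XY in auto)
  qed (use par conn in auto)
  obtain y b' where yb: "y \<in> Y - B2" "b' \<in> D \<inter> B2" "r (insert y (B2 - {b'})) = int (card B2)"
  proof (rule exchange_in_side[OF XY(2) B2(1,2,3) _ XY(1), of e f "D \<inter> B2"])
    show "B2 \<noteq> Y" using B2 dep by auto
    show "E - Y = insert e (insert f X)" using XY by blast
    show "r Y + r X \<le> r E" using rk by simp
    have "D \<subseteq> D \<inter> B2 \<union> X" using D(1) B1(1) by auto
    then show "r (insert f (D \<inter> B2 \<union> X)) = r (D \<inter> B2 \<union> X)"
      by (rule spanned_mono) (use rD ef BE XY in auto)
  qed (use par conn in auto)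
  let ?C = "?B - {b, b'}"
  have bB: "b \<in> B1" "b' \<in> B2" "b \<noteq> b'" "b \<notin> B2" "b' \<notin> B1" using xb yb dj by auto
  have CE: "?C \<subseteq> E" using BE by auto
  have rC: "r ?C = r E - 2"
  proof -
    have "card ?B = card {b, b'} + card ?C" using card_split[of "{b, b'}" ?B] bB BE by auto
    then show ?thesis using indep_sub[OF _ BE(3) iB, of ?C] iB rB bB by auto
  qed
  have zE: "x \<in> E" "b \<in> E" "y \<in> E" "b' \<in> E" using xb yb BE XY bB by auto
  have Bb: "?B - {b} = insert b' ?C" "?B - {b'} = insert b ?C" "?B = insert b (insert b' ?C)"
    using bB by auto
  have bb': "r (insert b (insert b' ?C)) = r E" using rB unfolding Bb(3)[symmetric] .
  have fb: "r (insert f (insert b' ?C)) = r E" "r (insert f (insert b ?C)) = r E"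
    using D(3)[of b] D(3)[of b'] xb yb iB rB unfolding Bb[symmetric] by auto
  \<comment> \<open>\<open>x\<close> can replace \<open>b\<close> in the basis \<open>B1\<close> of
    \<open>X\<close>, so \<open>x\<close> and \<open>b'\<close> together still span modulo
    \<open>?C\<close>. In particular \<open>x\<close> does not become a loop.\<close>
  have xb': "r (insert x (insert b' ?C)) = r E"
  proof -
    have bsp: "r (insert b (insert x (B1 - {b}))) = r (insert x (B1 - {b}))"
      by (rule spanned_if_full[of _ X]) (use xb B1 XY bB in auto)
    have "r (insert b (insert x (?B - {b}))) = r (insert x (?B - {b}))"
      by (rule spanned_mono[OF _ _ _ bsp]) (use BE zE bB in auto)
    moreover have "insert b (insert x (?B - {b})) = insert x ?B" using bB by auto
    ultimately show ?thesis using spB[of x] xb(1) rB unfolding Bb(1)[symmetric] by auto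
  qed
  have yb': "r (insert y (insert b ?C)) = r E"
  proof -
    have bsp: "r (insert b' (insert y (B2 - {b'}))) = r (insert y (B2 - {b'}))"
      by (rule spanned_if_full[of _ Y]) (use yb B2 XY bB in auto)
    have "r (insert b' (insert y (?B - {b'}))) = r (insert y (?B - {b'}))"
      by (rule spanned_mono[OF _ _ _ bsp]) (use BE zE bB in auto)
    moreover have "insert b' (insert y (?B - {b'})) = insert y ?B" using bB by auto
    ultimately show ?thesis using spB[of y] yb(1) rB unfolding Bb(2)[symmetric] by auto
  qed
  have one: "r (insert z ?C) = r ?C + 1" "r (insert w ?C) = r ?C + 1"
    if "z \<in> E" "w \<in> E" "r (insert z (insert w ?C)) = r E" for z w
  proof -
    have "insert z ?C \<subseteq> E" "insert w ?C \<subseteq> E" using that CE by auto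
    then have "r (insert z (insert w ?C)) \<le> r (insert w ?C) + 1" "r (insert w (insert z ?C)) \<le> r (insert z ?C) + 1"
      "r (insert z ?C) \<le> r ?C + 1" "r (insert w ?C) \<le> r ?C + 1"
      using r_insert_le that(1,2) CE by blast+
    then show "r (insert z ?C) = r ?C + 1" "r (insert w ?C) = r ?C + 1"
      using that(3) rC insert_commute[of z w ?C] by simp_all
  qed
  have ef_par: "r (insert e (insert f ?C)) = r (insert f ?C)" "r (insert f (insert e ?C)) = r (insert e ?C)"
    using spanned_mono[of "{f}" "insert f ?C" e] spanned_mono[of "{e}" "insert e ?C" f] par ef CE
    by (auto simp: insert_commute)
  note b1 = one[OF zE(2,4) bb'] and x1 = one(1)[OF zE(1,4) xb'] and y1 = one(1)[OF zE(3,2) yb']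
    and f1 = one(1)[OF ef(2) zE(4) fb(1)]
  have e1: "r (insert e ?C) = r ?C + 1" using ef_par f1 insert_commute[of e f ?C] by simp
  \<comment> \<open>\<open>B1\<close> spans \<open>x\<close> and is contained in
    \<open>insert b ?C\<close>, so the contraction makes \<open>x\<close> parallel to
    \<open>b\<close>; likewise \<open>y\<close> to \<open>b'\<close>.\<close>
  have xsp: "r (insert x (insert b ?C)) = r (insert b ?C)"
    by (rule spanned_mono[of B1]) (use spX xb CE zE bB in auto)
  have ysp: "r (insert y (insert b' ?C)) = r (insert b' ?C)"
    by (rule spanned_mono[of B2]) (use spY yb CE zE bB in auto)
  show ?thesis
  proof (rule pairs_minor[OF CE, of b x b' y f e])
    show "distinct [b, x, b', y, f, e]" using xb(1) yb(1) ef XY(3,5) bB B1(1) B2(1) by auto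
    show "{b, x, b', y, f, e} \<subseteq> E - ?C" using xb(1) yb(1) ef XY(3) bB B1(1) B2(1) zE by auto
    show "r ({b, x} \<union> ?C) = r ?C + 1" using xsp b1 insert_commute[of x b ?C] by simp
    show "r ({b', y} \<union> ?C) = r ?C + 1" using ysp b1 insert_commute[of y b' ?C] by simp
    show "r ({f, e} \<union> ?C) = r ?C + 1" using ef_par e1 by simp
    show "r (insert z ?C) = r ?C + 1" if "z \<in> {b, x, b', y, f, e}" for z
      using that b1 x1 y1 f1 e1 by (elim insertE emptyE) (simp_all only:)
    have "{b, b'} \<union> ?C = ?B" using bB by auto
    then show "r ({b, b'} \<union> ?C) = r ?C + 2" using rB rC by simp
    show "r ({b, f} \<union> ?C) = r ?C + 2" using fb rC insert_commute[of b f ?C] by simp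
    show "r ({b', f} \<union> ?C) = r ?C + 2" using fb rC insert_commute[of b' f ?C] by simp
    have "{b, b', f} \<union> ?C = insert f ?B" using bB by auto
    then show "r ({b, b', f} \<union> ?C) = r ?C + 2" using spf iB rB rC by simp
  qed
qed

text \<open>Before a cut inside the independent side lie \<open>f\<close>, \<open>e\<close> and
  \<open>u\<close> elements of it, of rank at most \<open>1 + u\<close>. The other side of the cut
  has rank at most \<open>r (set ys)\<close> plus the number of remaining elements, so the sum is at
  most \<open>r E + 1\<close>. For later cuts \<open>e\<close> is spanned by \<open>f\<close> and
  the old ordering gives the bound.\<close>

lemma width1_double_indep_side:
  assumes ef: "e \<in> E" "f \<in> E" "e \<noteq> f" "r {e, f} \<le> 1" "r {f} = r {e, f}"
    and es: "width1 (E - {e}) r (xs @ f # ys)"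
    and ind: "r (set xs) = int (card (set xs))" "r (set xs) + r (set ys) \<le> r E"
  shows "width1 E r (f # e # xs @ ys)"
  unfolding width1_def
proof (intro conjI allI impI)
  have d: "distinct (xs @ f # ys)" "set xs \<union> insert f (set ys) = E - {e}" using es by (auto simp: width1_def)
  then have XY: "set xs \<subseteq> E" "set ys \<subseteq> E" "set xs \<inter> set ys = {}" "f \<notin> set xs" "f \<notin> set ys"
    "e \<notin> set xs" "e \<notin> set ys" by auto
  show "distinct (f # e # xs @ ys)" using d ef XY by auto
  show "set (f # e # xs @ ys) = E" using d ef by auto
  fix us vs assume uv: "f # e # xs @ ys = us @ vs"
  show "conn E r (set us) \<le> 1"
  proof (cases "us = [] \<or> us = [f]")
    case True
    then show ?thesis using conn_le_card[of "{}"] conn_le_card[of "{f}"] ef by auto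
  next
    case False
    then obtain us' where us: "us = f # e # us'" "xs @ ys = us' @ vs"
      using uv by (auto simp: Cons_eq_append_conv)
    then consider ws where "xs = us' @ ws" "vs = ws @ ys" | ws where "us' = xs @ ws" "ys = ws @ vs"
      by (auto simp: append_eq_append_conv2)
    then show ?thesis
    proof cases
      case 1
      have u: "set us' \<subseteq> set xs" "set us' \<subseteq> E" using 1 XY by auto
      have "r ({e, f} \<union> set us') \<le> 1 + int (card (set us'))"
        using r_union_card[of "{e, f}" "set us'"] u ef by auto
      moreover have "E - set us = set ys \<union> (set xs - set us')" using u us XY d(2) by auto
      then have "r (E - set us) \<le> r (set ys) + int (card (set xs - set us'))"
        using r_union_card[of "set ys" "set xs - set us'"] XY by auto
      moreover have "card (set xs) = card (set us') + card (set xs - set us')"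
        using card_split[OF u(1) XY(1)] .
      moreover have "{e, f} \<union> set us' = set us" using us by auto
      ultimately show ?thesis using ind unfolding conn_def by simp
    next
      case 2
      have "conn (E - {e}) r (set (xs @ f # ws)) \<le> 1"
        using width1_conn[of "E - {e}" r "xs @ f # ws" vs] es 2 by simp
      moreover have sub: "set (xs @ f # ws) \<subseteq> E - {e}" using 2 XY ef by auto
      moreover have su: "set us = insert e (set (xs @ f # ws))" using us 2 by auto
      moreover have "E - insert e (set (xs @ f # ws)) = E - {e} - set (xs @ f # ws)" by auto
      moreover have "r (insert e (set (xs @ f # ws))) = r (set (xs @ f # ws))"
        by (rule spanned_mono[of "{f}"]) (use sub ef in auto)
      moreover have "r (E - {e}) \<le> r E" by (rule r_mono) auto
      ultimately show ?thesis unfolding conn_def by simp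
    qed
  qed
qed

text \<open>Only the cut between \<open>f\<close> and \<open>e\<close> is new, and
  \<open>low\<close> is its bound. At every other cut \<open>e\<close> and \<open>f\<close> are on
  the same side, where \<open>e\<close> adds nothing to the rank.\<close>

lemma width1_insert_parallel:
  assumes ef: "e \<in> E" "f \<in> E" "e \<noteq> f" "r {e} = 1" "r {f} = 1" "r {e, f} = 1"
    and es: "width1 (E - {e}) r (xs @ f # ys)"
    and low: "r (insert f (set xs)) + r (insert f (set ys)) \<le> r E + 1"
  shows "width1 E r (xs @ f # e # ys)"
  unfolding width1_def
proof (intro conjI allI impI)
  have d: "distinct (xs @ f # ys)" "set xs \<union> insert f (set ys) = E - {e}" using es by (auto simp: width1_def)
  then have XY: "set xs \<subseteq> E" "set ys \<subseteq> E" "set xs \<inter> set ys = {}" "f \<notin> set xs" "f \<notin> set ys"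
    "e \<notin> set xs" "e \<notin> set ys" by auto
  have spe: "r (insert e A) = r A" if "f \<in> A" "A \<subseteq> E" for A
    by (rule spanned_mono[of "{f}"]) (use that ef in auto)
  have rE: "r (E - {e}) = r E" using spe[of "E - {e}"] ef by (simp add: insert_absorb)
  show "distinct (xs @ f # e # ys)" using d ef XY by auto
  show "set (xs @ f # e # ys) = E" using d ef by auto
  fix us vs assume uv: "xs @ f # e # ys = us @ vs"
  then consider ws where "xs = us @ ws" | "us = xs @ [f]" "vs = e # ys"
    | ws where "us = xs @ f # e # ws" "ys = ws @ vs"
    by (auto simp: append_eq_append_conv2 Cons_eq_append_conv)
  then show "conn E r (set us) \<le> 1"
  proof cases
    case 1
    have u: "set us \<subseteq> set xs" using 1 by auto
    have "conn (E - {e}) r (set us) \<le> 1"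
      using width1_conn[of "E - {e}" r us "ws @ f # ys"] es 1 by simp
    moreover have "insert e (E - {e} - set us) = E - set us" using u XY ef by auto
    moreover have "r (insert e (E - {e} - set us)) = r (E - {e} - set us)"
      by (rule spe) (use u XY ef in auto)
    ultimately show ?thesis using rE unfolding conn_def by simp
  next
    case 2
    have "E - set us = insert e (set ys)" using 2 d XY ef by auto
    moreover have "r (insert e (set ys)) \<le> r (insert f (set ys))"
    proof -
      have "r (insert e (set ys)) \<le> r (insert e (insert f (set ys)))"
        by (rule r_mono) (use XY ef in auto)
      then show ?thesis using spe[of "insert f (set ys)"] XY ef by auto
    qed
    moreover have "set us = insert f (set xs)" using 2 by auto
    ultimately show ?thesis using low unfolding conn_def by simp
  next
    case 3
    have "conn (E - {e}) r (set (xs @ f # ws)) \<le> 1"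
      using width1_conn[of "E - {e}" r "xs @ f # ws" vs] es 3 by simp
    moreover have sub: "set (xs @ f # ws) \<subseteq> E - {e}" using 3 XY ef by auto
    moreover have su: "set us = insert e (set (xs @ f # ws))" using 3 by auto
    moreover have "E - insert e (set (xs @ f # ws)) = E - {e} - set (xs @ f # ws)" by auto
    moreover have "r (insert e (set (xs @ f # ws))) = r (set (xs @ f # ws))"
      by (rule spe) (use sub in auto)
    ultimately show ?thesis using rE unfolding conn_def by simp
  qed
qed

lemma width1_parallel:
  assumes ef: "e \<in> E" "f \<in> E" "e \<noteq> f" "r {e} = 1" "r {f} = 1" "r {e, f} = 1"
    and es: "width1 (E - {e}) r es"
    and conn: "\<And>S. S \<subseteq> E \<Longrightarrow> S \<noteq> {} \<Longrightarrow> S \<noteq> E \<Longrightarrow> 0 < conn E r S"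
    and no: "\<not> has_rank_minor E r (sparse_paving 2 {..<6} pairs)"
  shows "\<exists>es. width1 E r es"
proof -
  have "f \<in> set es" using es ef by (auto simp: width1_def)
  then obtain xs ys where es': "es = xs @ f # ys" by (meson split_list)
  let ?X = "set xs" and ?Y = "set ys"
  have o: "width1 (E - {e}) r (xs @ f # ys)" using es es' by simp
  have d: "distinct (xs @ f # ys)" "?X \<union> insert f ?Y = E - {e}" using o by (auto simp: width1_def)
  then have XY: "?X \<subseteq> E" "?Y \<subseteq> E" "?X \<inter> ?Y = {}" "f \<notin> ?X" "f \<notin> ?Y" "e \<notin> ?X" "e \<notin> ?Y" by auto
  show ?thesis
  proof (cases "r (insert f ?X) + r (insert f ?Y) \<le> r E + 1")
    case True
    then show ?thesis using width1_insert_parallel[OF ef o] by blast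
  next
    case False
    have rE: "r (E - {e}) = r E"
    proof -
      have "r (insert e (E - {e})) = r (E - {e})"
        by (rule spanned_mono[of "{f}"]) (use ef in auto)
      then show ?thesis using ef by (simp add: insert_absorb)
    qed
    have c1: "conn (E - {e}) r ?X \<le> 1" using width1_conn[OF o] .
    have c2: "conn (E - {e}) r (insert f ?X) \<le> 1"
      using width1_conn[of "E - {e}" r "xs @ [f]" ys] o by simp
    have "E - {e} - ?X = insert f ?Y" "E - {e} - insert f ?X = ?Y" using d XY by auto
    then have 1: "r ?X + r (insert f ?Y) \<le> r E + 1" "r (insert f ?X) + r ?Y \<le> r E + 1"
      using c1 c2 rE unfolding conn_def by auto
    have 2: "r (insert f ?X) \<le> r ?X + 1" "r (insert f ?Y) \<le> r ?Y + 1"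
      using r_insert_le XY ef by auto
    \<comment> \<open>The sum of the two bounds in \<open>1\<close>, compared with the failed
      inequality.\<close>
    have low: "r ?X + r ?Y \<le> r E" using 1 2 False by linarith
    have XYE: "?X \<union> ?Y = E - {e, f}" using d XY by auto
    \<comment> \<open>The pair \<open>{e, f}\<close> has rank 1 and is not a separator, so removing
      it keeps the rank. With \<open>low\<close> this gives
      \<open>r ?X + r ?Y = r E\<close>.\<close>
    have full: "r (?X \<union> ?Y) = r E"
    proof (cases "?X \<union> ?Y = {}")
      case True
      then have "E - {e} = {f}" "?X = {}" "?Y = {}" using d by auto
      then show ?thesis using False ef rE by simp
    next
      case ne: False
      have "0 < conn E r {e, f}" by (rule conn) (use ne XYE ef in auto)
      then have "r E \<le> r (?X \<union> ?Y)" using ef XYE unfolding conn_def by simp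
      then show ?thesis using r_mono[of "?X \<union> ?Y" E] XY by auto
    qed
    have eq: "r ?X + r ?Y = r E" using low full r_union_le[of ?X ?Y] XY by auto
    consider "r ?X = int (card ?X)" | "r ?Y = int (card ?Y)"
      | "r ?X \<noteq> int (card ?X)" "r ?Y \<noteq> int (card ?Y)" by blast
    then show ?thesis
    proof cases
      case 1
      then show ?thesis using width1_double_indep_side[OF ef(1-3) _ _ o] ef low by auto
    next
      case 2
      interpret e: rank_function "E - {e}" r by (rule restrict) auto
      have "width1 (E - {e}) r (rev ys @ f # rev xs)" using e.width1_rev[OF o] by simp
      from width1_double_indep_side[OF ef(1-3) _ _ this] show ?thesis using 2 ef low by auto
    next
      case 3
      have "E - (?X \<union> ?Y) = {e, f}" using XYE ef by auto
      from pairs_minor_of_dependent_sides[OF XY(1-3) this ef(3) eq full ef(4-6) 3 conn]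
      show ?thesis using no by blast
    qed
  qed
qed

end

section \<open>Simple cosimple matroids\<close>

lemma card_3_eq:
  assumes "card A = 3" "x \<in> A" "y \<in> A" "z \<in> A" "x \<noteq> y" "x \<noteq> z" "y \<noteq> z"
  shows "A = {x, y, z}"
proof -
  have "finite A" using assms(1) by (metis card.infinite zero_neq_numeral)
  moreover have "{x, y, z} \<subseteq> A" "card {x, y, z} = card A" using assms by auto
  ultimately show ?thesis by (metis card_subset_eq)
qed

text \<open>\<open>T\<close> and \<open>K\<close> are the families of triangles and triads.\<close>

lemma k4_configuration:
  assumes T3: "\<And>A. A \<in> T \<Longrightarrow> card A = 3" and K3: "\<And>A. A \<in> K \<Longrightarrow> card A = 3"
    and ortho: "\<And>A B. A \<in> T \<Longrightarrow> B \<in> K \<Longrightarrow> card (A \<inter> B) \<noteq> 1" and TK: "T \<inter> K = {}"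
    and TT: "\<And>A B x y. A \<in> T \<Longrightarrow> B \<in> T \<Longrightarrow> x \<noteq> y \<Longrightarrow> {x, y} \<subseteq> A \<inter> B \<Longrightarrow> A = B"
    and KK: "\<And>A B x y. A \<in> K \<Longrightarrow> B \<in> K \<Longrightarrow> x \<noteq> y \<Longrightarrow> {x, y} \<subseteq> A \<inter> B \<Longrightarrow> A = B"
    and T2: "\<And>x. x \<in> E \<Longrightarrow> \<exists>A\<in>T. \<exists>B\<in>T. A \<inter> B = {x}"
    and K2: "\<And>x. x \<in> E \<Longrightarrow> \<exists>A\<in>K. \<exists>B\<in>K. A \<inter> B = {x}"
    and e: "e \<in> E" and sub: "\<And>A. A \<in> T \<Longrightarrow> A \<subseteq> E"
  obtains a b c d f where "distinct [e, a, c, b, d, f]"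
    "{e, a, c} \<in> T" "{e, b, d} \<in> T" "{a, b, f} \<in> T" "{c, d, f} \<in> T"
    "{e, a, b} \<in> K" "{e, c, d} \<in> K" "{a, c, f} \<in> K"
proof -
  \<comment> \<open>A triangle and a triad that meet share exactly two elements:
    \<open>ortho\<close> excludes one, and three would make them equal, against
    \<open>TK\<close>.\<close>
  have two: "\<exists>y. A \<inter> B = {x, y} \<and> y \<noteq> x" if AB: "A \<in> T" "B \<in> K" "x \<in> A" "x \<in> B" for A B x
  proof -
    have fA: "finite A" using T3[OF AB(1)] by (metis card.infinite zero_neq_numeral)
    have fB: "finite B" using K3[OF AB(2)] by (metis card.infinite zero_neq_numeral)
    have "card (A \<inter> B) \<le> 3" using card_mono[OF fA, of "A \<inter> B"] T3[OF AB(1)] by simp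
    moreover have "card (A \<inter> B) \<noteq> 3"
    proof
      assume "card (A \<inter> B) = 3"
      then have "A \<inter> B = A" "A \<inter> B = B"
        using card_subset_eq[OF fA, of "A \<inter> B"] card_subset_eq[OF fB, of "A \<inter> B"]
          T3[OF AB(1)] K3[OF AB(2)] by auto
      then show False using AB TK by auto
    qed
    moreover have "card (A \<inter> B) \<noteq> 0" using AB fA by auto
    moreover have "card (A \<inter> B) \<noteq> 1" using ortho AB by blast
    ultimately have "card (A \<inter> B) = 2" by linarith
    then obtain u v where uv: "A \<inter> B = {u, v}" "u \<noteq> v" by (meson card_2_iff)
    then have "x = u \<or> x = v" using AB by auto
    then show ?thesis using uv by (metis insert_commute)
  qed
  obtain K1 K2' where K12: "K1 \<in> K" "K2' \<in> K" "K1 \<inter> K2' = {e}" using K2[OF e] by blast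
  obtain T1 T2' where T12: "T1 \<in> T" "T2' \<in> T" "T1 \<inter> T2' = {e}" using T2[OF e] by blast
  have ein: "e \<in> K1" "e \<in> K2'" "e \<in> T1" "e \<in> T2'" using K12 T12 by auto
  \<comment> \<open>Two triangles and two triads at \<open>e\<close> have four intersections, each
    with one element besides \<open>e\<close>. These four elements are distinct and determine all
    four sets.\<close>
  obtain a where a: "T1 \<inter> K1 = {e, a}" "a \<noteq> e" using two[OF T12(1) K12(1)] ein by blast
  obtain b where b: "T2' \<inter> K1 = {e, b}" "b \<noteq> e" using two[OF T12(2) K12(1)] ein by blast
  obtain c where c: "T1 \<inter> K2' = {e, c}" "c \<noteq> e" using two[OF T12(1) K12(2)] ein by blast
  obtain d where d: "T2' \<inter> K2' = {e, d}" "d \<noteq> e" using two[OF T12(2) K12(2)] ein by blast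
  have m: "a \<in> T1" "a \<in> K1" "b \<in> T2'" "b \<in> K1" "c \<in> T1" "c \<in> K2'" "d \<in> T2'" "d \<in> K2'"
    using a b c d by auto
  have dist: "a \<noteq> b" "a \<noteq> c" "a \<noteq> d" "b \<noteq> c" "b \<noteq> d" "c \<noteq> d"
    using m K12(3) T12(3) a(2) b(2) c(2) d(2) by blast+
  have sets: "T1 = {e, a, c}" "T2' = {e, b, d}" "K1 = {e, a, b}" "K2' = {e, c, d}"
    using card_3_eq[OF T3[OF T12(1)]] card_3_eq[OF T3[OF T12(2)]] card_3_eq[OF K3[OF K12(1)]]
      card_3_eq[OF K3[OF K12(2)]] ein m dist a(2) b(2) c(2) d(2) by metis+
  have aE: "a \<in> E" "c \<in> E" using sub[OF T12(1)] m by auto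
  \<comment> \<open>Of two triads meeting only in \<open>a\<close>, one differs from
    \<open>K1\<close>. It shares only \<open>a\<close> with \<open>K1\<close>, so it avoids
    \<open>e\<close> and \<open>b\<close> and must meet \<open>T1\<close> in \<open>c\<close>. Its
    third element is \<open>f\<close>.\<close>
  obtain K3' where K3': "K3' \<in> K" "a \<in> K3'" "K3' \<noteq> K1"
  proof -
    obtain P Q where PQ: "P \<in> K" "Q \<in> K" "P \<inter> Q = {a}" using K2[OF aE(1)] by blast
    then have "P \<noteq> Q" using K3[OF PQ(1)] by auto
    then show thesis using that[of P] that[of Q] PQ by blast
  qed
  have nK3: "e \<notin> K3'" "b \<notin> K3'"
    using KK[OF K3'(1) K12(1), of a e] KK[OF K3'(1) K12(1), of a b] K3' ein m a(2) dist by auto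
  obtain y where "T1 \<inter> K3' = {a, y}" "y \<noteq> a" using two[OF T12(1) K3'(1) m(1) K3'(2)] by blast
  then have cK: "c \<in> K3'" using nK3 sets(1) by auto
  obtain f where f: "f \<in> K3'" "f \<noteq> a" "f \<noteq> c"
  proof -
    have "\<not> K3' \<subseteq> {a, c}" using K3[OF K3'(1)] card_mono[of "{a, c}" K3'] dist by auto
    then show thesis using that by blast
  qed
  have K3e: "K3' = {a, c, f}" using card_3_eq[OF K3[OF K3'(1)] K3'(2) cK f(1)] dist f by auto
  have fne: "f \<noteq> e" "f \<noteq> b" using nK3 f by auto
  have fd: "f \<noteq> d"
  proof
    assume "f = d"
    then have "K3' = K2'" using KK[OF K3'(1) K12(2), of c d] cK f m dist by auto
    then show False using K3'(2) sets(4) dist a(2) by auto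
  qed
  \<comment> \<open>A triangle through \<open>a\<close> other than \<open>T1\<close> avoids
    \<open>e\<close> and \<open>c\<close>. It shares a second element with \<open>K1\<close> and
    with \<open>K3'\<close>, hence contains \<open>b\<close> and \<open>f\<close>. The same argument
    at \<open>c\<close> yields \<open>{c, d, f}\<close>.\<close>
  obtain T3' where T3': "T3' \<in> T" "a \<in> T3'" "T3' \<noteq> T1"
  proof -
    obtain P Q where PQ: "P \<in> T" "Q \<in> T" "P \<inter> Q = {a}" using T2[OF aE(1)] by blast
    then have "P \<noteq> Q" using T3[OF PQ(1)] by auto
    then show thesis using that[of P] that[of Q] PQ by blast
  qed
  have nT3: "e \<notin> T3'" "c \<notin> T3'"
    using TT[OF T3'(1) T12(1), of a e] TT[OF T3'(1) T12(1), of a c] T3' ein m a(2) dist by auto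
  obtain y where "T3' \<inter> K1 = {a, y}" "y \<noteq> a" using two[OF T3'(1) K12(1) T3'(2) m(2)] by blast
  then have bT: "b \<in> T3'" using nT3 sets(3) by auto
  obtain y where "T3' \<inter> K3' = {a, y}" "y \<noteq> a" using two[OF T3'(1) K3'(1) T3'(2) K3'(2)] by blast
  then have fT: "f \<in> T3'" using nT3 K3e by auto
  have T3e: "T3' = {a, b, f}" using card_3_eq[OF T3[OF T3'(1)] T3'(2) bT fT] dist f fne by auto
  obtain T4 where T4: "T4 \<in> T" "c \<in> T4" "T4 \<noteq> T1"
  proof -
    obtain P Q where PQ: "P \<in> T" "Q \<in> T" "P \<inter> Q = {c}" using T2[OF aE(2)] by blast
    then have "P \<noteq> Q" using T3[OF PQ(1)] by auto
    then show thesis using that[of P] that[of Q] PQ by blast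
  qed
  have nT4: "e \<notin> T4" "a \<notin> T4"
    using TT[OF T4(1) T12(1), of c e] TT[OF T4(1) T12(1), of c a] T4 ein m c(2) dist by auto
  obtain y where "T4 \<inter> K2' = {c, y}" "y \<noteq> c" using two[OF T4(1) K12(2) T4(2) m(6)] by blast
  then have dT: "d \<in> T4" using nT4 sets(4) by auto
  obtain y where "T4 \<inter> K3' = {c, y}" "y \<noteq> c" using two[OF T4(1) K3'(1) T4(2) cK] by blast
  then have fT4: "f \<in> T4" using nT4 K3e by auto
  have T4e: "T4 = {c, d, f}" using card_3_eq[OF T3[OF T4(1)] T4(2) dT fT4] dist f fd by auto
  show thesis
    by (rule that[of a c b d f])
      (use sets K3e T3e T4e T12 K12 K3'(1) T3'(1) T4(1) dist a(2) b(2) c(2) d(2) f fne fd in auto)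
qed

lemma dual_u24: "dual (sparse_paving 2 {..<4::nat} {}) = sparse_paving 2 {..<4} {}"
  using dual_sparse_paving[OF sparse_u24] by simp

lemma dual_pairs: "dual (sparse_paving 2 {..<6} pairs) = sparse_paving 4 {..<6} k23_cycles"
proof -
  have "(\<lambda>A. {..<6} - A) ` pairs = k23_cycles"
    unfolding k23_cycles_def pairs_def lessThan_6 by code_simp
  then show ?thesis using dual_sparse_paving[OF sparse_pairs] by simp
qed

section \<open>Four-point lines, triangles and triads\<close>

context rank_function
begin

lemma u24_minor:
  assumes "C \<subseteq> E" "Q \<subseteq> E - C" "card Q = 4" "r (Q \<union> C) \<le> r C + 2"
    and two: "\<And>x y. x \<in> Q \<Longrightarrow> y \<in> Q \<Longrightarrow> x \<noteq> y \<Longrightarrow> r ({x, y} \<union> C) = r C + 2"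
  shows "has_rank_minor E r (sparse_paving 2 {..<4::nat} {})"
proof -
  have "finite Q" using assms(2) finite_sub by blast
  then obtain g where g: "bij_betw g {..<4::nat} Q"
    using ex_bij_betw_nat_finite[of Q] assms(3) by (auto simp: atLeast0LessThan)
  then have gi: "inj_on g {..<4}" "g ` {..<4} = Q" by (auto simp: bij_betw_def)
  show ?thesis
  proof (rule has_rank_minor_sparse_pavingI[OF sparse_u24 assms(1) gi(1)])
    show "g ` {..<4} \<subseteq> E - C" "r (g ` {..<4} \<union> C) \<le> r C + int 2" using gi assms by auto
    fix A :: "nat set" assume A: "A \<subseteq> {..<4}" "card A = 2"
    then obtain i j where ij: "A = {i, j}" "i \<noteq> j" by (meson card_2_iff)
    then have "g i \<in> Q" "g j \<in> Q" "g i \<noteq> g j" using A gi by (auto dest: inj_onD)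
    then show "r (g ` A \<union> C) = r C + int 2 \<longleftrightarrow> A \<notin> {}" using two[of "g i" "g j"] ij by auto
  qed
qed

lemma u24_minor_dual:
  assumes "has_rank_minor E (dual_rank E r) (sparse_paving 2 {..<4::nat} {})"
  shows "has_rank_minor E r (sparse_paving 2 {..<4::nat} {})"
  using has_rank_minor_dual[OF assms] unfolding dual_u24 by (simp add: sparse_paving_def)

text \<open>Two different triangles with two common elements would together form a line with four
  points, which is a \<open>U\<^sub>2\<^sub>,\<^sub>4\<close> restriction. The dual instance treats
  triads.\<close>

lemma triangles_eq:
  assumes simple: "\<And>x y. x \<in> E \<Longrightarrow> y \<in> E \<Longrightarrow> x \<noteq> y \<Longrightarrow> r {x, y} = 2"
    and no: "\<not> has_rank_minor E r (sparse_paving 2 {..<4::nat} {})"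
    and AB: "A \<subseteq> E" "B \<subseteq> E" "card A = 3" "card B = 3" "r A = 2" "r B = 2"
      "x \<noteq> y" "{x, y} \<subseteq> A \<inter> B"
  shows "A = B"
proof (rule ccontr)
  assume ne: "A \<noteq> B"
  have fin: "finite A" "finite B" using AB finite_sub by auto
  have "2 \<le> card (A \<inter> B)" using card_mono[of "A \<inter> B" "{x, y}"] fin AB by auto
  moreover have "card (A \<inter> B) \<noteq> 3"
    using card_subset_eq[OF fin(1), of "A \<inter> B"] card_subset_eq[OF fin(2), of "A \<inter> B"] ne AB by auto
  moreover have "card (A \<inter> B) \<le> 3" using card_mono[OF fin(1), of "A \<inter> B"] AB by auto
  ultimately have "card (A \<inter> B) = 2" by linarith
  then have c: "card (A \<union> B) = 4" using card_Un_Int[OF fin] AB by simp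
  have "A \<inter> B \<subseteq> E" "x \<in> E" "y \<in> E" using AB by auto
  then have "2 \<le> r (A \<inter> B)" using r_mono[OF AB(8)] simple[of x y] AB(7) by simp
  then have "r (A \<union> B) \<le> 2" using submodular[OF AB(1,2)] AB by simp
  moreover have "r ({u, v} \<union> {}) = r {} + 2" if "u \<in> A \<union> B" "v \<in> A \<union> B" "u \<noteq> v" for u v
    using simple[of u v] that AB(1,2) r_empty by auto
  ultimately have "has_rank_minor E r (sparse_paving 2 {..<4::nat} {})"
    by (intro u24_minor[of "{}" "A \<union> B"]) (use AB(1,2) c r_empty in auto)
  then show False using no by simp
qed

context
  assumes simple: "\<And>x y. x \<in> E \<Longrightarrow> y \<in> E \<Longrightarrow> x \<noteq> y \<Longrightarrow> r {x, y} = 2"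
    and cosimple: "\<And>x y. x \<in> E \<Longrightarrow> y \<in> E \<Longrightarrow> x \<noteq> y \<Longrightarrow> dual_rank E r {x, y} = 2"
begin

text \<open>The complement of a triad is a hyperplane: removing only the other two elements keeps
  the rank, because pairs are independent in the dual.\<close>

lemma insert_compl_triad:
  assumes "B \<subseteq> E" "card B = 3" "dual_rank E r B = 2" "x \<in> B"
  shows "r (insert x (E - B)) = r E" "r (E - B) = r E - 1"
proof -
  show "r (E - B) = r E - 1" using assms by (simp add: dual_rank_def)
  have "card (B - {x}) = 2" using assms finite_sub[of B] by simp
  then obtain y z where yz: "B - {x} = {y, z}" "y \<noteq> z" by (meson card_2_iff)
  then have "dual_rank E r (B - {x}) = 2" using cosimple[of y z] assms by auto
  moreover have "E - (B - {x}) = insert x (E - B)" using assms by auto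
  ultimately show "r (insert x (E - B)) = r E" using \<open>card (B - {x}) = 2\<close> by (simp add: dual_rank_def)
qed

text \<open>If they met only in \<open>x\<close>, the other two elements of \<open>A\<close> would
  lie in the hyperplane \<open>E - B\<close> and span \<open>x\<close>, which is outside it.\<close>

lemma triangle_triad_ortho:
  assumes A: "A \<subseteq> E" "card A = 3" "r A = 2" and B: "B \<subseteq> E" "card B = 3" "dual_rank E r B = 2"
  shows "card (A \<inter> B) \<noteq> 1"
proof
  assume "card (A \<inter> B) = 1"
  then obtain x where x: "A \<inter> B = {x}" by (meson card_1_singletonE)
  have "x \<in> A" using x by auto
  then have "card (A - {x}) = 2" using A(2) by (simp add: card_Diff_singleton)
  then obtain y z where yz: "A - {x} = {y, z}" "y \<noteq> z" by (meson card_2_iff)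
  then have "r (A - {x}) = 2" using simple[of y z] A by auto
  moreover have "insert x (A - {x}) = A" using x by auto
  ultimately have "r (insert x (A - {x})) = r (A - {x})" using A by simp
  then have "r (insert x (E - B)) = r (E - B)"
    by (intro spanned_mono[of "A - {x}" "E - B" x]) (use A B x in auto)
  then show False using insert_compl_triad[OF B, of x] x by auto
qed

text \<open>With \<open>B\<close> a basis of the hyperplane \<open>E - A\<close>, a part
  \<open>?I\<close> of \<open>B\<close> completes \<open>{x, y}\<close> to a basis of
  \<open>{x, y} \<union> B\<close>. Contracting \<open>?I\<close> keeps \<open>A\<close> a line, and
  an element \<open>f\<close> of \<open>B\<close> left over becomes a fourth point on it.\<close>

lemma triangle_not_triad:
  assumes no: "\<not> has_rank_minor E r (sparse_paving 2 {..<4::nat} {})"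
    and A: "A \<subseteq> E" "card A = 3" "r A = 2" "dual_rank E r A = 2"
  shows False
proof -
  have fA: "finite A" using A finite_sub by blast
  obtain x y z where xyz: "A = {x, y, z}" "x \<noteq> y" "x \<noteq> z" "y \<noteq> z" using A(2) by (meson card_3_iff)
  obtain B where B: "B \<subseteq> E - A" "r B = int (card B)" "r B = r (E - A)"
    using ex_basis[of "{}" "E - A"] r_empty by auto
  have rB: "r B = r E - 1" using B(3) insert_compl_triad(2)[OF A(1,2,4), of x] xyz by auto
  have BE: "B \<subseteq> E" "finite B" using B(1) finite_sub[of B] by auto
  have "r {x, y} = int (card {x, y})" using simple[of x y] xyz A by auto
  then obtain J where J: "{x, y} \<subseteq> J" "J \<subseteq> {x, y} \<union> B" "r J = int (card J)" "r J = r ({x, y} \<union> B)"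
    using ex_basis[of "{x, y}" "{x, y} \<union> B"] BE A xyz by auto
  have JE: "J \<subseteq> E" "finite J" using J(2) BE A xyz finite_subset by auto
  let ?I = "J - {x, y}"
  have "?I \<subseteq> B" using J(2) by blast
  moreover have "?I \<subseteq> E" using JE by blast
  moreover have "?I \<inter> A = {}" using calculation(1) B(1) by blast
  ultimately have I: "?I \<subseteq> B" "?I \<subseteq> E" "?I \<inter> A = {}" .
  have rI: "r ?I = int (card ?I)" using indep_sub[OF Diff_subset JE(1) J(3)] .
  have cJ: "card J = card ?I + 2" using card_split[OF J(1) JE(1)] xyz by simp
  have "r J \<le> r E" using r_mono[OF JE(1)] by simp
  \<comment> \<open>Counting: \<open>card ?I + 2\<close> is at most \<open>r E\<close>, which is
    \<open>card B + 1\<close>.\<close>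
  then have "?I \<noteq> B" using cJ rB B(2) J(3) by auto
  then obtain f where f: "f \<in> B" "f \<notin> ?I" using I by blast
  have fE: "f \<in> E" "f \<notin> A" using f B BE by auto
  have rJ: "r J = r ?I + 2" using J(3) cJ rI by simp
  have fspan: "r (insert f J) = r J"
    by (rule spanned_if_full[of _ "{x, y} \<union> B"]) (use J BE A xyz f in auto)
  have pair: "r ({u, v} \<union> ?I) = r ?I + 2" if "u \<in> A" "v \<in> A" "u \<noteq> v" for u v
  proof -
    have "r {u, v} = 2" using simple that A by auto
    then have "r (insert w {u, v}) = r {u, v}" if "w \<in> A" for w
      using spanned_if_full[of "{u, v}" A w] \<open>u \<in> A\<close> \<open>v \<in> A\<close> that A by auto
    then have "r (insert w ({u, v} \<union> ?I)) = r ({u, v} \<union> ?I)" if "w \<in> A" for w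
      using spanned_mono[of "{u, v}" "{u, v} \<union> ?I" w] \<open>u \<in> A\<close> \<open>v \<in> A\<close> that A I by auto
    then have "r (({u, v} \<union> ?I) \<union> A) = r ({u, v} \<union> ?I)"
      by (intro spanned_union) (use that A I in auto)
    moreover have "r J \<le> r (({u, v} \<union> ?I) \<union> A)" by (rule r_mono) (use xyz I A that in auto)
    moreover have "r ({u, v} \<union> ?I) \<le> r ?I + 2"
      using r_union_card[of ?I "{u, v}"] that A I by (auto simp: Un_commute)
    ultimately show ?thesis using rJ by linarith
  qed
  have rfI: "r (insert f ?I) = r ?I + 1"
    using indep_sub[of "insert f ?I" B] I f BE B rI J JE by simp
  \<comment> \<open>\<open>f\<close> and \<open>?I\<close> lie in the hyperplane
    \<open>E - A\<close>, and \<open>u\<close> does not, so \<open>u\<close> cannot become parallel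
    to \<open>f\<close>.\<close>
  have fpair: "r ({u, f} \<union> ?I) = r ?I + 2" if u: "u \<in> A" for u
  proof (rule ccontr)
    assume ne: "r ({u, f} \<union> ?I) \<noteq> r ?I + 2"
    have fI: "insert f ?I \<subseteq> E" using I fE by auto
    have uE: "u \<in> E" using u A by auto
    have "r (insert u (insert f ?I)) = r (insert f ?I)"
      using ne r_le_insert[OF fI uE] r_insert_le[OF fI uE] rfI by auto
    then have "r (insert u (E - A)) = r (E - A)"
      by (rule spanned_mono[rotated 3]) (use I B f uE in auto)
    then show False using insert_compl_triad[OF A(1,2,4) u] by simp
  qed
  have "has_rank_minor E r (sparse_paving 2 {..<4::nat} {})"
  proof (rule u24_minor[of ?I "insert f A"])
    show "?I \<subseteq> E" by (rule I)
    show "insert f A \<subseteq> E - ?I" using A I fE f by auto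
    show "card (insert f A) = 4" using A fE fA by simp
    have "r (insert f J \<union> A) = r (insert f J)"
    proof (rule spanned_union)
      fix w assume w: "w \<in> A"
      have "r (insert w {x, y}) = r {x, y}"
        by (rule spanned_if_full[of _ A]) (use simple[of x y] xyz A w in auto)
      then show "r (insert w (insert f J)) = r (insert f J)"
        by (rule spanned_mono[rotated 3]) (use J JE fE w A in auto)
    qed (use JE fE A in auto)
    moreover have "insert f J \<union> A = insert f A \<union> ?I" using J xyz by auto
    ultimately show "r (insert f A \<union> ?I) \<le> r ?I + 2" using fspan rJ by simp
    show "r ({u, v} \<union> ?I) = r ?I + 2" if "u \<in> insert f A" "v \<in> insert f A" "u \<noteq> v" for u v
      using that pair[of u v] fpair[of u] fpair[of v] by (auto simp: insert_commute)
  qed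
  then show False using no by simp
qed

text \<open>The first two elements \<open>a\<close>, \<open>b\<close> of the ordering have rank 2,
  so width one forces the rank of the rest to drop below \<open>r E\<close>, which makes
  \<open>{x, a, b}\<close> a triad. Reversal treats the last two. With five elements in
  \<open>E\<close>, four remain besides \<open>x\<close>, and the two ends are disjoint.\<close>

lemma two_triads:
  assumes x: "x \<in> E" and c: "5 \<le> card E" and es: "width1 (E - {x}) r es"
  shows "\<exists>A B. A \<subseteq> E \<and> card A = 3 \<and> dual_rank E r A = 2 \<and> B \<subseteq> E \<and> card B = 3 \<and> dual_rank E r B = 2 \<and>
    A \<inter> B = {x}"
proof -
  interpret e: rank_function "E - {x}" r by (rule restrict) auto
  interpret d: rank_function E "dual_rank E r" by (rule dual)
  have es': "distinct es" "set es = E - {x}" using es by (auto simp: width1_def)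
  then have len: "4 \<le> length es" using c x finite_E distinct_card[of es] by simp
  have triad: "dual_rank E r {x, a, b} = 2" if "conn (E - {x}) r {a, b} \<le> 1" "a \<in> E - {x}" "b \<in> E - {x}" "a \<noteq> b" for a b
  proof -
    have "r (E - {x}) = r E"
    proof -
      have "r (E - {x, a}) = r E" using cosimple[of x a] that x by (auto simp: dual_rank_def)
      moreover have "r (E - {x, a}) \<le> r (E - {x})" by (rule r_mono) auto
      moreover have "r (E - {x}) \<le> r E" by (rule r_mono) auto
      ultimately show ?thesis by simp
    qed
    moreover have "r {a, b} = 2" using simple that by auto
    moreover have "E - {x} - {a, b} = E - {x, a, b}" by auto
    ultimately have "r (E - {x, a, b}) \<le> r E - 1" using that(1) by (simp add: conn_def)
    moreover have "card {x, a, b} = 3" using that by auto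
    ultimately have "dual_rank E r {x, a, b} \<le> 2" by (simp add: dual_rank_def)
    moreover have "dual_rank E r {a, b} \<le> dual_rank E r {x, a, b}" by (rule d.r_mono) (use that x in auto)
    ultimately show ?thesis using cosimple[of a b] that by auto
  qed
  have two: "\<exists>a b gs. xs = a # b # gs" if "2 \<le> length xs" for xs :: "'a list"
    using that by (auto simp: Suc_le_length_iff numeral_eq_Suc)
  obtain a b gs where gs: "es = a # b # gs" using two[of es] len by auto
  obtain c d hs where hs: "rev gs = c # d # hs" using two[of "rev gs"] len gs by auto
  then have gs2: "gs = rev hs @ [d, c]" by (metis append.assoc append_Cons append_Nil rev.simps(2) rev_rev_ident)
  have dist: "distinct [x, a, b, c, d]" "{a, b, c, d} \<subseteq> E - {x}" using es' gs gs2 by auto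
  have c1: "conn (E - {x}) r {a, b} \<le> 1" using width1_conn[of "E - {x}" r "[a, b]" gs] es gs by simp
  have "width1 (E - {x}) r (rev es)" using es by (rule e.width1_rev)
  then have c2: "conn (E - {x}) r {c, d} \<le> 1"
    using width1_conn[of "E - {x}" r "[c, d]" "hs @ [b, a]"] gs hs by simp
  show ?thesis
    by (intro exI[of _ "{x, a, b}"] exI[of _ "{x, c, d}"])
      (use triad[OF c1] triad[OF c2] dist x in auto)
qed

end

lemma rank_six_le_3:
  assumes "{p, q, s, u, v, w} \<subseteq> E" "r {p, q, u} \<le> r {p, q}" "r {p, s, v} \<le> r {p, s}" "r {q, s, w} \<le> r {q, s}"
  shows "r {p, q, s, u, v, w} \<le> 3"
proof -
  have sp: "r (insert z {p, q, s}) = r {p, q, s}"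
    if "{a, b} \<subseteq> {p, q, s}" "r {a, b, z} \<le> r {a, b}" "z \<in> {u, v, w}" for a b z
  proof (rule spanned_mono[OF that(1)])
    show "{p, q, s} \<subseteq> E" "z \<in> E" using that assms by auto
    have "{a, b} \<subseteq> E" using that assms by auto
    then show "r (insert z {a, b}) = r {a, b}"
      using that(2) r_le_insert[of "{a, b}" z] \<open>z \<in> E\<close> by (simp add: insert_commute)
  qed
  have "r ({p, q, s} \<union> {u, v, w}) = r {p, q, s}"
    by (rule spanned_union) (use assms sp[of p q u] sp[of p s v] sp[of q s w] in auto)
  moreover have "{p, q, s} \<union> {u, v, w} = {p, q, s, u, v, w}" by auto
  moreover have "r {p, q, s} \<le> int (card {p, q, s})" by (rule r_card) (use assms in auto)
  moreover have "card {p, q, s} \<le> 3" by (simp add: card_insert_if)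
  ultimately show ?thesis by simp
qed

text \<open>Every 3-set other than the four triangles meets one of them in two elements. If it had
  rank 2 it would coincide with that triangle by \<open>triangles_eq\<close>.\<close>

lemma k4_minor:
  assumes simple: "\<And>x y. x \<in> E \<Longrightarrow> y \<in> E \<Longrightarrow> x \<noteq> y \<Longrightarrow> r {x, y} = 2"
    and no: "\<not> has_rank_minor E r (sparse_paving 2 {..<4::nat} {})"
    and E: "E = {e, a, c, b, d, f}" "distinct [e, a, c, b, d, f]" "r E \<le> 3"
    and tri: "r {e, a, c} = 2" "r {e, b, d} = 2" "r {a, b, f} = 2" "r {c, d, f} = 2"
  shows "has_rank_minor E r (sparse_paving 3 {..<6} k4_triangles)"
proof -
  let ?g = "nth [e, a, c, b, d, f]"
  have img: "?g ` {..<6} = E" unfolding lessThan_6 E(1) by simp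
  have inj: "inj_on ?g {..<6}" using E(2) inj_on_nth[of "[e, a, c, b, d, f]" "{..<6}"] by auto
  have crd: "card (?g ` A) = card A" "?g ` A \<subseteq> E" if "A \<subseteq> {..<6}" for A
    using card_image[OF inj_on_subset[OF inj that]] image_mono[OF that, of ?g] img by auto
  have t: "A \<subseteq> {..<6}" "card A = 3" "r (?g ` A) = 2" if "A \<in> k4_triangles" for A
  proof -
    show "A \<subseteq> {..<6}" "card A = 3" using that sparse_k4 by (auto simp: sparse_def)
    show "r (?g ` A) = 2" using that tri unfolding k4_triangles_def by (auto simp: numeral_eq_Suc)
  qed
  show ?thesis
  proof (rule has_rank_minor_sparse_pavingI[OF sparse_k4 _ inj])
    show "{} \<subseteq> E" by simp
    show "?g ` {..<6} \<subseteq> E - {}" using img by simp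
    show "r (?g ` {..<6} \<union> {}) \<le> r {} + int 3" using img E(3) r_empty by simp
    fix A :: "nat set" assume A: "A \<subseteq> {..<6}" "card A = 3"
    have "r (?g ` A) = 3" if nA: "A \<notin> k4_triangles"
    proof (rule ccontr)
      assume ne: "r (?g ` A) \<noteq> 3"
      have "\<forall>A\<in>Pow {..<6}. card A = 3 \<longrightarrow> A \<notin> k4_triangles \<longrightarrow> (\<exists>L\<in>k4_triangles. card (A \<inter> L) = 2)"
        unfolding k4_triangles_def by code_simp
      then obtain L where L: "L \<in> k4_triangles" "card (A \<inter> L) = 2" using A nA by blast
      then obtain i j where ij: "A \<inter> L = {i, j}" "i \<noteq> j" by (meson card_2_iff)
      then have s: "i \<in> A" "j \<in> A" "i \<in> L" "j \<in> L" by auto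
      then have gne: "?g i \<noteq> ?g j" using inj_onD[OF inj, of i j] ij(2) A(1) by auto
      have gs: "{?g i, ?g j} \<subseteq> ?g ` A \<inter> ?g ` L" using s by auto
      have "r {?g i, ?g j} = 2" using simple[OF _ _ gne] gs crd(2)[OF A(1)] by auto
      then have "2 \<le> r (?g ` A)" using r_mono[of "{?g i, ?g j}" "?g ` A"] gs crd(2)[OF A(1)] by auto
      moreover have "r (?g ` A) \<le> 3" using r_card[OF crd(2)[OF A(1)]] crd(1)[OF A(1)] A(2) by simp
      ultimately have "r (?g ` A) = 2" using ne by linarith
      then have "?g ` A = ?g ` L"
        using triangles_eq[OF simple no crd(2)[OF A(1)] crd(2)[OF t(1)[OF L(1)]] _ _ _ t(3)[OF L(1)] gne gs]
          crd(1)[OF A(1)] crd(1)[OF t(1)[OF L(1)]] A(2) t(2)[OF L(1)] by simp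
      then have "A = L" using inj_on_image_eq_iff[OF inj A(1) t(1)[OF L(1)]] by blast
      then show False using nA L by simp
    qed
    then show "r (?g ` A \<union> {}) = r {} + int 3 \<longleftrightarrow> A \<notin> k4_triangles"
      using t(3)[of A] r_empty by auto
  qed
qed

end

context rank_function
begin

text \<open>On \<open>E - {e}\<close> the function \<open>dual_rank E r\<close> is the rank function
  of the dual of the contraction by \<open>e\<close>, and duality preserves connectivity. Orderings
  of contractions thus serve as orderings of deletions from the dual.\<close>

lemma dual_rank_delete:
  assumes "e \<in> E" "width1 (E - {e}) (contract_rank r {e}) es"
  shows "width1 (E - {e}) (dual_rank E r) es"
  unfolding width1_def
proof (intro conjI allI impI)
  show es: "distinct es" "set es = E - {e}" using assms by (auto simp: width1_def)
  fix xs ys assume xy: "es = xs @ ys"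
  let ?X = "set xs"
  have X: "?X \<subseteq> E - {e}" using xy es by auto
  have "conn (E - {e}) (contract_rank r {e}) ?X \<le> 1" using width1_conn assms(2) xy by blast
  moreover have "E - {e} - ?X \<union> {e} = E - ?X" "E - {e} \<union> {e} = E" "?X \<union> {e} = E - (E - {e} - ?X)"
    using X assms(1) by auto
  moreover have "E - (E - {e}) = {e}" using assms(1) by auto
  moreover have "card (E - {e}) = card ?X + card (E - {e} - ?X)" using card_split[OF X] by auto
  ultimately show "conn (E - {e}) (dual_rank E r) ?X \<le> 1"
    unfolding conn_def contract_rank_def dual_rank_def by simp
qed

lemma k4_if_simple_cosimple:
  assumes simple: "\<And>x y. x \<in> E \<Longrightarrow> y \<in> E \<Longrightarrow> x \<noteq> y \<Longrightarrow> r {x, y} = 2"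
    and cosimple: "\<And>x y. x \<in> E \<Longrightarrow> y \<in> E \<Longrightarrow> x \<noteq> y \<Longrightarrow> dual_rank E r {x, y} = 2"
    and conn: "\<And>S. S \<subseteq> E \<Longrightarrow> S \<noteq> {} \<Longrightarrow> S \<noteq> E \<Longrightarrow> 0 < conn E r S"
    and big: "4 \<le> card E"
    and no: "\<not> has_rank_minor E r (sparse_paving 2 {..<4::nat} {})"
    and del: "\<And>x. x \<in> E \<Longrightarrow> \<exists>es. width1 (E - {x}) r es"
    and con: "\<And>x. x \<in> E \<Longrightarrow> \<exists>es. width1 (E - {x}) (contract_rank r {x}) es"
  shows "has_rank_minor E r (sparse_paving 3 {..<6} k4_triangles)"
proof -
  interpret d: rank_function E "dual_rank E r" by (rule dual)
  have dd: "dual_rank E (dual_rank E r) A = r A" if "A \<subseteq> E" for A using dual_dual that .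
  have no': "\<not> has_rank_minor E (dual_rank E r) (sparse_paving 2 {..<4::nat} {})"
    using u24_minor_dual no by blast
  have cosimple': "dual_rank E (dual_rank E r) {x, y} = 2" if "x \<in> E" "y \<in> E" "x \<noteq> y" for x y
    using dd[of "{x, y}"] simple[OF that] that by simp
  \<comment> \<open>On four elements, dual rank at least 2 gives rank at most 2, and a simple
    matroid of that rank on four elements is \<open>U\<^sub>2\<^sub>,\<^sub>4\<close>.\<close>
  have "card E \<noteq> 4"
  proof
    assume c: "card E = 4"
    obtain x y where xy: "x \<in> E" "y \<in> E" "x \<noteq> y"
      using card_le_Suc0_iff_eq[OF finite_E] big by force
    have "dual_rank E r {x, y} \<le> dual_rank E r E" by (rule d.r_mono) (use xy in auto)
    then have "r E \<le> 2" using cosimple[OF xy] c r_empty by (simp add: dual_rank_def)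
    then have "has_rank_minor E r (sparse_paving 2 {..<4::nat} {})"
      by (intro u24_minor[of "{}" E]) (use c simple r_empty in auto)
    then show False using no by simp
  qed
  then have big5: "5 \<le> card E" using big by simp
  then obtain e0 where e0: "e0 \<in> E" by fastforce
  let ?T = "{A. A \<subseteq> E \<and> card A = 3 \<and> r A = 2}"
  let ?K = "{A. A \<subseteq> E \<and> card A = 3 \<and> dual_rank E r A = 2}"
  obtain a b c d f where cfg: "distinct [e0, a, c, b, d, f]"
    "{e0, a, c} \<in> ?T" "{e0, b, d} \<in> ?T" "{a, b, f} \<in> ?T" "{c, d, f} \<in> ?T"
    "{e0, a, b} \<in> ?K" "{e0, c, d} \<in> ?K" "{a, c, f} \<in> ?K"
  proof (rule k4_configuration[of ?T ?K E e0])
    show "card (A \<inter> B) \<noteq> 1" if "A \<in> ?T" "B \<in> ?K" for A B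
      using triangle_triad_ortho[OF simple cosimple, of A B] that by blast
    show "?T \<inter> ?K = {}"
    proof (rule ccontr)
      assume "?T \<inter> ?K \<noteq> {}"
      then obtain A where "A \<subseteq> E" "card A = 3" "r A = 2" "dual_rank E r A = 2" by blast
      from triangle_not_triad[OF simple cosimple no this] show False .
    qed
    show "A = B" if "A \<in> ?T" "B \<in> ?T" "x \<noteq> y" "{x, y} \<subseteq> A \<inter> B" for A B x y
      using triangles_eq[OF simple no, of A B x y] that by blast
    show "A = B" if "A \<in> ?K" "B \<in> ?K" "x \<noteq> y" "{x, y} \<subseteq> A \<inter> B" for A B x y
      using d.triangles_eq[OF cosimple no', of A B x y] that by blast
    show "\<exists>A\<in>?K. \<exists>B\<in>?K. A \<inter> B = {x}" if x: "x \<in> E" for x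
    proof -
      obtain es where es: "width1 (E - {x}) r es" using del[OF x] by blast
      show ?thesis using two_triads[OF simple cosimple x big5 es] by blast
    qed
    show "\<exists>A\<in>?T. \<exists>B\<in>?T. A \<inter> B = {x}" if x: "x \<in> E" for x
    proof -
      obtain es where "width1 (E - {x}) (contract_rank r {x}) es" using con[OF x] by blast
      then have "width1 (E - {x}) (dual_rank E r) es" by (rule dual_rank_delete[OF x])
      from d.two_triads[OF cosimple cosimple' x big5 this] obtain A B where
        "A \<subseteq> E" "card A = 3" "dual_rank E (dual_rank E r) A = 2"
        "B \<subseteq> E" "card B = 3" "dual_rank E (dual_rank E r) B = 2" "A \<inter> B = {x}" by blast
      then have "A \<in> ?T" "B \<in> ?T" using dd by auto
      then show ?thesis using \<open>A \<inter> B = {x}\<close> by blast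
    qed
    show "e0 \<in> E" by fact
  qed auto
  let ?Z = "{e0, a, c, b, d, f}"
  have ZE: "?Z \<subseteq> E" using cfg by auto
  have r2: "r {x, y} = 2" "dual_rank E r {x, y} = 2" if "x \<in> ?Z" "y \<in> ?Z" "x \<noteq> y" for x y
    using simple cosimple that ZE by auto
  \<comment> \<open>The triangles put \<open>c\<close>, \<open>d\<close>, \<open>f\<close> on the
    lines through two of \<open>e0\<close>, \<open>a\<close>, \<open>b\<close>. In the dual, the
    triads put \<open>b\<close>, \<open>d\<close>, \<open>f\<close> on the lines through two of
    \<open>e0\<close>, \<open>a\<close>, \<open>c\<close>.\<close>
  have "r {e0, a, b, c, d, f} \<le> 3"
    by (rule rank_six_le_3) (use cfg r2[of e0 a] r2[of e0 b] r2[of a b] ZE in auto)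
  moreover have "dual_rank E r {e0, a, c, b, d, f} \<le> 3"
    by (rule d.rank_six_le_3)
      (use cfg r2[of e0 a] r2[of e0 c] r2[of a c] ZE in auto)
  moreover have "{e0, a, b, c, d, f} = ?Z" by auto
  ultimately have rZ: "r ?Z \<le> 3" "dual_rank E r ?Z \<le> 3" by auto
  have "card ?Z = 6" using cfg(1) by auto
  \<comment> \<open>A nonempty set with connectivity at most 3 + 3 - 6 cannot be proper in a
    connected matroid.\<close>
  then have "conn E r ?Z \<le> 0" using conn_via_dual[OF ZE] rZ by simp
  then have Z: "E = ?Z" using conn[OF ZE] by force
  show ?thesis
    by (rule k4_minor[OF simple no Z cfg(1)]) (use Z rZ cfg in auto)
qed

end

section \<open>The induction and the characterization\<close>

lemma width1_if_no_excluded_minor: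
  assumes "rank_function E r"
    and "\<not> has_rank_minor E r (sparse_paving 2 {..<4::nat} {})"
    and "\<not> has_rank_minor E r (sparse_paving 3 {..<6} k4_triangles)"
    and "\<not> has_rank_minor E r (sparse_paving 4 {..<6} k23_cycles)"
    and "\<not> has_rank_minor E r (sparse_paving 2 {..<6} pairs)"
  shows "\<exists>es. width1 E r es"
  using assms
proof (induction "card E" arbitrary: E r rule: less_induct)
  case less
  interpret rank_function E r by fact
  interpret d: rank_function E "dual_rank E r" by (rule dual)
  have IH: "\<exists>es. width1 S (contract_rank r C) es" if "C \<union> S \<subseteq> E" "C \<inter> S = {}" "S \<noteq> E" for C S
  proof (rule less.hyps)
    show "card S < card E" using that finite_E by (intro psubset_card_mono) auto
    show "rank_function S (contract_rank r C)" using contract that(1) .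
  qed (use has_rank_minor_minor[OF that(1,2)] less.prems in blast)+
  have IHr: "\<exists>es. width1 S r es" if "S \<subseteq> E" "S \<noteq> E" for S
    using IH[of "{}" S] that contract_rank_empty[of r, OF r_empty] by simp
  show ?case
  proof (cases "card E \<le> 3")
    case True
    then show ?thesis by (rule width1_small)
  next
    case big: False
    show ?thesis
    proof (cases "\<exists>S. S \<subseteq> E \<and> S \<noteq> {} \<and> S \<noteq> E \<and> conn E r S \<le> 0")
      case True
      then obtain S where S: "S \<subseteq> E" "S \<noteq> {}" "S \<noteq> E" "conn E r S \<le> 0" by blast
      obtain es fs where "width1 S r es" "width1 (E - S) r fs"
        using IHr[OF S(1,3)] IHr[of "E - S"] S by blast
      then show ?thesis using width1_append[OF S(1,4)] by blast
    next
      case False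
      then have conn: "0 < conn E r S" if "S \<subseteq> E" "S \<noteq> {}" "S \<noteq> E" for S
        using that by (meson linorder_not_le)
      have conn': "0 < conn E (dual_rank E r) S" if "S \<subseteq> E" "S \<noteq> {}" "S \<noteq> E" for S
        using conn[OF that] conn_dual[OF that(1)] by simp
      have ne: "{x} \<noteq> E" for x using big by auto
      \<comment> \<open>A loop would be a separator, and \<open>E\<close> has further elements;
        dually, a coloop would be one.\<close>
      have one: "r {x} = 1" if "x \<in> E" for x
      proof -
        have "0 < conn E r {x}" by (rule conn) (use ne that in auto)
        moreover have "r (E - {x}) \<le> r E" by (rule r_mono) auto
        ultimately show ?thesis using r_single_le[OF that] unfolding conn_def by linarith
      qed
      have one': "dual_rank E r {x} = 1" if "x \<in> E" for x
      proof -
        have "0 < conn E (dual_rank E r) {x}" by (rule conn') (use ne that in auto)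
        moreover have "dual_rank E r (E - {x}) \<le> dual_rank E r E" by (rule d.r_mono) auto
        ultimately show ?thesis using d.r_single_le[OF that] unfolding conn_def by linarith
      qed
      have del: "\<exists>es. width1 (E - {x}) r es" if "x \<in> E" for x using IHr[of "E - {x}"] that by blast
      have con: "\<exists>es. width1 (E - {x}) (contract_rank r {x}) es" if "x \<in> E" for x
        using IH[of "{x}" "E - {x}"] that by blast
      show ?thesis
      proof (cases "\<exists>e f. e \<in> E \<and> f \<in> E \<and> e \<noteq> f \<and> r {e, f} \<noteq> 2")
        case True
        then obtain e f where ef: "e \<in> E" "f \<in> E" "e \<noteq> f" "r {e, f} \<noteq> 2" by blast
        have "r {e, f} = 1"
          using ef one r_mono[of "{e}" "{e, f}"] r_card[of "{e, f}"] by auto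
        moreover obtain es where "width1 (E - {e}) r es" using del[OF ef(1)] by blast
        ultimately show ?thesis
          by (rule width1_parallel[OF ef(1-3) one[OF ef(1)] one[OF ef(2)] _ _ conn less.prems(5)])
      next
        case simple: False
        show ?thesis
        proof (cases "\<exists>e f. e \<in> E \<and> f \<in> E \<and> e \<noteq> f \<and> dual_rank E r {e, f} \<noteq> 2")
          case True
          then obtain e f where ef: "e \<in> E" "f \<in> E" "e \<noteq> f" "dual_rank E r {e, f} \<noteq> 2" by blast
          have "dual_rank E r {e, f} = 1"
            using ef one' d.r_mono[of "{e}" "{e, f}"] d.r_card[of "{e, f}"] by auto
          moreover obtain es where "width1 (E - {e}) (contract_rank r {e}) es" using con[OF ef(1)] by blast
          then have "width1 (E - {e}) (dual_rank E r) es" by (rule dual_rank_delete[OF ef(1)])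
          \<comment> \<open>For a series pair the argument runs in the dual, where a triangle with
            doubled edges corresponds to an \<open>M(K\<^sub>2\<^sub>,\<^sub>3)\<close> minor of the
            matroid itself.\<close>
          moreover have "\<not> has_rank_minor E (dual_rank E r) (sparse_paving 2 {..<6} pairs)"
          proof
            assume "has_rank_minor E (dual_rank E r) (sparse_paving 2 {..<6} pairs)"
            then have "has_rank_minor E r (dual (sparse_paving 2 {..<6} pairs))"
              by (rule has_rank_minor_dual) (simp add: sparse_paving_def)
            then show False using less.prems(4) by (simp add: dual_pairs)
          qed
          ultimately have "\<exists>es. width1 E (dual_rank E r) es"
            by (intro d.width1_parallel[OF ef(1-3) one'[OF ef(1)] one'[OF ef(2)] _ _ conn'])
          then show ?thesis using width1_dual by blast
        next
          case False
          then have "has_rank_minor E r (sparse_paving 3 {..<6} k4_triangles)"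
            by (intro k4_if_simple_cosimple[OF _ _ conn _ less.prems(2) del con])
              (use simple big in \<open>auto simp: not_le\<close>)
          then show ?thesis using less.prems(3) by simp
        qed
      qed
    qed
  qed
qed

theorem theorem4p2:
  fixes M :: "'a set_system"
  assumes "matroid M"
  shows "M \<in> pathwidth_class 1 TYPE('f::{field,finite}) \<longleftrightarrow>
    \<not> has_minor_iso M (uniform_matroid 2 4) \<and>
    \<not> has_minor_iso M (cycle_matroid (complete_graph 4)) \<and>
    \<not> has_minor_iso M (cycle_matroid (complete_bipartite_graph 2 3)) \<and>
    \<not> has_minor_iso M (dual (cycle_matroid (complete_bipartite_graph 2 3)))"
proof -
  interpret matroid M by fact
  let ?E = "ground M" and ?r = "\<lambda>X. int (rank M X)"
  interpret rank_function ?E ?r by (rule rank_function)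
  have minor: "has_minor_iso M N \<longleftrightarrow> has_rank_minor ?E ?r N" for N :: "'b set_system"
    using has_minor_iso_matroid_of_rank[of N] eq_matroid_of_rank by simp
  have rep: "representable TYPE('f) M" if es: "width1 ?E ?r es" for es
  proof -
    obtain n and v :: "'a \<Rightarrow> nat \<Rightarrow> 'f" where "represents ?E ?r n v"
      using width1_represents[OF rank_function es] by blast
    then show ?thesis unfolding representable_def represents_def using indep_iff_rank by auto
  qed
  \<comment> \<open>An ordering of width one already yields a representation, so membership depends
    on the ordering alone and not on the field.\<close>
  have "M \<in> pathwidth_class 1 TYPE('f) \<longleftrightarrow> (\<exists>es. width1 ?E ?r es)"
    using rep pathwidth_le_1_iff assms by (auto simp: pathwidth_class_def)
  also have "\<dots> \<longleftrightarrow>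
      \<not> has_rank_minor ?E ?r (sparse_paving 2 {..<4::nat} {}) \<and>
      \<not> has_rank_minor ?E ?r (sparse_paving 3 {..<6} k4_triangles) \<and>
      \<not> has_rank_minor ?E ?r (sparse_paving 4 {..<6} k23_cycles) \<and>
      \<not> has_rank_minor ?E ?r (sparse_paving 2 {..<6} pairs)"
    using no_excluded_minor_if_width1 width1_if_no_excluded_minor[OF rank_function] by blast
  finally show ?thesis
    unfolding minor uniform_eq has_rank_minor_k4 has_rank_minor_k23 has_rank_minor_dual_k23 .
qed

end
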